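(* Let $G$ be a unimodular second-countable locally compact group containing an open compact subgroup $K_0$, and let $G^\circ$ be $G$ with the Haar measure normalized so that the measure of $K_0$ is $1$. Let $\Lambda=\Lambda(G)\subset\mathbb N$ be the multiplicative semigroup consisting of all products of indices $[K_1:K_2]$, where $K_1\supset K_2$ are open compact subgroups of $G$. Then the set $\operatorname{Polh}_\Lambda(G^\circ,G^\circ)$, consisting of $0$ and of all nonzero $R^\circ\in\operatorname{Polh}(G^\circ,G^\circ)$ such that $\alpha(R^\circ)^{-1}\in\Lambda$ and $\beta(R^\circ)^{-1}\in\Lambda$, is a compact subsemigroup in $\operatorname{Polh}(G^\circ,G^\circ)$.
   Context: All locally compact groups are second countable. $G^\circ=(G,\gamma)$, $H^\circ=(H,\eta)$, etc. denote unimodular groups with fixed Haar measures. The set $\operatorname{Polh}(G^\circ,H^\circ)$ of polyhomomorphisms consists of: the zero measure $0_{G,H}$ on $G\times H$; and all pairs $R^\circ=(R,\rho)$ where $R\subset G\times H$ is a closed subgroup and $\rho$ is a Haar measure on $R$ whose image under the projection to $G$ is dominated by $\gamma$ (i.e. the $\rho$-measure of $R\cap(A\times H)$ is $\le\gamma(A)$ for all Borel $A$) and whose image under the projection to $H$ is dominated by $\eta$. For a subgroup $R\subset G\times H$: $\operatorname{dom}R$, $\operatorname{im}R$ are its projections to $G$ and $H$; $\ker R=\{g:(g,1)\in R\}$; $\operatorname{indef}R=\{h:(1,h)\in R\}$. For nonzero $R^\circ$ the image of $\rho$ in $G$ equals $\alpha(R^\circ)\gamma|_{\operatorname{dom}R}$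 and the image in $H$ equals $\beta(R^\circ)\eta|_{\operatorname{im}R}$, with constants $0<\alpha(R^\circ),\beta(R^\circ)\le1$. Product: for nonzero $R^\circ\in\operatorname{Polh}(G^\circ,H^\circ)$, $T^\circ\in\operatorname{Polh}(H^\circ,K^\circ)$ the product $S^\circ=T^\circ R^\circ$ has underlying subgroup $S=TR=\{(g,k): \exists h\in H,\ (g,h)\in R,\ (h,k)\in T\}\subset G\times K$, with Haar measure normalized by $$\alpha(S^\circ)=\frac{\alpha(R^\circ)\alpha(T^\circ)}{[\operatorname{indef}R:(\operatorname{indef}R\cap\operatorname{dom}T)]},\qquad \beta(S^\circ)=\frac{\beta(R^\circ)\beta(T^\circ)}{[\ker T:(\ker T\cap\operatorname{im}R)]}.$$ A product with a zero factor is zero. Topology: regard each polyhomomorphism as a measure on $G\times H$. A sequence $R_j^\circ=(R_j,\rho_j)$ converges to $R^\circ=(R,\rho)$ if $\int\theta\,d\rho_j\to\int\theta\,d\rho$ for every $\theta\in C_c(G\times H)$; convergence to $0$ means that all these integrals tend to $0$. This convergence is metrizable and makes $\operatorname{Polh}(G^\circ,H^\circ)$ a compact space. *)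

theory Defs
  imports "HOL-Analysis.Analysis" "HOL-Library.Set_Algebras"
begin

section \<open>Subgroups, indices and Haar measures\<close>

text \<open>
  Groups are rendered by the library class \<open>topological_group_add\<close>. Despite the additive
  notation that class does not assume commutativity: \<open>x + y\<close> is the product \<open>xy\<close>, \<open>- x\<close> the
  inverse and \<open>0\<close> the unit; \<open>a +o B\<close> is the left coset \<open>aB\<close>. The operations on
  \<open>'a \<times> 'b\<close> are componentwise, so this type is the direct product group.
\<close>

definition is_subgroup :: "'g::group_add set \<Rightarrow> bool" where
  "is_subgroup R \<longleftrightarrow> 0 \<in> R \<and> (\<forall>x\<in>R. \<forall>y\<in>R. x + y \<in> R) \<and> (\<forall>x\<in>R. - x \<in> R)"

text \<open>The value is \<open>0\<close> when there are infinitely many cosets.\<close>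

definition subgroup_index :: "'g::group_add set \<Rightarrow> 'g set \<Rightarrow> nat" where
  "subgroup_index A B = card ((\<lambda>a. a +o B) ` A)"

text \<open>
  A measure on a closed subgroup \<open>R\<close> is represented by its extension by zero to a Borel measure
  on the ambient group. The groups considered are second countable, locally compact and Hausdorff,
  where a Borel measure that is finite on compact sets is automatically regular, and where a
  nonzero invariant one is automatically positive on nonempty relatively open subsets of \<open>R\<close>.
\<close>

definition haar_measure_on :: "'g::{group_add,topological_space} set \<Rightarrow> 'g measure \<Rightarrow> bool" where
  "haar_measure_on R \<rho> \<longleftrightarrow>
     sets \<rho> = sets borel \<and>
     emeasure \<rho> (- R) = 0 \<and>
     emeasure \<rho> R \<noteq> 0 \<and>
     (\<forall>K. compact K \<longrightarrow> emeasure \<rho> K < \<infinity>) \<and>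
     (\<forall>r\<in>R. \<forall>A\<in>sets borel. emeasure \<rho> ((\<lambda>x. r + x) ` A) = emeasure \<rho> A)"

definition unimodular_haar :: "'g::{group_add,topological_space} measure \<Rightarrow> bool" where
  "unimodular_haar \<gamma> \<longleftrightarrow>
     haar_measure_on UNIV \<gamma> \<and>
     (\<forall>r. \<forall>A\<in>sets borel. emeasure \<gamma> ((\<lambda>x. x + r) ` A) = emeasure \<gamma> A)"

section \<open>Polyhomomorphisms\<close>

text \<open>
  The domain and image of a subgroup \<open>R \<subseteq> G \<times> H\<close> are \<^term>\<open>Domain R\<close> and \<^term>\<open>Range R\<close>,
  and the product \<open>TR\<close> of subgroups is the relational composition \<open>R O T\<close>.
\<close>

definition ker_rel :: "('a::group_add \<times> 'b::group_add) set \<Rightarrow> 'a set" where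
  "ker_rel R = {g. (g, 0) \<in> R}"

definition indef_rel :: "('a::group_add \<times> 'b::group_add) set \<Rightarrow> 'b set" where
  "indef_rel R = {h. (0, h) \<in> R}"

datatype ('a, 'b) polyhom =
  ZeroPolh
| Polyhom "('a \<times> 'b) set" "('a \<times> 'b) measure"

definition Polh ::
  "'a::{group_add,topological_space} measure \<Rightarrow> 'b::{group_add,topological_space} measure
     \<Rightarrow> ('a, 'b) polyhom set" where
  "Polh \<gamma> \<eta> = insert ZeroPolh
     {Polyhom R \<rho> | R \<rho>.
        is_subgroup R \<and> closed R \<and> haar_measure_on R \<rho> \<and>
        (\<forall>A\<in>sets borel. emeasure \<rho> (R \<inter> (A \<times> UNIV)) \<le> emeasure \<gamma> A) \<and>
        (\<forall>B\<in>sets borel. emeasure \<rho> (R \<inter> (UNIV \<times> B)) \<le> emeasure \<eta> B)}"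

definition polh_alpha :: "'a::topological_space measure \<Rightarrow> ('a \<times> 'b) set \<Rightarrow> ('a \<times> 'b) measure \<Rightarrow> real" where
  "polh_alpha \<gamma> R \<rho> = (THE a. 0 < a \<and>
     (\<forall>A\<in>sets borel. emeasure \<rho> (A \<times> UNIV) = ennreal a * emeasure \<gamma> (A \<inter> Domain R)))"

definition polh_beta :: "'b::topological_space measure \<Rightarrow> ('a \<times> 'b) set \<Rightarrow> ('a \<times> 'b) measure \<Rightarrow> real" where
  "polh_beta \<eta> R \<rho> = (THE b. 0 < b \<and>
     (\<forall>B\<in>sets borel. emeasure \<rho> (UNIV \<times> B) = ennreal b * emeasure \<eta> (B \<inter> Range R)))"

text \<open>\<open>polh_mult \<gamma> \<eta> \<kappa> T R\<close> is the product \<open>TR\<close> of \<open>R\<close> from \<open>G\<close> to \<open>H\<close> and \<open>T\<close> from \<open>H\<close> to \<open>K\<close>.\<close>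

fun polh_mult ::
  "'a::{group_add,topological_space} measure \<Rightarrow> 'b::{group_add,topological_space} measure
     \<Rightarrow> 'c::{group_add,topological_space} measure
     \<Rightarrow> ('b, 'c) polyhom \<Rightarrow> ('a, 'b) polyhom \<Rightarrow> ('a, 'c) polyhom" where
  "polh_mult \<gamma> \<eta> \<kappa> (Polyhom T \<tau>) (Polyhom R \<rho>) =
     Polyhom (R O T)
       (THE \<sigma>. haar_measure_on (R O T) \<sigma> \<and>
          polh_alpha \<gamma> (R O T) \<sigma> =
            polh_alpha \<gamma> R \<rho> * polh_alpha \<eta> T \<tau>
              / real (subgroup_index (indef_rel R) (indef_rel R \<inter> Domain T)) \<and>
          polh_beta \<kappa> (R O T) \<sigma> =
            polh_beta \<eta> R \<rho> * polh_beta \<kappa> T \<tau>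
              / real (subgroup_index (ker_rel T) (ker_rel T \<inter> Range R)))"
| "polh_mult \<gamma> \<eta> \<kappa> ZeroPolh R = ZeroPolh"
| "polh_mult \<gamma> \<eta> \<kappa> T ZeroPolh = ZeroPolh"

section \<open>The topology\<close>

fun polh_measure :: "('a::topological_space, 'b::topological_space) polyhom \<Rightarrow> ('a \<times> 'b) measure" where
  "polh_measure ZeroPolh = null_measure borel"
| "polh_measure (Polyhom R \<rho>) = \<rho>"

definition test_function :: "('x::topological_space \<Rightarrow> real) \<Rightarrow> bool" where
  "test_function \<theta> \<longleftrightarrow> continuous_on UNIV \<theta> \<and> compact (closure {x. \<theta> x \<noteq> 0})"

definition polh_converges ::
  "(nat \<Rightarrow> ('a::topological_space, 'b::topological_space) polyhom) \<Rightarrow> ('a, 'b) polyhom \<Rightarrow> bool" where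
  "polh_converges X P \<longleftrightarrow>
     (\<forall>\<theta>. test_function \<theta> \<longrightarrow>
        (\<lambda>j. \<integral>x. \<theta> x \<partial>(polh_measure (X j))) \<longlonglongrightarrow> (\<integral>x. \<theta> x \<partial>(polh_measure P)))"

text \<open>
  The open sets are the sequentially open ones. A metrizable topology is determined in this way
  by its convergent sequences, so this is the metrizable topology defined by
  \<^const>\<open>polh_converges\<close>.
\<close>

definition polh_open ::
  "'a::{group_add,topological_space} measure \<Rightarrow> 'b::{group_add,topological_space} measure
     \<Rightarrow> ('a, 'b) polyhom set \<Rightarrow> bool" where
  "polh_open \<gamma> \<eta> U \<longleftrightarrow> U \<subseteq> Polh \<gamma> \<eta> \<and>
     (\<forall>X P. range X \<subseteq> Polh \<gamma> \<eta> \<and> P \<in> U \<and> polh_converges X P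
        \<longrightarrow> (\<forall>\<^sub>F j in sequentially. X j \<in> U))"

definition polh_topology ::
  "'a::{group_add,topological_space} measure \<Rightarrow> 'b::{group_add,topological_space} measure
     \<Rightarrow> ('a, 'b) polyhom topology" where
  "polh_topology \<gamma> \<eta> = topology (polh_open \<gamma> \<eta>)"

lemma openin_polh_topology: "openin (polh_topology \<gamma> \<eta>) = polh_open \<gamma> \<eta>"
proof -
  have "istopology (polh_open \<gamma> \<eta>)"
    unfolding istopology_def
  proof (intro conjI allI impI)
    fix S T assume "polh_open \<gamma> \<eta> S" "polh_open \<gamma> \<eta> T"
    then show "polh_open \<gamma> \<eta> (S \<inter> T)"
      unfolding polh_open_def eventually_conj_iff Int_iff by blast
  next
    fix K assume K: "\<forall>S\<in>K. polh_open \<gamma> \<eta> S"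
    show "polh_open \<gamma> \<eta> (\<Union>K)"
      unfolding polh_open_def
    proof (intro conjI allI impI)
      show "\<Union>K \<subseteq> Polh \<gamma> \<eta>"
        using K unfolding polh_open_def by blast
    next
      fix X P
      assume X: "range X \<subseteq> Polh \<gamma> \<eta> \<and> P \<in> \<Union>K \<and> polh_converges X P"
      then obtain S where S: "S \<in> K" "P \<in> S" by blast
      with K X have "\<forall>\<^sub>F j in sequentially. X j \<in> S"
        unfolding polh_open_def by blast
      then show "\<forall>\<^sub>F j in sequentially. X j \<in> \<Union>K"
        by (rule eventually_mono) (use S in blast)
    qed
  qed
  then show ?thesis
    unfolding polh_topology_def by (rule topology_inverse')
qed

lemma topspace_polh_topology: "topspace (polh_topology \<gamma> \<eta>) = Polh \<gamma> \<eta>"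
  unfolding topspace_def openin_polh_topology
  by (auto simp: polh_open_def image_subset_iff intro!: exI[of _ "Polh \<gamma> \<eta>"])

section \<open>The semigroup of indices and the associated polyhomomorphisms\<close>

inductive_set index_semigroup :: "'g::{group_add,topological_space} itself \<Rightarrow> nat set"
  for G :: "'g itself" where
  index: "\<lbrakk>is_subgroup K1; is_subgroup K2; open K1; compact K1; open K2; compact K2;
           (K2 :: 'g set) \<subseteq> K1\<rbrakk> \<Longrightarrow> subgroup_index K1 K2 \<in> index_semigroup G"
| mult: "\<lbrakk>m \<in> index_semigroup G; n \<in> index_semigroup G\<rbrakk> \<Longrightarrow> m * n \<in> index_semigroup G"

definition Polh_Lambda :: "'a::{group_add,topological_space} measure \<Rightarrow> ('a, 'a) polyhom set" where
  "Polh_Lambda \<gamma> = insert ZeroPolh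
     {Polyhom R \<rho> | R \<rho>. Polyhom R \<rho> \<in> Polh \<gamma> \<gamma> \<and>
        inverse (polh_alpha \<gamma> R \<rho>) \<in> real ` index_semigroup TYPE('a) \<and>
        inverse (polh_beta \<gamma> R \<rho>) \<in> real ` index_semigroup TYPE('a)}"

end

theory Submission
  imports Defs "HOL-Probability.Helly_Selection"
begin

text \<open>
  If \<open>(R, \<rho>)\<close> is a nonzero polyhomomorphism, the bound on the projections of \<open>\<rho>\<close> forces \<open>dom R\<close>
  and \<open>im R\<close> to be open and \<open>ker R\<close> and \<open>indef R\<close> to be compact. A compact group \<open>L\<close> normalised
  by an open subgroup has all its indices \<open>[L : L \<inter> D]\<close>, \<open>D\<close> an open subgroup, in \<open>\<Lambda>\<close>; this gives
  closure under products. For compact open subgroups \<open>U\<close> and \<open>V\<close>, counting cosets shows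
  \<open>\<rho>(U \<times> V) [indef R : indef R \<inter> V] = \<alpha>(R) \<gamma>(dom (R \<inter> (U \<times> V)))\<close>, so that \<open>\<gamma>(U) / \<rho>(U \<times> V)\<close> lies
  in \<open>\<Lambda>\<close> when \<open>\<alpha>(R)\<inverse>\<close> does. Rectangles being compact and open, \<open>\<rho>(U \<times> V)\<close> is continuous in \<open>\<rho>\<close>,
  and \<open>\<Lambda>\<close> is discrete; choosing \<open>V \<supseteq> indef R\<close> and \<open>U \<subseteq> dom (R \<inter> (U \<times> V))\<close> for the limit \<open>R\<close> of a
  sequence yields \<open>\<alpha>(R)\<inverse> \<in> \<Lambda>\<close>.

  Sequential compactness of locally bounded measures is reduced to Helly's theorem on the real line
  by a Borel code. It also provides Haar measures on closed subgroups \<open>S\<close>, as limits of the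
  normalised restrictions of an ambient Haar measure to small neighbourhoods of \<open>S\<close>.
\<close>

section \<open>Test functions\<close>

text \<open>A compact open subgroup does not make \<open>G\<close> totally disconnected:
  \<open>G\<close> may be a circle with \<open>K0 = G\<close>. Indicators of compact open sets are
  test functions, but they do not generate all of them, so Urysohn and Tietze functions are needed
  beside clopen partitions. The obstacle to compactness is that mass on the groups of a sequence may
  escape along the noncompact second factor. The image measure in \<open>G\<close> can then lose
  mass in the limit and \<alpha> can jump; the rectangle identity shows that the jump is an integer
  factor, a product of indices. The product is given by a definite description that prescribes
  \<alpha> and \<beta> at once. Its meaning rests on three facts: a Haar measure exists on the
  closed subgroup \<open>TR\<close>, it is determined by its \<alpha>, and the \<beta> forced by
  this choice is the prescribed one. The last fact is where right invariance of \<gamma> enters.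
  Passing to the converse of \<open>R\<close> exchanges \<alpha> with \<beta>, \<open>indef\<close>
  with \<open>ker\<close> and domain with range, so the main arguments are made for \<alpha>
  only.\<close>

lemma compact_closed_subset: "compact C \<Longrightarrow> closed A \<Longrightarrow> A \<subseteq> C \<Longrightarrow> compact A"
  using compact_Int_closed[of C A] by (simp add: Int_absorb1)

lemma continuous_on_indicator_clopen:
  assumes "open C" "closed C"
  shows "continuous_on UNIV (indicator C :: 'x::topological_space \<Rightarrow> real)"
proof -
  have "continuous_on (C \<union> - C) (\<lambda>x. if x \<in> C then 1 else 0 :: real)"
    using assms by (intro continuous_on_If) auto
  then show ?thesis
    by (simp add: indicator_def[abs_def] of_bool_def)
qed

text \<open>The set \<open>C\<close> is clopen, so its indicator is continuous and serves as a
  cut-off that supplies compact support.\<close>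

lemma test_function_times_indicator:
  fixes f :: "'x::t2_space \<Rightarrow> real"
  assumes "continuous_on UNIV f" "open C" "compact C"
  shows "test_function (\<lambda>x. f x * indicator C x)"
proof -
  have C: "closed C" using assms by (simp add: compact_imp_closed)
  have "closure {x. f x * indicator C x \<noteq> 0} \<subseteq> C"
    by (rule closure_minimal[OF _ C]) (auto simp: indicator_def)
  then have "compact (closure {x. f x * indicator C x \<noteq> 0})"
    using assms(3) by (intro compact_closed_subset[OF _ closed_closure])
  then show ?thesis
    unfolding test_function_def
    by (auto intro!: continuous_on_mult assms continuous_on_indicator_clopen C)
qed

lemma test_function_indicator:
  fixes C :: "'x::t2_space set"
  assumes "open C" "compact C"
  shows "test_function (indicator C :: 'x \<Rightarrow> real)"
  using test_function_times_indicator[OF continuous_on_const assms, of 1] by simp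

lemma test_function_max:
  assumes "test_function f" "test_function g"
  shows "test_function (\<lambda>x. max (f x) (g x))"
proof -
  have "closure {x. max (f x) (g x) \<noteq> 0} \<subseteq> closure {x. f x \<noteq> 0} \<union> closure {x. g x \<noteq> 0}"
    unfolding closure_Un[symmetric] by (rule closure_mono) (auto simp: max_def)
  moreover have "compact (closure {x. f x \<noteq> 0} \<union> closure {x. g x \<noteq> 0})"
    using assms by (auto simp: test_function_def)
  ultimately have "compact (closure {x. max (f x) (g x) \<noteq> 0})"
    by (intro compact_closed_subset[OF _ closed_closure])
  then show ?thesis
    using assms unfolding test_function_def by (auto intro!: continuous_on_max)
qed

lemma test_function_zero: "test_function (\<lambda>x. 0)"
  by (simp add: test_function_def)

lemma test_function_measurable:
  "test_function \<theta> \<Longrightarrow> sets M = sets borel \<Longrightarrow> \<theta> \<in> borel_measurable M"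
  unfolding test_function_def by (simp add: borel_measurable_continuous_onI cong: measurable_cong_sets)

lemma test_function_bounded:
  assumes "test_function \<theta>"
  obtains B where "\<And>x. \<bar>\<theta> x\<bar> \<le> B" "0 \<le> B"
proof -
  let ?S = "closure {x. \<theta> x \<noteq> 0}"
  have "compact (\<theta> ` ?S)"
    using assms unfolding test_function_def by (intro compact_continuous_image) (auto intro: continuous_on_subset)
  then obtain B where B: "\<And>y. y \<in> \<theta> ` ?S \<Longrightarrow> \<bar>y\<bar> \<le> B" "B > 0"
    by (metis bounded_pos compact_imp_bounded real_norm_def)
  have "\<bar>\<theta> x\<bar> \<le> B" for x
    using B closure_subset[of "{x. \<theta> x \<noteq> 0}"] by (cases "\<theta> x = 0") auto
  then show thesis using that B(2) by (meson less_imp_le)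
qed

lemma test_function_integrable:
  assumes "test_function \<theta>" "sets M = sets borel" "\<And>K. compact K \<Longrightarrow> emeasure M K < \<infinity>"
  shows "integrable M (\<theta> :: 'x::t2_space \<Rightarrow> real)"
proof -
  obtain B where B: "\<And>x. \<bar>\<theta> x\<bar> \<le> B" "0 \<le> B" by (rule test_function_bounded[OF assms(1)]) blast
  let ?S = "closure {x. \<theta> x \<noteq> 0}"
  have S: "compact ?S" using assms by (simp add: test_function_def)
  have "integrable M (\<lambda>x. B * indicator ?S x)"
    using assms(2) assms(3)[OF S] by (intro integrable_mult_right integrable_real_indicator) auto
  then show ?thesis
    by (rule Bochner_Integration.integrable_bound)
      (use B closure_subset[of "{x. \<theta> x \<noteq> 0}"] in
        \<open>auto simp: test_function_measurable assms indicator_def intro!: AE_I2\<close>)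
qed

text \<open>Stands for local compactness and sigma-compactness at once. The pieces may be empty and
  need not be small, since a compact open set can be connected; the topology inside a piece is
  handled by continuous functions.\<close>

locale compact_open_partition =
  fixes X :: "nat \<Rightarrow> 'x::{second_countable_topology,t2_space} set"
  assumes open_X: "open (X n)"
    and compact_X: "compact (X n)"
    and disj_X: "disjoint_family X"
    and Un_X: "(\<Union>n. X n) = UNIV"

lemma compact_open_partition_exists:
  assumes "\<And>x::'x::{second_countable_topology,t2_space}. \<exists>C. open C \<and> compact C \<and> x \<in> C"
  obtains X where "compact_open_partition (X :: nat \<Rightarrow> 'x::{second_countable_topology,t2_space} set)"
proof -
  obtain C :: "'x \<Rightarrow> 'x set" where C: "\<And>x. open (C x)" "\<And>x. compact (C x)" "\<And>x. x \<in> C x"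
    using assms by metis
  obtain F where F: "F \<subseteq> range C" "countable F" "\<Union>F = \<Union>(range C)"
    using Lindelof[of "range C"] C(1) by blast
  have UF: "\<Union>F = UNIV" using F(3) C(3) by auto
  then have "F \<noteq> {}" by auto
  define Y where "Y = from_nat_into F"
  have rY: "range Y = F" unfolding Y_def using F(2) \<open>F \<noteq> {}\<close> by (rule range_from_nat_into[rotated])
  then have Y: "open (Y n)" "compact (Y n)" for n
    using F(1) C(1,2) by (metis (no_types, lifting) image_iff rangeI subsetD)+
  \<comment> \<open>Compact sets are closed here, so finite unions of the \<open>Y i\<close> are
    clopen and can be removed without losing openness or compactness.\<close>
  have "open (disjointed Y n)" "compact (disjointed Y n)" for n
  proof -
    have "closed (\<Union>i\<in>{0..<n}. Y i)" using Y(2) by (auto intro: compact_imp_closed)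
    moreover have "open (\<Union>i\<in>{0..<n}. Y i)" using Y(1) by auto
    ultimately show "open (disjointed Y n)" "compact (disjointed Y n)"
      unfolding disjointed_def using Y by (auto intro: open_Diff compact_diff)
  qed
  then have "compact_open_partition (disjointed Y)"
    by unfold_locales (auto simp: disjoint_family_disjointed UN_disjointed_eq rY UF)
  then show thesis by (rule that)
qed

section \<open>Normality, and approximation of open sets by test functions\<close>

context compact_open_partition
begin

lemma closed_X: "closed (X n)"
  using compact_X by (rule compact_imp_closed)

text \<open>Regularity comes from local compactness, and a regular Lindelof space is normal. This
  makes Urysohn and Tietze available on a space with no given metric.\<close>

lemma normal_space_euclidean: "normal_space (euclidean :: 'x topology)"
proof -
  have "locally_compact_space (euclidean :: 'x topology)"
    unfolding locally_compact_space_def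
  proof
    fix x :: 'x
    obtain n where "x \<in> X n" using Un_X by blast
    then show "\<exists>U K. openin euclidean U \<and> compactin euclidean K \<and> x \<in> U \<and> U \<subseteq> K"
      using open_X compact_X by (intro exI[of _ "X n"]) auto
  qed
  then have "regular_space (euclidean :: 'x topology)"
    by (rule locally_compact_Hausdorff_imp_regular_space)
      (simp add: Hausdorff_space_def disjnt_def, metis hausdorff)
  moreover have "second_countable (euclidean :: 'x topology)"
    unfolding second_countable_def
    using ex_countable_basis[where 'a='x] topological_basisE topological_basis_open
    by (metis open_openin)
  ultimately show ?thesis
    using regular_Lindelof_imp_normal_space second_countable_imp_Lindelof_space by blast
qed

lemma regular_nbhd:
  fixes x :: 'x
  assumes "open U" "x \<in> U"
  obtains V where "open V" "x \<in> V" "closure V \<subseteq> U"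
proof -
  have "closedin euclidean {x}" "closedin euclidean (- U)" "disjnt {x} (- U)"
    using assms by (auto simp: disjnt_def)
  then obtain V W where VW: "openin euclidean V" "openin euclidean W" "{x} \<subseteq> V" "- U \<subseteq> W" "disjnt V W"
    using normal_space_euclidean unfolding normal_space_def by meson
  have "closure V \<subseteq> - W"
    using VW by (intro closure_minimal) (auto simp: disjnt_def)
  then show thesis using VW by (intro that[of V]) auto
qed

lemma urysohn_function:
  assumes "closed A" "open B" "A \<subseteq> B"
  obtains f :: "'x \<Rightarrow> real" where "continuous_on UNIV f" "\<And>x. 0 \<le> f x" "\<And>x. f x \<le> 1"
    "\<And>x. x \<in> A \<Longrightarrow> f x = 1" "\<And>x. x \<notin> B \<Longrightarrow> f x = 0"
proof -
  have "closedin euclidean A" "closedin euclidean (- B)" "disjnt (-B) A"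
    using assms by (auto simp: disjnt_def)
  then obtain f where f: "continuous_map euclidean (top_of_set {0..1::real}) f"
    "f ` (-B) \<subseteq> {0}" "f ` A \<subseteq> {1}"
    using Urysohn_lemma[OF normal_space_euclidean, of "-B" A 0 1] by auto
  show thesis
    by (rule that[of f]) (use f in \<open>auto simp: continuous_map_in_subtopology\<close>)
qed

text \<open>Urysohn functions for the countably many basic sets with closure inside
  \<open>B\<close>, cut down to the pieces, include for each point of \<open>B\<close> one with
  value 1 there; running maxima make the sequence increase. Measures of open sets are read off from
  test integrals in this way.\<close>

lemma indicator_open_limit:
  assumes "open (B :: 'x set)"
  obtains \<theta> :: "nat \<Rightarrow> 'x \<Rightarrow> real" where "\<And>n. test_function (\<theta> n)" "\<And>n x. 0 \<le> \<theta> n x" "\<And>n x. \<theta> n x \<le> 1"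
    "\<And>x. incseq (\<lambda>n. \<theta> n x)" "\<And>x. (\<lambda>n. \<theta> n x) \<longlonglongrightarrow> indicator B x"
proof -
  obtain Bs :: "'x set set" where Bs: "countable Bs" "topological_basis Bs"
    using ex_countable_basis by blast
  \<comment> \<open>The empty set keeps the family nonempty, as enumeration by
    \<open>from_nat_into\<close> requires.\<close>
  define C where "C = insert {} {b\<in>Bs. closure b \<subseteq> B}"
  have cC: "countable C" "C \<noteq> {}" using Bs by (auto simp: C_def)
  define c where "c = from_nat_into C"
  have rc: "range c = C" unfolding c_def using cC by (intro range_from_nat_into) auto
  have cl: "closure (c n) \<subseteq> B" for n
  proof -
    have "c n \<in> C" using rc by auto
    then show ?thesis by (auto simp: C_def)
  qed
  have "\<exists>f::'x \<Rightarrow> real. continuous_on UNIV f \<and> (\<forall>x. 0 \<le> f x \<and> f x \<le> 1) \<and> (\<forall>x\<in>closure (c n). f x = 1) \<and> (\<forall>x. x \<notin> B \<longrightarrow> f x = 0)" for n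
    by (rule urysohn_function[OF closed_closure assms cl[of n]]) blast
  then obtain f :: "nat \<Rightarrow> 'x \<Rightarrow> real" where f: "\<And>n. continuous_on UNIV (f n)" "\<And>n x. 0 \<le> f n x" "\<And>n x. f n x \<le> 1"
    "\<And>n x. x \<in> closure (c n) \<Longrightarrow> f n x = 1" "\<And>n x. x \<notin> B \<Longrightarrow> f n x = 0"
    by metis
  \<comment> \<open>One index runs over pairs of a basic set and a piece; the piece provides compact
    support.\<close>
  define g where "g m x = f (fst (prod_decode m)) x * indicator (X (snd (prod_decode m))) x" for m x
  have g: "test_function (g m)" "0 \<le> g m x" "g m x \<le> 1" "x \<notin> B \<Longrightarrow> g m x = 0" for m x
    unfolding g_def[abs_def]
    by (rule test_function_times_indicator) (use f open_X compact_X in \<open>auto simp: indicator_def\<close>)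
  define \<theta> where "\<theta> = rec_nat (\<lambda>x. 0) (\<lambda>n h x. max (h x) (g n x))"
  have \<theta>_0: "\<theta> 0 = (\<lambda>x. 0)" and \<theta>_Suc: "\<theta> (Suc n) = (\<lambda>x. max (\<theta> n x) (g n x))" for n
    by (simp_all add: \<theta>_def)
  have tf: "test_function (\<theta> n)" for n
    by (induction n) (simp_all add: \<theta>_0 \<theta>_Suc test_function_zero test_function_max g(1))
  have bd: "0 \<le> \<theta> n x" "\<theta> n x \<le> 1" "x \<notin> B \<Longrightarrow> \<theta> n x = 0" for n x
    by (induction n) (simp_all add: \<theta>_0 \<theta>_Suc g max_def)
  have inc: "incseq (\<lambda>n. \<theta> n x)" for x
    by (rule incseq_SucI) (simp add: \<theta>_Suc)
  have lim: "(\<lambda>n. \<theta> n x) \<longlonglongrightarrow> indicator B x" for x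
  proof (cases "x \<in> B")
    case False
    then show ?thesis by (simp add: bd(3))
  next
    case True
    obtain V where V: "open V" "x \<in> V" "closure V \<subseteq> B" by (rule regular_nbhd[OF assms True])
    obtain b where b: "b \<in> Bs" "x \<in> b" "b \<subseteq> V" using V Bs by (meson topological_basisE)
    then have "b \<in> C" using V closure_mono[of b V] by (auto simp: C_def)
    then obtain i where i: "c i = b" using rc by (metis imageE)
    obtain k where k: "x \<in> X k" using Un_X by blast
    have "g (prod_encode (i, k)) x = 1"
      using i b(2) k f(4)[of x i] closure_subset[of b] by (auto simp: g_def)
    then have 1: "\<theta> (Suc (prod_encode (i, k))) x = 1"
      using bd(2)[of "prod_encode (i,k)" x] by (simp add: \<theta>_Suc)
    have "\<forall>\<^sub>F n in sequentially. \<theta> n x = 1"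
      unfolding eventually_sequentially
    proof (intro exI allI impI)
      fix n assume "Suc (prod_encode (i, k)) \<le> n"
      then have "\<theta> (Suc (prod_encode (i, k))) x \<le> \<theta> n x" using inc[of x] by (simp add: incseq_def)
      then show "\<theta> n x = 1" using 1 bd(2)[of n x] by simp
    qed
    then show ?thesis using True by (simp add: tendsto_eventually)
  qed
  show thesis by (rule that[of \<theta>]) (use tf bd inc lim in auto)
qed

end

section \<open>A Borel code with continuous inverse\<close>

text \<open>The first differing digit contributes \<open>(1/3) ^ Suc p\<close> and all later digits
  together at most half of that. In base 2 the tail could cancel the difference completely.\<close>

lemma ternary_code_separates:
  fixes b b' :: "nat \<Rightarrow> bool"
  assumes "b p \<noteq> b' p" "\<And>i. i < p \<Longrightarrow> b i = b' i"
  shows "(1/3) ^ Suc p / 2 \<le> \<bar>(\<Sum>n. of_bool (b n) * (1/3) ^ Suc n) - (\<Sum>n. of_bool (b' n) * (1/3) ^ Suc n :: real)\<bar>"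
proof -
  have geo: "summable (\<lambda>n. (1/3::real) ^ Suc n)"
    by (intro summable_ignore_initial_segment[where k=1, simplified] summable_geometric) simp
  have sm: "summable (\<lambda>n. of_bool (c n) * (1/3) ^ Suc n :: real)" for c
    by (rule summable_comparison_test'[OF geo, of 0]) auto
  define d where "d n = (of_bool (b n) - of_bool (b' n)) * (1/3::real) ^ Suc n" for n
  have smd: "summable d"
    unfolding d_def left_diff_distrib by (intro summable_diff sm)
  have "(\<Sum>n. of_bool (b n) * (1/3) ^ Suc n) - (\<Sum>n. of_bool (b' n) * (1/3) ^ Suc n) = suminf d"
    unfolding d_def left_diff_distrib by (intro suminf_diff sm)
  also have "suminf d = (\<Sum>n. d (n + Suc p)) + sum d {..<Suc p}"
    by (rule suminf_split_initial_segment[OF smd])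
  also have "sum d {..<Suc p} = d p"
    using assms(2) by (simp add: d_def)
  finally have eq: "(\<Sum>n. of_bool (b n) * (1/3) ^ Suc n) - (\<Sum>n. of_bool (b' n) * (1/3) ^ Suc n) = (\<Sum>n. d (n + Suc p)) + d p" .
  have dp: "\<bar>d p\<bar> = (1/3) ^ Suc p" using assms(1) by (auto simp: d_def)
  have geo': "(\<lambda>n. (1/3::real) ^ Suc (n + Suc p)) sums ((1/3) ^ Suc p / 2)"
  proof -
    have "(\<lambda>n. (1/3::real) ^ Suc (Suc p) * (1/3) ^ n) sums ((1/3) ^ Suc (Suc p) * (1 / (1 - 1/3)))"
      by (intro sums_mult geometric_sums) simp
    then show ?thesis by (simp add: power_add mult_ac)
  qed
  have "\<bar>\<Sum>n. d (n + Suc p)\<bar> \<le> (\<Sum>n. (1/3::real) ^ Suc (n + Suc p))"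
  proof -
    have le: "norm (d (n + Suc p)) \<le> (1/3::real) ^ Suc (n + Suc p)" for n
      by (auto simp: d_def abs_mult)
    have "norm (\<Sum>n. d (n + Suc p)) \<le> (\<Sum>n. (1/3::real) ^ Suc (n + Suc p))"
      by (rule norm_suminf_le[OF le]) (use geo' in \<open>simp add: sums_iff\<close>)
    then show ?thesis by simp
  qed
  then have "\<bar>\<Sum>n. d (n + Suc p)\<bar> \<le> (1/3) ^ Suc p / 2"
    using geo' by (simp add: sums_iff)
  then show ?thesis unfolding eq using dp by linarith
qed

context compact_open_partition
begin

definition piece :: "'x \<Rightarrow> nat" where "piece x = (THE n. x \<in> X n)"

lemma piece_eq: "x \<in> X n \<longleftrightarrow> piece x = n"
proof -
  have "\<exists>!n. x \<in> X n"
    using Un_X disj_X unfolding disjoint_family_on_def by blast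
  then show ?thesis unfolding piece_def by (metis (mono_tags, lifting) the1_equality theI')
qed

definition base :: "nat \<Rightarrow> 'x set" where
  "base = from_nat_into (SOME B. countable B \<and> topological_basis B)"

lemma base: "open (base n)" "open U \<Longrightarrow> x \<in> U \<Longrightarrow> \<exists>n. x \<in> base n \<and> base n \<subseteq> U"
proof -
  define B where "B = (SOME B :: 'x set set. countable B \<and> topological_basis B)"
  have "countable B \<and> topological_basis B"
    unfolding B_def using ex_countable_basis[where 'a='x] by (rule someI_ex)
  then have B: "countable B" "topological_basis B" by auto
  have "B \<noteq> {}" using topological_basisE[OF B(2) open_UNIV UNIV_I] by blast
  then have r: "range base = B" unfolding base_def B_def[symmetric] by (intro range_from_nat_into B)
  show "open (base n)" using r B(2) topological_basis_open by blast
  show "open U \<Longrightarrow> x \<in> U \<Longrightarrow> \<exists>n. x \<in> base n \<and> base n \<subseteq> U"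
    using topological_basisE[OF B(2), of U x] r by (metis imageE)
qed

text \<open>An injective Borel code of the points by reals: pieces go to intervals at mutual distance
  at least 3/2, and within a piece the ternary digits record membership in the basic open sets.\<close>

definition code :: "'x \<Rightarrow> real" where
  "code x = 2 * real (piece x) + (\<Sum>n. of_bool (x \<in> base n) * (1/3) ^ Suc n)"

text \<open>The powers \<open>(1/3) ^ Suc n\<close> add up to 1/2; this bound keeps the codes of
  distinct pieces apart.\<close>

lemma code_frac: "0 \<le> (\<Sum>n. of_bool (b n) * (1/3) ^ Suc n :: real)" "(\<Sum>n. of_bool (b n) * (1/3) ^ Suc n :: real) \<le> 1/2"
proof -
  have geo: "(\<lambda>n. (1/3::real) ^ Suc n) sums (1/2)"
    using sums_mult[OF geometric_sums[of "1/3::real"], of "1/3"] by simp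
  have sm: "summable (\<lambda>n. of_bool (b n) * (1/3) ^ Suc n :: real)"
    by (rule summable_comparison_test'[of "\<lambda>n. (1/3::real) ^ Suc n" 0]) (use geo in \<open>auto simp: sums_iff\<close>)
  show "0 \<le> (\<Sum>n. of_bool (b n) * (1/3) ^ Suc n :: real)"
    by (rule suminf_nonneg[OF sm]) simp
  have "(\<Sum>n. of_bool (b n) * (1/3) ^ Suc n :: real) \<le> (\<Sum>n. (1/3::real) ^ Suc n)"
    by (rule suminf_le[OF _ sm]) (use geo in \<open>auto simp: sums_iff\<close>)
  then show "(\<Sum>n. of_bool (b n) * (1/3) ^ Suc n :: real) \<le> 1/2" using geo by (simp add: sums_iff)
qed

lemma code_piece:
  assumes "\<bar>code x - code y\<bar> < 1" shows "piece x = piece y"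
proof (rule ccontr)
  assume "piece x \<noteq> piece y"
  then have "1 \<le> \<bar>real (piece x) - real (piece y)\<bar>" by linarith
  then show False
    using assms code_frac[of "\<lambda>n. x \<in> base n"] code_frac[of "\<lambda>n. y \<in> base n"] unfolding code_def by linarith
qed

text \<open>If the bits at \<open>m\<close> differed, the first differing bit would sit at some
  \<open>p \<le> m\<close> and separate the codes by at least \<open>(1/3) ^ Suc p / 2\<close>. So
  an approximate code decides each bit exactly.\<close>

lemma code_base:
  assumes "\<bar>code x - code y\<bar> < (1/3) ^ Suc m / 2" shows "x \<in> base m \<longleftrightarrow> y \<in> base m"
proof (rule ccontr)
  assume neq: "\<not> (x \<in> base m \<longleftrightarrow> y \<in> base m)"
  define p where "p = (LEAST p. (x \<in> base p) \<noteq> (y \<in> base p))"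
  have p: "(x \<in> base p) \<noteq> (y \<in> base p)" unfolding p_def by (rule LeastI) (rule neq)
  have "p \<le> m" unfolding p_def by (rule Least_le) (rule neq)
  have lt: "(x \<in> base i) = (y \<in> base i)" if "i < p" for i
    using not_less_Least that unfolding p_def by blast
  have le: "(1/3) ^ Suc m \<le> (1/3 :: real) ^ Suc p" using \<open>p \<le> m\<close> by (intro power_decreasing) auto
  moreover have "(1/3) ^ Suc m \<le> (1::real)" by (intro power_le_one) auto
  \<comment> \<open>Equal pieces cancel the integer parts, so that only the digit sums are
    compared.\<close>
  ultimately have "piece x = piece y" using assms by (intro code_piece) linarith
  then have "\<bar>code x - code y\<bar> \<ge> (1/3) ^ Suc p / 2"
    using ternary_code_separates[of "\<lambda>n. x \<in> base n" p "\<lambda>n. y \<in> base n", OF p lt] unfolding code_def by simp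
  then show False using le assms by linarith
qed

text \<open>Membership bits jump at the boundaries of basic sets, so the code is Borel but in
  general not continuous; continuity is established for its inverse.\<close>

lemma code_measurable [measurable]: "code \<in> borel_measurable borel"
proof -
  have 1: "piece \<in> borel \<rightarrow>\<^sub>M count_space UNIV"
  proof (rule measurable_count_space_eq2_countable[THEN iffD2], intro conjI ballI)
    fix n
    have "piece -` {n} = X n" using piece_eq by blast
    then show "piece -` {n} \<inter> space borel \<in> sets borel" using open_X by simp
  qed (auto)
  have [measurable]: "base n \<in> sets borel" for n using base(1) by simp
  have 2: "(\<lambda>x. of_bool (x \<in> base n) * (1/3) ^ Suc n :: real) \<in> borel_measurable borel" for n
    by measurable
  have "(\<lambda>x. real (piece x)) \<in> borel_measurable borel"
    using 1 by measurable
  then show ?thesis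
    unfolding code_def[abs_def] using 2 by (intro borel_measurable_add borel_measurable_times borel_measurable_suminf) auto
qed

text \<open>The sets \<open>N n\<close> of points with code near \<open>t\<close> decrease inside
  one compact piece, so their closures share a point \<open>x\<close>. Membership in each basic set
  is eventually constant on them, which by Hausdorff separation excludes a second common point, and
  compactness then drives \<open>N n\<close> into every neighbourhood of \<open>x\<close>.\<close>

lemma decode_exists:
  assumes "t \<in> closure (range code)"
  shows "\<exists>x. \<forall>U. open U \<and> x \<in> U \<longrightarrow> (\<exists>\<delta>>0. \<forall>y. \<bar>code y - t\<bar> < \<delta> \<longrightarrow> y \<in> U)"
proof -
  define N where "N n = {y. \<bar>code y - t\<bar> < (1/3) ^ Suc n / 2}" for n
  have pos: "(1/3::real) ^ Suc n / 2 > 0" for n by simp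
  have dec: "N n \<subseteq> N m" if "m \<le> n" for m n
  proof -
    have "(1/3::real) ^ Suc n \<le> (1/3) ^ Suc m" using that by (intro power_decreasing) auto
    then show ?thesis unfolding N_def by (smt (verit, best) divide_right_mono mem_Collect_eq subsetI)
  qed
  have ne: "N n \<noteq> {}" for n
  proof -
    obtain y where "dist (code y) t < (1/3) ^ Suc n / 2"
      using assms pos[of n] unfolding closure_approachable by blast
    then show ?thesis by (auto simp: N_def dist_real_def)
  qed
  obtain y0 where y0: "y0 \<in> N 0" using ne by blast
  \<comment> \<open>Two points of \<open>N 0\<close> have codes less than 1/3 apart, hence lie in
    the same piece.\<close>
  have N0: "N n \<subseteq> X (piece y0)" for n
  proof
    fix y assume "y \<in> N n"
    then have "y \<in> N 0" using dec[of 0 n] by auto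
    then have "\<bar>code y - t\<bar> < 1/6" "\<bar>code y0 - t\<bar> < 1/6" using y0 by (simp_all add: N_def)
    then have "\<bar>code y - code y0\<bar> < 1" unfolding abs_less_iff by linarith
    then show "y \<in> X (piece y0)" using code_piece piece_eq by blast
  qed
  have cN: "closure (N n) \<subseteq> X (piece y0)" for n using N0 closed_X by (rule closure_minimal)
  then have cpt: "compact (closure (N n))" for n
    using compact_X compact_closed_subset by blast
  obtain x where x: "\<And>n. x \<in> closure (N n)"
  proof -
    have "X (piece y0) \<inter> \<Inter> (range (\<lambda>n. closure (N n))) \<noteq> {}"
    proof (rule compact_imp_fip[OF compact_X])
      fix F assume "finite F" "F \<subseteq> range (\<lambda>n. closure (N n))"
      then obtain I where I: "finite I" "F = (\<lambda>n. closure (N n)) ` I"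
        by (meson finite_subset_image)
      have "N (Max (insert 0 I)) \<subseteq> closure (N n)" if "n \<in> I" for n
        using dec[of n "Max (insert 0 I)"] I(1) that closure_subset[of "N n"] by force
      then show "X (piece y0) \<inter> \<Inter> F \<noteq> {}"
        using ne[of "Max (insert 0 I)"] N0[of "Max (insert 0 I)"] unfolding I(2) by blast
    qed auto
    then show thesis using that by auto
  qed
  \<comment> \<open>The shift to \<open>Suc m\<close> matters: two points of
    \<open>N (Suc m)\<close> have codes less than \<open>(1/3) ^ Suc (Suc m)\<close> apart, which is
    below the threshold \<open>(1/3) ^ Suc m / 2\<close> of \<open>code_base\<close>; for
    \<open>N m\<close> the bound would be too large.\<close>
  have bits: "z \<in> base m \<longleftrightarrow> y \<in> base m" if "z \<in> N (Suc m)" "y \<in> N (Suc m)" for m z y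
  proof (rule code_base)
    show "\<bar>code z - code y\<bar> < (1/3) ^ Suc m / 2"
      using that unfolding N_def mem_Collect_eq abs_less_iff by simp
  qed
  have uniq: "x' = x" if "\<And>n. x' \<in> closure (N n)" for x'
  proof (rule ccontr)
    assume "x' \<noteq> x"
    then obtain U V where "open U" "open V" "x' \<in> U" "x \<in> V" "U \<inter> V = {}" by (metis hausdorff)
    then obtain k l where kl: "x' \<in> base k" "x \<in> base l" "base k \<inter> base l = {}"
      by (metis base(2) disjoint_iff subset_iff)
    have "\<exists>z. z \<in> N n \<inter> base k" "\<exists>z. z \<in> N n \<inter> base l" for n
      using that[of n] x[of n] kl base(1) by (metis closure_iff_nhds_not_empty Int_commute ex_in_conv order_refl)+
    then obtain z1 z2 where z: "z1 \<in> N (Suc (max k l))" "z1 \<in> base k" "z2 \<in> N (Suc (max k l))" "z2 \<in> base l"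
      by (metis IntE)
    then have "z1 \<in> base l" using bits[of z1 l z2] dec[of "Suc l" "Suc (max k l)"] by auto
    then show False using z kl by blast
  qed
  \<comment> \<open>If no \<open>N n\<close> were inside \<open>U\<close>, the sets
    \<open>closure (N n) - U\<close> would have the finite intersection property in the compact
    piece and yield a common point other than \<open>x\<close>.\<close>
  have "\<exists>\<delta>>0. \<forall>y. \<bar>code y - t\<bar> < \<delta> \<longrightarrow> y \<in> U" if U: "open U" "x \<in> U" for U
  proof (rule ccontr)
    assume "\<not> ?thesis"
    then have neU: "\<not> N n \<subseteq> U" for n using pos[of n] unfolding N_def by blast
    have "X (piece y0) \<inter> \<Inter> (range (\<lambda>n. closure (N n) - U)) \<noteq> {}"
    proof (rule compact_imp_fip[OF compact_X])
      fix F assume "finite F" "F \<subseteq> range (\<lambda>n. closure (N n) - U)"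
      then obtain I where I: "finite I" "F = (\<lambda>n. closure (N n) - U) ` I"
        by (meson finite_subset_image)
      have "N (Max (insert 0 I)) - U \<subseteq> closure (N n) - U" if "n \<in> I" for n
        using dec[of n "Max (insert 0 I)"] I(1) that closure_subset[of "N n"] by force
      then show "X (piece y0) \<inter> \<Inter> F \<noteq> {}"
        using neU[of "Max (insert 0 I)"] N0[of "Max (insert 0 I)"] unfolding I(2) by blast
    qed (use U in auto)
    then obtain x' where "\<And>n. x' \<in> closure (N n) - U" by auto
    then show False using uniq[of x'] U by auto
  qed
  then show ?thesis by blast
qed

text \<open>Constrained only on the closure of the range of \<open>code\<close>. Weak limits of
  image measures live on that closure, which may exceed the range.\<close>

definition decode :: "real \<Rightarrow> 'x" where
  "decode t = (SOME x. \<forall>U. open U \<and> x \<in> U \<longrightarrow> (\<exists>\<delta>>0. \<forall>y. \<bar>code y - t\<bar> < \<delta> \<longrightarrow> y \<in> U))"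

lemma decode:
  assumes "t \<in> closure (range code)" "open U" "decode t \<in> U"
  shows "\<exists>\<delta>>0. \<forall>y. \<bar>code y - t\<bar> < \<delta> \<longrightarrow> y \<in> U"
  using someI_ex[OF decode_exists[OF assms(1)]] assms(2,3) unfolding decode_def by blast

lemma decode_code: "decode (code x) = x"
proof (rule ccontr)
  assume "decode (code x) \<noteq> x"
  then obtain U V where UV: "open U" "open V" "decode (code x) \<in> U" "x \<in> V" "U \<inter> V = {}" by (metis hausdorff)
  have "code x \<in> closure (range code)" using closure_subset[of "range code"] by auto
  from decode[OF this UV(1,3)] obtain \<delta> where "\<delta> > 0" "\<And>y. \<bar>code y - code x\<bar> < \<delta> \<Longrightarrow> y \<in> U" by blast
  then have "x \<in> U" by simp
  then show False using UV by blast
qed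

text \<open>If all points with code near \<open>t\<close> lie in \<open>V\<close>, then so do the
  points with code near a nearby \<open>s\<close>. Hence \<open>decode s\<close> is in
  \<open>closure V\<close>, which regularity allows to be chosen inside \<open>U\<close>.\<close>

lemma continuous_on_decode: "continuous_on (closure (range code)) decode"
  unfolding continuous_on_topological
proof (intro ballI allI impI)
  fix t U assume t: "t \<in> closure (range code)" and U: "open U" "decode t \<in> U"
  obtain V where V: "open V" "decode t \<in> V" "closure V \<subseteq> U" by (rule regular_nbhd[OF U])
  obtain \<delta> where \<delta>: "\<delta> > 0" "\<And>y. \<bar>code y - t\<bar> < \<delta> \<Longrightarrow> y \<in> V" using decode[OF t V(1,2)] by blast
  show "\<exists>A. open A \<and> t \<in> A \<and> (\<forall>s\<in>closure (range code). s \<in> A \<longrightarrow> decode s \<in> U)"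
  proof (intro exI[of _ "ball t (\<delta>/2)"] conjI ballI impI)
    fix s assume s: "s \<in> closure (range code)" "s \<in> ball t (\<delta>/2)"
    have "decode s \<in> closure V"
      unfolding closure_iff_nhds_not_empty
    proof (intro allI impI)
      fix A W assume W: "W \<subseteq> A" "open W" "decode s \<in> W"
      obtain \<epsilon> where \<epsilon>: "\<epsilon> > 0" "\<And>y. \<bar>code y - s\<bar> < \<epsilon> \<Longrightarrow> y \<in> W" using decode[OF s(1) W(2,3)] by blast
      have "min \<epsilon> (\<delta>/2) > 0" using \<epsilon>(1) \<delta>(1) by simp
      then obtain y where y: "dist (code y) s < min \<epsilon> (\<delta>/2)"
        using s(1) unfolding closure_approachable by blast
      then have "y \<in> W" using \<epsilon>(2) by (simp add: dist_real_def)
      moreover have "y \<in> V" using y s(2) unfolding dist_real_def mem_ball abs_less_iff min_less_iff_conj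
        by (intro \<delta>(2)) (unfold abs_less_iff, linarith)
      ultimately show "V \<inter> A \<noteq> {}" using W(1) by blast
    qed
    then show "decode s \<in> U" using V by blast
  qed (use \<delta> in auto)
qed

text \<open>A form of Prokhorov's theorem. The image measures under \<open>code\<close> are tight on
  the line, where Helly's theorem gives a weak limit; it is carried by the closure of the range of
  \<open>code\<close> and is brought back by \<open>decode\<close>.\<close>

lemma prob_seq_compact:
  fixes P :: "nat \<Rightarrow> 'x measure"
  assumes P: "\<And>j. prob_space (P j)" "\<And>j. sets (P j) = sets borel"
    and tight: "\<And>\<epsilon>. \<epsilon> > 0 \<Longrightarrow> \<exists>N. \<forall>j. measure (P j) (\<Union>n\<le>N. X n) > 1 - \<epsilon>"
  obtains r :: "nat \<Rightarrow> nat" and Q where "strict_mono r" "prob_space Q" "sets Q = sets borel"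
    "\<And>f :: 'x \<Rightarrow> real. continuous_on UNIV f \<Longrightarrow> bounded (range f) \<Longrightarrow>
       (\<lambda>j. \<integral>x. f x \<partial>P (r j)) \<longlonglongrightarrow> (\<integral>x. f x \<partial>Q)"
proof -
  define \<nu> where "\<nu> j = distr (P j) borel code" for j
  have meas: "code \<in> P j \<rightarrow>\<^sub>M borel" for j
    using code_measurable P(2)[of j] by (simp cong: measurable_cong_sets)
  have rd: "real_distribution (\<nu> j)" for j
    unfolding \<nu>_def by (rule prob_space.real_distribution_distr[OF P(1) meas])
  have "tight \<nu>"
    unfolding tight_def
  proof (intro conjI allI impI rd)
    fix \<epsilon> :: real assume "\<epsilon> > 0"
    then obtain N where N: "\<And>j. measure (P j) (\<Union>n\<le>N. X n) > 1 - \<epsilon>" using tight by blast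
    \<comment> \<open>Points of the first \<open>N + 1\<close> pieces have codes between 0 and
      \<open>2 * N + 1/2\<close>.\<close>
    show "\<exists>a b. a < b \<and> (\<forall>j. 1 - \<epsilon> < measure (\<nu> j) {a<..b})"
    proof (rule exI[of _ "-1"], rule exI[of _ "2 * real N + 1"], intro conjI allI)
      fix j
      interpret prob_space "P j" by (rule P(1))
      have sub: "(\<Union>n\<le>N. X n) \<subseteq> code -` {-1<..2 * real N + 1} \<inter> space (P j)"
      proof
        fix x assume "x \<in> (\<Union>n\<le>N. X n)"
        then have "real (piece x) \<le> real N" by (auto simp: piece_eq)
        then have "code x \<in> {-1<..2 * real N + 1}"
          using code_frac[of "\<lambda>n. x \<in> base n"] unfolding code_def by auto
        then show "x \<in> code -` {-1<..2 * real N + 1} \<inter> space (P j)"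
          using sets_eq_imp_space_eq[OF P(2)[of j]] by simp
      qed
      have "measure (P j) (\<Union>n\<le>N. X n) \<le> measure (P j) (code -` {-1<..2 * real N + 1} \<inter> space (P j))"
        using meas[of j] by (intro finite_measure_mono[OF sub]) auto
      also have "\<dots> = measure (\<nu> j) {-1<..2 * real N + 1}"
        unfolding \<nu>_def by (rule measure_distr[symmetric]) (use meas in auto)
      finally show "1 - \<epsilon> < measure (\<nu> j) {-1<..2 * real N + 1}" using N[of j] by linarith
    qed simp
  qed
  from tight_imp_convergent_subsubsequence[OF this strict_mono_id]
  obtain r M where r: "strict_mono r" and M: "real_distribution M" and conv: "weak_conv_m (\<nu> \<circ> r) M"
    unfolding comp_id by blast
  interpret M: real_distribution M by (rule M)
  define C where "C = closure (range code)"
  have clC: "closed C" by (simp add: C_def)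
  have codeC: "code x \<in> C" for x using closure_subset[of "range code"] by (auto simp: C_def)
  have neC: "C \<noteq> {}" using codeC by blast
  have lim: "(\<lambda>j. \<integral>x. F (code x) \<partial>P (r j)) \<longlonglongrightarrow> (\<integral>t. F t \<partial>M)"
    if F: "continuous_on UNIV F" "\<And>t. \<bar>F t\<bar> \<le> B" for F :: "real \<Rightarrow> real" and B
  proof -
    have "(\<lambda>j. integral\<^sup>L ((\<nu> \<circ> r) j) F) \<longlonglongrightarrow> integral\<^sup>L M F"
    proof (rule weak_conv_imp_integral_bdd_continuous_conv[where B=B])
      show "real_distribution ((\<nu> \<circ> r) n)" for n using rd by simp
      show "isCont F x" for x using F(1) by (simp add: continuous_on_eq_continuous_at)
    qed (use M conv F in \<open>auto simp: comp_def\<close>)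
    moreover have "integral\<^sup>L ((\<nu> \<circ> r) j) F = (\<integral>x. F (code x) \<partial>P (r j))" for j
      unfolding \<nu>_def comp_def using F(1) by (intro integral_distr meas borel_measurable_continuous_onI)
    ultimately show ?thesis by simp
  qed
  have AEC: "AE t in M. t \<in> C"
  proof -
    \<comment> \<open>A bounded continuous function that vanishes on all codes and is positive off
      \<open>C\<close>; its limit integral 0 shows that \<open>M\<close> is carried by
      \<open>C\<close>.\<close>
    define \<phi> where "\<phi> t = min 1 (infdist t C)" for t
    have \<phi>: "continuous_on UNIV \<phi>" "\<bar>\<phi> t\<bar> \<le> 1" "0 \<le> \<phi> t" for t
      unfolding \<phi>_def[abs_def] by (auto intro!: continuous_intros simp: infdist_nonneg)
    have z: "\<phi> (code x) = 0" for x using codeC[of x] by (simp add: \<phi>_def)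
    have int0: "integral\<^sup>L M \<phi> = 0"
      using lim[OF \<phi>(1,2)] z by (simp add: LIMSEQ_const_iff)
    have "\<phi> \<in> borel_measurable M" using \<phi>(1) by (simp add: borel_measurable_continuous_onI cong: measurable_cong_sets)
    then have "integrable M \<phi>"
      using \<phi>(2) by (intro M.integrable_const_bound[where B=1]) auto
    then have "AE t in M. \<phi> t = 0"
      using int0 \<phi>(3) by (subst integral_nonneg_eq_0_iff_AE[symmetric]) auto
    then show ?thesis
    proof eventually_elim
      fix t assume "\<phi> t = 0"
      then have "infdist t C = 0" unfolding \<phi>_def by (simp add: min_def split: if_splits)
      then show "t \<in> C" using clC neC in_closed_iff_infdist_zero by blast
    qed
  qed
  \<comment> \<open>The default off \<open>C\<close> is arbitrary, as the complement of
    \<open>C\<close> is \<open>M\<close>-null.\<close>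
  define d where "d t = (if t \<in> C then decode t else decode (code undefined))" for t
  have d_meas: "d \<in> borel \<rightarrow>\<^sub>M borel"
    unfolding d_def
  proof (subst measurable_If_restrict_space_iff, goal_cases)
    case 1 then show ?case using clC by simp
  next
    case 2
    have "decode \<in> restrict_space borel {x. x \<in> C} \<rightarrow>\<^sub>M borel"
      using continuous_on_decode by (simp add: C_def borel_measurable_continuous_on_restrict)
    then show ?case by simp
  qed
  then have dM: "d \<in> M \<rightarrow>\<^sub>M borel" by (simp cong: measurable_cong_sets)
  define Q where "Q = distr M borel d"
  show thesis
  proof (rule that[OF r])
    show "prob_space Q" unfolding Q_def by (rule M.prob_space_distr[OF dM])
    show "sets Q = sets borel" by (simp add: Q_def)
    fix f :: "'x \<Rightarrow> real" assume f: "continuous_on UNIV f" "bounded (range f)"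
    obtain B where B: "\<And>x. \<bar>f x\<bar> \<le> B" using f(2) unfolding bounded_iff by auto
    have "continuous_on C (f \<circ> decode)"
      using continuous_on_decode f(1) unfolding C_def by (intro continuous_on_compose) (auto intro: continuous_on_subset)
    \<comment> \<open>The composite is continuous on \<open>C\<close> only. Tietze extends it with
      the same bound to the line, where weak convergence applies.\<close>
    then have "continuous_map (top_of_set C) euclideanreal (f \<circ> decode)" by simp
    moreover have "normal_space euclideanreal" "closedin euclideanreal C"
      using clC by (auto simp: metrizable_imp_normal_space metrizable_space_euclidean)
    moreover have bds: "- B \<le> f x \<and> f x \<le> B" for x using B[of x] by linarith
    then have "(f \<circ> decode) ` C \<subseteq> {-B..B}" by auto
    moreover have "- B \<le> B" using bds by (meson order_trans)
    ultimately obtain F where F: "continuous_map euclidean euclideanreal F" "\<And>t. t \<in> C \<Longrightarrow> F t = (f \<circ> decode) t"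
      "F ` topspace euclidean \<subseteq> {-B..B}"
      using Tietze_extension_closed_real_interval[of "euclidean :: real topology" C "f \<circ> decode" "-B" B] by blast
    have F': "continuous_on UNIV F" "\<bar>F t\<bar> \<le> B" for t
      using F(1,3) unfolding abs_le_iff image_subset_iff by (force simp: minus_le_iff)+
    have "(\<integral>x. F (code x) \<partial>P (r j)) = (\<integral>x. f x \<partial>P (r j))" for j
      using F(2)[OF codeC] by (simp add: decode_code)
    moreover have "(\<integral>t. F t \<partial>M) = (\<integral>x. f x \<partial>Q)"
    proof -
      have "(\<integral>x. f x \<partial>Q) = (\<integral>t. f (d t) \<partial>M)"
        unfolding Q_def using f(1) by (intro integral_distr dM borel_measurable_continuous_onI)
      also have "\<dots> = (\<integral>t. F t \<partial>M)"
      proof (rule integral_cong_AE)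
        show "AE t in M. f (d t) = F t" using AEC by eventually_elim (simp add: F(2) d_def)
        show "(\<lambda>t. f (d t)) \<in> borel_measurable M"
          using measurable_compose[OF dM borel_measurable_continuous_onI[OF f(1)]] .
        show "F \<in> borel_measurable M"
          using F'(1) by (simp add: borel_measurable_continuous_onI cong: measurable_cong_sets)
      qed
      finally show ?thesis by simp
    qed
    ultimately show "(\<lambda>j. \<integral>x. f x \<partial>P (r j)) \<longlonglongrightarrow> (\<integral>x. f x \<partial>Q)"
      using lim[OF F'] by simp
  qed
qed

end

section \<open>Vague convergence\<close>

text \<open>The convergence of \<open>polh_converges\<close> for bare measures, so that it covers
  approximations and limits not yet known to come from a polyhomomorphism.\<close>

definition vague_converges :: "(nat \<Rightarrow> 'x::topological_space measure) \<Rightarrow> 'x measure \<Rightarrow> bool" where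
  "vague_converges \<mu> M \<longleftrightarrow> (\<forall>\<theta>. test_function \<theta> \<longrightarrow> (\<lambda>j. \<integral>x. \<theta> x \<partial>\<mu> j) \<longlonglongrightarrow> (\<integral>x. \<theta> x \<partial>M))"

lemma vague_convergesD: "vague_converges \<mu> M \<Longrightarrow> test_function \<theta> \<Longrightarrow> (\<lambda>j. \<integral>x. \<theta> x \<partial>\<mu> j) \<longlonglongrightarrow> (\<integral>x. \<theta> x \<partial>M)"
  by (simp add: vague_converges_def)

lemma vague_converges_subseq: "vague_converges \<mu> M \<Longrightarrow> strict_mono r \<Longrightarrow> vague_converges (\<mu> \<circ> r) M"
  unfolding vague_converges_def using LIMSEQ_subseq_LIMSEQ by (fastforce simp: comp_def)

context compact_open_partition
begin

lemma continuous_on_piecewise: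
  assumes "\<And>n x. x \<in> X n \<Longrightarrow> f x = c n"
  shows "continuous_on UNIV (f :: 'x \<Rightarrow> 'b::topological_space)"
proof -
  have "continuous_on (\<Union>n. X n) f"
  proof (rule continuous_on_open_UN)
    show "continuous_on (X n) f" for n
      using assms[of _ n] by (subst continuous_on_cong[OF refl, of _ _ "\<lambda>_. c n"]) auto
  qed (use open_X in auto)
  then show ?thesis by (simp add: Un_X)
qed

lemma compact_subset_pieces:
  assumes "compact K" obtains N where "K \<subseteq> (\<Union>n\<le>N. X n)"
proof -
  obtain I where I: "finite I" "K \<subseteq> (\<Union>n\<in>I. X n)"
    using compactE_image[OF assms, of UNIV X] open_X Un_X by auto
  show thesis
    by (rule that[of "Max (insert 0 I)"]) (use I in \<open>fastforce intro: Max_ge\<close>)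
qed

lemma emeasure_pieces:
  assumes "sets M = sets borel" "A \<in> sets borel"
  shows "emeasure M A = (\<Sum>n. emeasure M (A \<inter> X n))"
proof -
  have "(\<Sum>n. emeasure M (A \<inter> X n)) = emeasure M (\<Union>n. A \<inter> X n)"
    using disj_X assms open_X
    by (intro suminf_emeasure) (auto simp: disjoint_family_on_def)
  also have "(\<Union>n. A \<inter> X n) = A" using Un_X by auto
  finally show ?thesis by simp
qed

lemma finite_on_compact:
  assumes "sets M = sets borel" "\<And>n. emeasure M (X n) < \<infinity>" "compact K"
  shows "emeasure M K < \<infinity>"
proof -
  obtain N where N: "K \<subseteq> (\<Union>n\<le>N. X n)" by (rule compact_subset_pieces[OF assms(3)])
  have "emeasure M K \<le> emeasure M (\<Union>n\<le>N. X n)"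
    using assms(1) open_X by (intro emeasure_mono[OF N]) auto
  also have "\<dots> \<le> (\<Sum>n\<le>N. emeasure M (X n))"
    using assms(1) open_X by (intro emeasure_subadditive_finite) auto
  also have "\<dots> < \<infinity>" using assms(2) by (simp add: ennreal_sum_less_top)
  finally show ?thesis .
qed

text \<open>A weight that is constant on the pieces turns the local bounds into total mass at most 1
  with uniformly small tails. Once normalised, the measures have a weakly convergent subsequence,
  and division by the weight undoes the change because \<open>\<theta> / w\<close> is bounded and
  continuous.\<close>

lemma vague_seq_compact:
  fixes \<mu> :: "nat \<Rightarrow> 'x measure" and b :: "nat \<Rightarrow> real"
  assumes \<mu>: "\<And>j. sets (\<mu> j) = sets borel" and bd: "\<And>j n. emeasure (\<mu> j) (X n) \<le> ennreal (b n)"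
  obtains r M where "strict_mono r" "sets M = sets borel" "\<And>K. compact K \<Longrightarrow> emeasure M K < \<infinity>"
    "vague_converges (\<mu> \<circ> r) M"
proof -
  \<comment> \<open>Chosen so that piece \<open>n\<close> receives weighted mass at most
    \<open>(1/2) ^ Suc n\<close>; the summand 1 keeps the denominator positive.\<close>
  define v where "v n = (1/2) ^ Suc n / (1 + \<bar>b n\<bar>)" for n
  have v: "v n > 0" for n unfolding v_def by (simp add: add_pos_nonneg)
  have vb: "v n * \<bar>b n\<bar> \<le> (1/2) ^ Suc n" for n
    unfolding v_def by (simp add: field_simps add_pos_nonneg)
  define w where "w x = v (piece x)" for x
  have w: "w x > 0" and wX: "x \<in> X n \<Longrightarrow> w x = v n" for x n
    using v by (auto simp: w_def piece_eq)
  have cw: "continuous_on UNIV w" using wX by (rule continuous_on_piecewise)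
  then have mw [measurable]: "w \<in> borel_measurable borel" by (rule borel_measurable_continuous_onI)
  \<comment> \<open>The factor \<open>c\<close> is 1 when the total masses are defined and their
    reciprocal when the measures are normalised.\<close>
  define D where "D c j = density (\<mu> j) (\<lambda>x. ennreal (c * w x))" for c j
  have sD: "sets (D c j) = sets borel" for c j by (simp add: D_def \<mu>)
  have spD: "space (D c j) = UNIV" for c j using sets_eq_imp_space_eq[OF sD] by simp
  have DX: "emeasure (D c j) (X n) \<le> ennreal (c * (1/2) ^ Suc n)" if "c > 0" for c j n
  proof -
    have "emeasure (D c j) (X n) = (\<integral>\<^sup>+x. ennreal (c * w x) * indicator (X n) x \<partial>\<mu> j)"
      unfolding D_def using open_X \<mu> mw by (intro emeasure_density) (auto cong: measurable_cong_sets)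
    also have "\<dots> = (\<integral>\<^sup>+x. ennreal (c * v n) * indicator (X n) x \<partial>\<mu> j)"
      by (intro nn_integral_cong) (auto simp: wX indicator_def)
    also have "\<dots> = ennreal (c * v n) * emeasure (\<mu> j) (X n)"
      using open_X \<mu> by (intro nn_integral_cmult_indicator) auto
    also have "\<dots> \<le> ennreal (c * v n) * ennreal \<bar>b n\<bar>"
      using bd[of j n] by (intro mult_left_mono order_trans[OF bd] ennreal_leI) auto
    also have "\<dots> = ennreal (c * (v n * \<bar>b n\<bar>))"
      using v[of n] that by (simp add: ennreal_mult[symmetric] mult.assoc)
    also have "\<dots> \<le> ennreal (c * (1/2) ^ Suc n)"
      using that vb by (intro ennreal_leI mult_left_mono) auto
    finally show ?thesis .
  qed
  have geo: "(\<lambda>n. (1/2::real) ^ Suc (n + N)) sums ((1/2) ^ N)" for N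
    using sums_mult[OF geometric_sums[of "1/2::real"], of "(1/2) ^ Suc N"] by (simp add: power_add mult_ac)
  have Dtail: "emeasure (D c j) (\<Union>n. X (n + N)) \<le> ennreal (c * (1/2) ^ N)" if "c > 0" for c j N
  proof -
    have "emeasure (D c j) (\<Union>n. X (n + N)) \<le> (\<Sum>n. emeasure (D c j) (X (n + N)))"
      using open_X sD by (intro emeasure_subadditive_countably) auto
    also have "\<dots> \<le> (\<Sum>n. ennreal (c * (1/2) ^ Suc (n + N)))"
      using DX[OF that] by (intro suminf_le) auto
    also have "\<dots> = ennreal (c * (1/2) ^ N)"
      using that by (intro suminf_ennreal_eq sums_mult geo) simp
    finally show ?thesis .
  qed
  have Dfin: "emeasure (D c j) UNIV \<le> ennreal c" if "c > 0" for c j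
    using Dtail[OF that, of j 0] by (simp add: Un_X)
  have Dint: "(\<integral>x. \<theta> x / w x \<partial>D c j) = c * (\<integral>x. \<theta> x \<partial>\<mu> j)" if "test_function \<theta>" "c > 0" for \<theta> c j
  proof -
    have m: "\<theta> \<in> borel_measurable (\<mu> j)" "w \<in> borel_measurable (\<mu> j)"
      using that(1) \<mu> mw by (auto simp: test_function_measurable cong: measurable_cong_sets)
    have "(\<integral>x. \<theta> x / w x \<partial>D c j) = (\<integral>x. (c * w x) *\<^sub>R (\<theta> x / w x) \<partial>\<mu> j)"
      unfolding D_def using m that(2) w less_imp_le by (intro integral_density) (auto intro!: AE_I2 mult_nonneg_nonneg)
    also have "\<dots> = (\<integral>x. c * \<theta> x \<partial>\<mu> j)"
      using w less_imp_neq by (intro Bochner_Integration.integral_cong) (auto simp: less_imp_neq[symmetric])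
    finally show ?thesis by simp
  qed
  have tw: "continuous_on UNIV (\<lambda>x. \<theta> x / w x)" "bounded (range (\<lambda>x. \<theta> x / w x))" if "test_function \<theta>" for \<theta>
  proof -
    show c: "continuous_on UNIV (\<lambda>x. \<theta> x / w x)"
      using that w cw by (auto simp: test_function_def less_imp_neq[symmetric] intro!: continuous_on_divide)
    have "{x. \<theta> x / w x \<noteq> 0} \<subseteq> {x. \<theta> x \<noteq> 0}" by auto
    then have "closure {x. \<theta> x / w x \<noteq> 0} \<subseteq> closure {x. \<theta> x \<noteq> 0}" by (rule closure_mono)
    then have "test_function (\<lambda>x. \<theta> x / w x)"
      using that c compact_closed_subset[OF _ closed_closure] unfolding test_function_def by blast
    then obtain B where "\<And>x. \<bar>\<theta> x / w x\<bar> \<le> B" by (rule test_function_bounded) blast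
    then show "bounded (range (\<lambda>x. \<theta> x / w x))" by (auto simp: bounded_iff)
  qed
  define m where "m j = measure (D 1 j) UNIV" for j
  have m01: "m j \<in> {0..1}" for j
    unfolding m_def measure_def using Dfin[of 1 j] by (auto intro: enn2real_leI)
  then obtain l r1 where r1: "strict_mono r1" "(m \<circ> r1) \<longlonglongrightarrow> l" "l \<in> {0..1}"
    using compact_Icc[of "0::real" 1] unfolding compact_def by metis
  have mj: "emeasure (D 1 j) UNIV = ennreal (m j)" for j
    unfolding m_def measure_def using le_less_trans[OF Dfin[of 1 j] ennreal_less_top] by simp
  have Dc: "emeasure (D c j) UNIV = ennreal (c * m j)" if "c > 0" for c j
  proof -
    have mm: "(\<lambda>x. ennreal (w x)) \<in> borel_measurable (\<mu> j)" using \<mu> mw by (auto cong: measurable_cong_sets)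
    have "emeasure (D c j) UNIV = (\<integral>\<^sup>+x. ennreal (c * w x) * indicator UNIV x \<partial>\<mu> j)"
      unfolding D_def using \<mu> mw by (intro emeasure_density) (auto cong: measurable_cong_sets)
    also have "\<dots> = (\<integral>\<^sup>+x. ennreal c * ennreal (w x) \<partial>\<mu> j)"
      using less_imp_le[OF w] that by (intro nn_integral_cong) (simp add: ennreal_mult)
    also have "\<dots> = ennreal c * (\<integral>\<^sup>+x. ennreal (w x) \<partial>\<mu> j)" by (rule nn_integral_cmult[OF mm])
    also have "(\<integral>\<^sup>+x. ennreal (w x) \<partial>\<mu> j) = emeasure (D 1 j) UNIV"
      unfolding D_def using \<mu> mw by (subst emeasure_density) (auto cong: measurable_cong_sets)
    finally show ?thesis unfolding mj using that m01[of j] by (simp add: ennreal_mult)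
  qed
  \<comment> \<open>If the weighted masses tend to 0 they cannot be normalised with uniform tails,
    but then \<open>B * m j\<close> bounds the integrals and the limit is the null measure.\<close>
  show thesis
  proof (cases "l = 0")
    case True
    have "vague_converges (\<mu> \<circ> r1) (null_measure borel)"
      unfolding vague_converges_def
    proof (intro allI impI)
      fix \<theta> :: "'x \<Rightarrow> real" assume \<theta>: "test_function \<theta>"
      obtain B where B: "\<And>x. \<bar>\<theta> x / w x\<bar> \<le> B"
        using tw(2)[OF \<theta>] unfolding bounded_iff by auto
      have "\<bar>\<integral>x. \<theta> x \<partial>\<mu> j\<bar> \<le> B * m j" for j
      proof -
        interpret finite_measure "D 1 j" by standard (use Dfin[of 1 j] spD in \<open>auto simp: top_unique\<close>)
        have me: "(\<lambda>x. \<theta> x / w x) \<in> borel_measurable (D 1 j)"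
          using tw(1)[OF \<theta>] sD by (simp add: borel_measurable_continuous_onI cong: measurable_cong_sets)
        have "\<bar>\<integral>x. \<theta> x / w x \<partial>D 1 j\<bar> \<le> (\<integral>x. \<bar>\<theta> x / w x\<bar> \<partial>D 1 j)"
          by (rule integral_abs_bound)
        also have "\<dots> \<le> (\<integral>x. B \<partial>D 1 j)"
        proof (rule integral_mono)
          show "integrable (D 1 j) (\<lambda>x. \<bar>\<theta> x / w x\<bar>)"
            using B me by (intro integrable_const_bound[where B=B] integrable_abs AE_I2) auto
        qed (use B in auto)
        also have "\<dots> = B * m j" by (simp add: m_def spD)
        finally show ?thesis using Dint[OF \<theta>, of 1 j] by simp
      qed
      then have "\<forall>\<^sub>F j in sequentially. norm (\<integral>x. \<theta> x \<partial>(\<mu> \<circ> r1) j) \<le> B * (m \<circ> r1) j" by simp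
      moreover have "(\<lambda>j. B * (m \<circ> r1) j) \<longlonglongrightarrow> 0"
        using tendsto_mult_left[OF r1(2), of B] True by simp
      ultimately have "(\<lambda>j. \<integral>x. \<theta> x \<partial>(\<mu> \<circ> r1) j) \<longlonglongrightarrow> 0"
        by (rule Lim_null_comparison)
      then show "(\<lambda>j. \<integral>x. \<theta> x \<partial>(\<mu> \<circ> r1) j) \<longlonglongrightarrow> (\<integral>x. \<theta> x \<partial>null_measure borel)" by simp
    qed
    then show thesis by (intro that[OF r1(1), of "null_measure borel"]) simp_all
  next
    case False
    then have l: "l > 0" using r1(3) by auto
    then have "\<forall>\<^sub>F j in sequentially. (m \<circ> r1) j > l / 2" using order_tendstoD(1)[OF r1(2), of "l / 2"] by simp
    then obtain J where J: "\<And>j. j \<ge> J \<Longrightarrow> m (r1 j) > l / 2" unfolding eventually_sequentially by auto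
    \<comment> \<open>Dropping the first \<open>J\<close> terms keeps every mass above
      \<open>l / 2\<close>, which makes the normalised tails uniformly small.\<close>
    define r2 where "r2 j = r1 (j + J)" for j
    have r2: "strict_mono r2" "m (r2 j) > l / 2" "(\<lambda>j. m (r2 j)) \<longlonglongrightarrow> l" for j
      unfolding r2_def using r1 J LIMSEQ_ignore_initial_segment[OF r1(2), of J]
      by (auto simp: strict_mono_def comp_def)
    have mpos: "m (r2 j) > 0" for j using r2(2)[of j] l by linarith
    define P where "P j = D (1 / m (r2 j)) (r2 j)" for j
    have sP: "sets (P j) = sets borel" for j by (simp add: P_def sD)
    have pP: "prob_space (P j)" for j
      by standard (use Dc[of "1 / m (r2 j)" "r2 j"] mpos[of j] spD in \<open>simp add: P_def\<close>)
    have "\<exists>N. \<forall>j. measure (P j) (\<Union>n\<le>N. X n) > 1 - \<epsilon>" if eps: "\<epsilon> > 0" for \<epsilon>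
    proof -
      obtain N where N: "(1/2::real) ^ N < \<epsilon> * l / 2"
        using real_arch_pow_inv[of "\<epsilon> * l / 2" "1/2"] mult_pos_pos[OF eps l] by auto
      show ?thesis
      proof (intro exI[of _ N] allI)
        fix j
        interpret prob_space "P j" by (rule pP)
        have "emeasure (P j) (\<Union>n. X (n + N)) \<le> ennreal (1 / m (r2 j) * (1/2) ^ N)"
          unfolding P_def using mpos by (intro Dtail) simp
        then have "measure (P j) (\<Union>n. X (n + N)) \<le> 1 / m (r2 j) * (1/2) ^ N"
          using mpos[of j] by (simp add: emeasure_eq_measure)
        also have "\<dots> \<le> 1 / (l/2) * (1/2) ^ N"
          using r2(2)[of j] l mpos[of j] by (intro mult_right_mono divide_left_mono) auto
        also have "\<dots> < \<epsilon>" using N l by (simp add: field_simps)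
        finally have 1: "measure (P j) (\<Union>n. X (n + N)) < \<epsilon>" .
        have "1 = measure (P j) UNIV" using prob_space spD by (simp add: P_def)
        also have "\<dots> \<le> measure (P j) ((\<Union>n\<le>N. X n) \<union> (\<Union>n. X (n + N)))"
        proof (rule finite_measure_mono)
          show "UNIV \<subseteq> (\<Union>n\<le>N. X n) \<union> (\<Union>n. X (n + N))"
          proof
            fix x :: 'x
            obtain n where n: "x \<in> X n" using Un_X by blast
            show "x \<in> (\<Union>n\<le>N. X n) \<union> (\<Union>n. X (n + N))"
            proof (cases "n \<le> N")
              case False
              then have "n = (n - N) + N" by simp
              then show ?thesis using n by (metis UN_I UNIV_I UnI2)
            qed (use n in auto)
          qed
        qed (use sP open_X in auto)
        also have "\<dots> \<le> measure (P j) (\<Union>n\<le>N. X n) + measure (P j) (\<Union>n. X (n + N))"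
          using sP open_X by (intro measure_Un_le) auto
        finally show "1 - \<epsilon> < measure (P j) (\<Union>n\<le>N. X n)" using 1 by linarith
      qed
    qed
    then obtain r Q where r: "strict_mono r" and Q: "prob_space Q" "sets Q = sets borel"
      and lim: "\<And>f :: 'x \<Rightarrow> real. continuous_on UNIV f \<Longrightarrow> bounded (range f) \<Longrightarrow>
         (\<lambda>j. \<integral>x. f x \<partial>P (r j)) \<longlonglongrightarrow> (\<integral>x. f x \<partial>Q)"
      using prob_seq_compact[of P, OF pP sP] by blast
    \<comment> \<open>The factor \<open>l\<close> restores the limit of the masses and
      \<open>1 / w\<close> removes the weight.\<close>
    define M where "M = density Q (\<lambda>x. ennreal (l / w x))"
    have sM: "sets M = sets borel" by (simp add: M_def Q)
    have mw': "(\<lambda>x. l / w x) \<in> borel_measurable Q" using mw Q(2) by (auto cong: measurable_cong_sets)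
    have MX: "emeasure M (X n) < \<infinity>" for n
    proof -
      have "emeasure M (X n) = (\<integral>\<^sup>+x. ennreal (l / w x) * indicator (X n) x \<partial>Q)"
        unfolding M_def using open_X Q(2) mw' by (intro emeasure_density) auto
      also have "\<dots> = (\<integral>\<^sup>+x. ennreal (l / v n) * indicator (X n) x \<partial>Q)"
        by (intro nn_integral_cong) (auto simp: wX indicator_def)
      also have "\<dots> = ennreal (l / v n) * emeasure Q (X n)"
        using open_X Q(2) by (intro nn_integral_cmult_indicator) auto
      also have "\<dots> < \<infinity>"
        using le_less_trans[OF prob_space.emeasure_le_1[OF Q(1), of "X n"] ennreal_one_less_top]
        by (simp add: ennreal_mult_less_top)
      finally show ?thesis .
    qed
    have "vague_converges (\<mu> \<circ> (r2 \<circ> r)) M"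
      unfolding vague_converges_def
    proof (intro allI impI)
      fix \<theta> :: "'x \<Rightarrow> real" assume \<theta>: "test_function \<theta>"
      have "(\<lambda>j. m (r2 (r j)) * (\<integral>x. \<theta> x / w x \<partial>P (r j))) \<longlonglongrightarrow> l * (\<integral>x. \<theta> x / w x \<partial>Q)"
        using LIMSEQ_subseq_LIMSEQ[OF r2(3) r] by (intro tendsto_mult lim tw \<theta>) (simp add: comp_def)
      moreover have "m (r2 (r j)) * (\<integral>x. \<theta> x / w x \<partial>P (r j)) = (\<integral>x. \<theta> x \<partial>(\<mu> \<circ> (r2 \<circ> r)) j)" for j
        unfolding P_def using Dint[OF \<theta>, of "1 / m (r2 (r j))" "r2 (r j)"] mpos[of "r j"] by simp
      moreover have "l * (\<integral>x. \<theta> x / w x \<partial>Q) = (\<integral>x. \<theta> x \<partial>M)"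
      proof -
        have "(\<integral>x. \<theta> x \<partial>M) = (\<integral>x. (l / w x) *\<^sub>R \<theta> x \<partial>Q)"
          unfolding M_def using l w less_imp_le mw' \<theta> Q(2)
          by (intro integral_density) (auto simp: test_function_measurable intro!: AE_I2 divide_nonneg_nonneg)
        also have "\<dots> = (\<integral>x. l * (\<theta> x / w x) \<partial>Q)" by (intro Bochner_Integration.integral_cong) auto
        finally show ?thesis by (simp only: integral_mult_right_zero)
      qed
      ultimately show "(\<lambda>j. \<integral>x. \<theta> x \<partial>(\<mu> \<circ> (r2 \<circ> r)) j) \<longlonglongrightarrow> (\<integral>x. \<theta> x \<partial>M)" by simp
    qed
    then show thesis
      by (intro that[of "r2 \<circ> r" M] strict_mono_o r2 r sM finite_on_compact[OF sM MX])
  qed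
qed

end

section \<open>Semicontinuity under vague convergence, and determination by test functions\<close>

definition locally_finite_borel :: "'x::topological_space measure \<Rightarrow> bool" where
  "locally_finite_borel M \<longleftrightarrow> sets M = sets borel \<and> (\<forall>K. compact K \<longrightarrow> emeasure M K < \<infinity>)"

lemma locally_finite_borelD:
  assumes "locally_finite_borel M"
  shows "sets M = sets borel" "space M = UNIV" "compact K \<Longrightarrow> emeasure M K < \<infinity>" "compact K \<Longrightarrow> emeasure M K \<noteq> \<infinity>"
  using assms sets_eq_imp_space_eq[of M borel] by (auto simp: locally_finite_borel_def)

lemma test_function_nn_integral:
  fixes \<theta> :: "'x::t2_space \<Rightarrow> real"
  assumes "test_function \<theta>" "\<And>x. 0 \<le> \<theta> x" "locally_finite_borel M"
  shows "(\<integral>\<^sup>+x. ennreal (\<theta> x) \<partial>M) = ennreal (\<integral>x. \<theta> x \<partial>M)"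
  using assms by (intro nn_integral_eq_integral test_function_integrable) (auto simp: locally_finite_borel_def)

lemma integral_test_indicator:
  fixes C :: "'x::t2_space set"
  assumes "open C" "compact C" "locally_finite_borel M"
  shows "(\<integral>x. indicator C x \<partial>M) = measure M C" "emeasure M C = ennreal (measure M C)"
  using locally_finite_borelD[OF assms(3)] assms(1,2)
  by (auto simp: measure_def less_top)

text \<open>The indicator of a compact open set is itself a test function. This exact convergence is
  the reason for working with rectangles of compact open subgroups.\<close>

lemma vague_converges_compact_open:
  fixes C :: "'x::t2_space set"
  assumes "vague_converges \<mu> M" "open C" "compact C" "locally_finite_borel M" "\<And>j. locally_finite_borel (\<mu> j)"
  shows "(\<lambda>j. measure (\<mu> j) C) \<longlonglongrightarrow> measure M C"
  using vague_convergesD[OF assms(1) test_function_indicator[OF assms(2,3)]] assms(2-)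
  by (simp add: locally_finite_borelD(2))

context compact_open_partition
begin

text \<open>Monotone convergence. The same functions serve for every locally finite measure, which
  lets countably many of them determine such a measure.\<close>

lemma open_approx:
  assumes "open (B :: 'x set)"
  obtains \<theta> :: "nat \<Rightarrow> 'x \<Rightarrow> real" where "\<And>n. test_function (\<theta> n)" "\<And>n x. 0 \<le> \<theta> n x" "\<And>n x. \<theta> n x \<le> indicator B x"
    "\<And>x. incseq (\<lambda>n. \<theta> n x)" "\<And>x. (\<lambda>n. \<theta> n x) \<longlonglongrightarrow> indicator B x"
    "\<And>M. locally_finite_borel M \<Longrightarrow> (\<lambda>n. ennreal (\<integral>x. \<theta> n x \<partial>M)) \<longlonglongrightarrow> emeasure M B"
proof -
  obtain \<theta> :: "nat \<Rightarrow> 'x \<Rightarrow> real" where \<theta>: "\<And>n. test_function (\<theta> n)" "\<And>n x. 0 \<le> \<theta> n x" "\<And>n x. \<theta> n x \<le> 1"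
    "\<And>x. incseq (\<lambda>n. \<theta> n x)" "\<And>x. (\<lambda>n. \<theta> n x) \<longlonglongrightarrow> indicator B x"
    using indicator_open_limit[OF assms] by metis
  have le: "\<theta> n x \<le> indicator B x" for n x
    using incseq_le[OF \<theta>(4,5)] .
  have "(\<lambda>n. ennreal (\<integral>x. \<theta> n x \<partial>M)) \<longlonglongrightarrow> emeasure M B" if M: "locally_finite_borel M" for M
  proof -
    have "(\<lambda>n. \<integral>\<^sup>+x. ennreal (\<theta> n x) \<partial>M) \<longlonglongrightarrow> (\<integral>\<^sup>+x. ennreal (indicator B x) \<partial>M)"
    proof (rule nn_integral_LIMSEQ)
      show "incseq (\<lambda>n x. ennreal (\<theta> n x))"
        using \<theta>(4) by (auto simp: incseq_def le_fun_def intro!: ennreal_leI)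
      show "(\<lambda>x. ennreal (\<theta> n x)) \<in> borel_measurable M" for n
        using test_function_measurable[OF \<theta>(1) locally_finite_borelD(1)[OF M]] by simp
      show "(\<lambda>n. ennreal (\<theta> n x)) \<longlonglongrightarrow> ennreal (indicator B x)" for x
        by (intro tendsto_ennrealI \<theta>)
    qed
    moreover have "(\<integral>\<^sup>+x. ennreal (indicator B x) \<partial>M) = emeasure M B"
      using assms locally_finite_borelD(1)[OF M] by (simp add: ennreal_indicator)
    ultimately show ?thesis by (simp add: test_function_nn_integral[OF \<theta>(1,2) M])
  qed
  then show thesis using that \<theta> le by blast
qed

text \<open>Lower semicontinuity on open sets: test functions below the indicator of
  \<open>B\<close> keep integrals at most \<open>c\<close> in the limit, and these integrals exhaust
  the limit mass of \<open>B\<close>.\<close>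

lemma vague_open_le:
  assumes "vague_converges \<mu> M" "locally_finite_borel M" "\<And>j. locally_finite_borel (\<mu> j)" "open (B :: 'x set)"
    "\<forall>\<^sub>F j in sequentially. emeasure (\<mu> j) B \<le> c"
  shows "emeasure M B \<le> c"
proof -
  obtain \<theta> :: "nat \<Rightarrow> 'x \<Rightarrow> real" where \<theta>: "\<And>n. test_function (\<theta> n)" "\<And>n x. 0 \<le> \<theta> n x" "\<And>n x. \<theta> n x \<le> indicator B x"
    "\<And>M. locally_finite_borel M \<Longrightarrow> (\<lambda>n. ennreal (\<integral>x. \<theta> n x \<partial>M)) \<longlonglongrightarrow> emeasure M B"
    using open_approx[OF assms(4)] by metis
  have "ennreal (\<integral>x. \<theta> n x \<partial>M) \<le> c" for n
  proof (rule tendsto_upperbound)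
    show "(\<lambda>j. ennreal (\<integral>x. \<theta> n x \<partial>\<mu> j)) \<longlonglongrightarrow> ennreal (\<integral>x. \<theta> n x \<partial>M)"
      by (intro tendsto_ennrealI vague_convergesD[OF assms(1) \<theta>(1)])
    show "\<forall>\<^sub>F j in sequentially. ennreal (\<integral>x. \<theta> n x \<partial>\<mu> j) \<le> c"
      using assms(5)
    proof eventually_elim
      fix j assume c: "emeasure (\<mu> j) B \<le> c"
      have "ennreal (\<integral>x. \<theta> n x \<partial>\<mu> j) = (\<integral>\<^sup>+x. ennreal (\<theta> n x) \<partial>\<mu> j)"
        using test_function_nn_integral[OF \<theta>(1,2) assms(3)] by simp
      also have "\<dots> \<le> (\<integral>\<^sup>+x. indicator B x \<partial>\<mu> j)"
        by (intro nn_integral_mono) (metis \<theta>(3) ennreal_indicator ennreal_leI)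
      also have "\<dots> = emeasure (\<mu> j) B"
        using locally_finite_borelD(1)[OF assms(3)] assms(4) by simp
      finally show "ennreal (\<integral>x. \<theta> n x \<partial>\<mu> j) \<le> c" using c by (rule order_trans)
    qed
  qed simp
  then show ?thesis
    by (intro LIMSEQ_le_const2[OF \<theta>(4)[OF assms(2)]]) auto
qed

text \<open>Some test function below the indicator of \<open>B\<close> has positive limit integral.
  This finds points of the approximating subgroups near each point of the support of the
  limit.\<close>

lemma vague_open_eventually_pos:
  assumes "vague_converges \<mu> M" "locally_finite_borel M" "\<And>j. locally_finite_borel (\<mu> j)" "open (B :: 'x set)"
    "emeasure M B \<noteq> 0"
  shows "\<forall>\<^sub>F j in sequentially. emeasure (\<mu> j) B \<noteq> 0"
proof -
  obtain \<theta> :: "nat \<Rightarrow> 'x \<Rightarrow> real" where \<theta>: "\<And>n. test_function (\<theta> n)" "\<And>n x. 0 \<le> \<theta> n x" "\<And>n x. \<theta> n x \<le> indicator B x"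
    "\<And>M. locally_finite_borel M \<Longrightarrow> (\<lambda>n. ennreal (\<integral>x. \<theta> n x \<partial>M)) \<longlonglongrightarrow> emeasure M B"
    using open_approx[OF assms(4)] by metis
  have "\<exists>n. (\<integral>x. \<theta> n x \<partial>M) > 0"
  proof (rule ccontr)
    assume "\<not> ?thesis"
    then have "ennreal (\<integral>x. \<theta> n x \<partial>M) = 0" for n by (simp add: ennreal_neg not_less)
    then show False using \<theta>(4)[OF assms(2)] assms(5) by (simp add: LIMSEQ_const_iff)
  qed
  then obtain n where "(\<integral>x. \<theta> n x \<partial>M) > 0" by blast
  then have "\<forall>\<^sub>F j in sequentially. (\<integral>x. \<theta> n x \<partial>\<mu> j) > 0"
    by (rule order_tendstoD(1)[OF vague_convergesD[OF assms(1) \<theta>(1)]])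
  then show ?thesis
  proof eventually_elim
    fix j assume pos: "(\<integral>x. \<theta> n x \<partial>\<mu> j) > 0"
    show "emeasure (\<mu> j) B \<noteq> 0"
    proof
      assume "emeasure (\<mu> j) B = 0"
      then have "B \<in> null_sets (\<mu> j)"
        using locally_finite_borelD(1)[OF assms(3)] assms(4) by (simp add: null_setsI)
      then have "AE x in \<mu> j. x \<notin> B" by (rule AE_not_in)
      then have "AE x in \<mu> j. \<theta> n x = 0"
      proof eventually_elim
        fix x assume "x \<notin> B"
        then show "\<theta> n x = 0" using \<theta>(2)[of n x] \<theta>(3)[of n x] by simp
      qed
      then have "(\<integral>x. \<theta> n x \<partial>\<mu> j) = 0" by (rule integral_eq_zero_AE)
      then show False using pos by simp
    qed
  qed
qed

text \<open>The neighbourhoods are sublevel sets of functions increasing to the indicator of the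
  complement; intersecting them with a compact open set gives the finite mass that continuity from
  above requires.\<close>

lemma compact_outer_approx:
  assumes "compact (A :: 'x set)"
  obtains O' where "\<And>n. open (O' n)" "decseq O'" "(\<Inter>n. O' n) = A" "\<And>n. A \<subseteq> O' n"
    "\<And>M. locally_finite_borel M \<Longrightarrow> (\<lambda>n. emeasure M (O' n)) \<longlonglongrightarrow> emeasure M A"
proof -
  obtain N where N: "A \<subseteq> (\<Union>n\<le>N. X n)" by (rule compact_subset_pieces[OF assms])
  define C where "C = (\<Union>n\<le>N. X n)"
  have C: "open C" "compact C" unfolding C_def using open_X compact_X by auto
  have clA: "closed A" by (rule compact_imp_closed[OF assms])
  have "open (- A)" using clA by auto
  then obtain \<theta> :: "nat \<Rightarrow> 'x \<Rightarrow> real" where \<theta>: "\<And>n. test_function (\<theta> n)" "\<And>n x. 0 \<le> \<theta> n x" "\<And>n x. \<theta> n x \<le> indicator (- A) x"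
    "\<And>x. incseq (\<lambda>n. \<theta> n x)" "\<And>x. (\<lambda>n. \<theta> n x) \<longlonglongrightarrow> indicator (- A) x"
    using open_approx by metis
  define O' where "O' n = C \<inter> {x. \<theta> n x < 1/2}" for n
  have op: "open (O' n)" for n
    unfolding O'_def using C \<theta>(1)[of n] by (intro open_Int open_Collect_less) (auto simp: test_function_def)
  have dec: "decseq O'"
    unfolding decseq_def O'_def using incseqD[OF \<theta>(4)] by (auto intro: le_less_trans simp del: less_divide_eq_numeral1)
  have AO: "A \<subseteq> O' n" for n
  proof
    fix x assume "x \<in> A"
    then show "x \<in> O' n" using N \<theta>(3)[of n x] by (auto simp: O'_def C_def)
  qed
  have int: "(\<Inter>n. O' n) = A"
  proof
    show "(\<Inter>n. O' n) \<subseteq> A"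
    proof
      fix x assume x: "x \<in> (\<Inter>n. O' n)"
      show "x \<in> A"
      proof (rule ccontr)
        assume "x \<notin> A"
        then have "(\<lambda>n. \<theta> n x) \<longlonglongrightarrow> 1" using \<theta>(5)[of x] by simp
        then have "\<forall>\<^sub>F n in sequentially. \<theta> n x > 1/2" by (rule order_tendstoD) simp
        then obtain n where "\<theta> n x > 1/2" by (metis eventually_sequentially order_refl)
        moreover have "x \<in> O' n" using x by blast
          ultimately show False by (simp add: O'_def)
      qed
    qed
  qed (use AO in blast)
  have "(\<lambda>n. emeasure M (O' n)) \<longlonglongrightarrow> emeasure M A" if M: "locally_finite_borel M" for M
    unfolding int[symmetric]
  proof (rule Lim_emeasure_decseq[OF _ dec])
    show "range O' \<subseteq> sets M" using op locally_finite_borelD(1)[OF M] by auto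
    fix n
    have "emeasure M (O' n) \<le> emeasure M C"
      using C locally_finite_borelD(1)[OF M] by (intro emeasure_mono) (auto simp: O'_def)
    also have "\<dots> < \<infinity>" using locally_finite_borelD(3)[OF M C(2)] .
    finally show "emeasure M (O' n) \<noteq> \<infinity>" by simp
  qed
  then show thesis using that op dec int AO by blast
qed

text \<open>Finite intersections of basic sets inside a piece form a countable generating system
  stable under intersection, and the mass of each member is a limit of countably many test
  integrals. The embedding of polyhomomorphisms into real sequences rests on this family.\<close>

lemma determining_family:
  obtains \<theta> :: "nat \<Rightarrow> 'x \<Rightarrow> real" where "\<And>n. test_function (\<theta> n)"
    "\<And>M N. locally_finite_borel M \<Longrightarrow> locally_finite_borel N \<Longrightarrow>
      (\<And>n. (\<integral>x. \<theta> n x \<partial>M) = (\<integral>x. \<theta> n x \<partial>N)) \<Longrightarrow> M = N"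
proof -
  \<comment> \<open>\<open>set_decode\<close> runs over the finite sets of naturals, so
    \<open>F\<close> codes a finite intersection; \<open>F = 0\<close> codes the empty one and gives
    the whole piece.\<close>
  define B where "B n F = X n \<inter> (\<Inter>i\<in>set_decode F. base i)" for n F
  have oB: "open (B n F)" for n F
    unfolding B_def using open_X base(1) by (intro open_Int open_INT) auto
  have "\<exists>\<theta> :: nat \<Rightarrow> 'x \<Rightarrow> real. (\<forall>k. test_function (\<theta> k)) \<and>
      (\<forall>M. locally_finite_borel M \<longrightarrow> (\<lambda>k. ennreal (\<integral>x. \<theta> k x \<partial>M)) \<longlonglongrightarrow> emeasure M (B n F))" for n F
    by (rule open_approx[OF oB]) blast
  then obtain \<theta> :: "nat \<Rightarrow> nat \<Rightarrow> nat \<Rightarrow> 'x \<Rightarrow> real" where \<theta>: "\<And>n F k. test_function (\<theta> n F k)"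
      "\<And>n F M. locally_finite_borel M \<Longrightarrow> (\<lambda>k. ennreal (\<integral>x. \<theta> n F k x \<partial>M)) \<longlonglongrightarrow> emeasure M (B n F)"
    by metis
  define \<phi> where "\<phi> m = (case prod_decode m of (n, q) \<Rightarrow> case prod_decode q of (F, k) \<Rightarrow> \<theta> n F k)" for m
  have \<phi>: "\<theta> n F k = \<phi> (prod_encode (n, prod_encode (F, k)))" for n F k by (simp add: \<phi>_def)
  show thesis
  proof (rule that[of \<phi>])
    show "test_function (\<phi> m)" for m by (simp add: \<phi>_def \<theta>(1) split: prod.split)
    fix M N :: "'x measure"
    assume M: "locally_finite_borel M" and N: "locally_finite_borel N"
      and eq: "\<And>n. (\<integral>x. \<phi> n x \<partial>M) = (\<integral>x. \<phi> n x \<partial>N)"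
    have eqB: "emeasure M (B n F) = emeasure N (B n F)" for n F
      using \<theta>(2)[OF M, of n F] \<theta>(2)[OF N, of n F] unfolding \<phi> eq by (rule LIMSEQ_unique)
    define e :: "nat \<Rightarrow> nat" where "e i = set_encode {i}" for i
    have e: "set_decode (e i) = {i}" for i unfolding e_def by (rule set_encode_inverse) simp
    define E where "E = insert {} {B n F | n F. True}"
    have E_int: "Int_stable E"
    proof (rule Int_stableI)
      fix a b assume ab: "a \<in> E" "b \<in> E"
      show "a \<inter> b \<in> E"
      proof (cases "a = {} \<or> b = {}")
        case False
        then obtain n F m G where nF: "a = B n F" "b = B m G" using ab by (auto simp: E_def)
        show ?thesis
        proof (cases "n = m")
          case True
          have "set_decode (set_encode (set_decode F \<union> set_decode G)) = set_decode F \<union> set_decode G"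
            by (simp add: set_encode_inverse finite_set_decode)
          then have "a \<inter> b = B n (set_encode (set_decode F \<union> set_decode G))"
            using True by (auto simp: nF B_def)
          then show ?thesis by (auto simp: E_def)
        next
          case False
          then have "a \<inter> b = {}" using disj_X by (auto simp: nF B_def disjoint_family_on_def)
          then show ?thesis by (simp add: E_def)
        qed
      qed (auto simp: E_def)
    qed
    have E_gen: "sigma_sets UNIV E = sets borel"
    proof (rule antisym)
      have "E \<subseteq> sets (borel :: 'x measure)" using oB by (auto simp: E_def)
      then show "sigma_sets UNIV E \<subseteq> sets borel"
        using sets.sigma_sets_subset[of E "borel :: 'x measure"] by simp
      interpret S: sigma_algebra UNIV "sigma_sets UNIV E" by (rule sigma_algebra_sigma_sets) simp
      have "U \<in> sigma_sets UNIV E" if U: "open U" for U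
      proof -
        have "U = (\<Union>i. \<Union>n. if base i \<subseteq> U then B n (e i) else {})"
        proof
          show "U \<subseteq> (\<Union>i. \<Union>n. if base i \<subseteq> U then B n (e i) else {})"
          proof
            fix x assume "x \<in> U"
            then obtain i n where "x \<in> base i" "base i \<subseteq> U" "x \<in> X n" using base(2)[OF U] Un_X by blast
            then have "x \<in> (if base i \<subseteq> U then B n (e i) else {})" by (simp add: B_def e)
            then show "x \<in> (\<Union>i. \<Union>n. if base i \<subseteq> U then B n (e i) else {})" by blast
          qed
        qed (auto simp: B_def e split: if_splits)
        moreover have "(if base i \<subseteq> U then B n (e i) else {}) \<in> sigma_sets UNIV E" for i n
          by (auto simp: E_def intro!: sigma_sets.Basic sigma_sets.Empty)
        then have "(\<Union>i. \<Union>n. if base i \<subseteq> U then B n (e i) else {}) \<in> sigma_sets UNIV E"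
          by (intro S.countable_UN image_subsetI)
        ultimately show ?thesis by simp
      qed
      then show "sets borel \<subseteq> sigma_sets UNIV E"
        unfolding borel_def by (auto intro!: S.sigma_sets_subset simp: sets_measure_of)
    qed
    show "M = N"
    proof (rule measure_eqI_generator_eq[OF E_int, where A=X and \<Omega>=UNIV])
      show "emeasure M e = emeasure N e" if "e \<in> E" for e
        using that eqB by (auto simp: E_def)
      have "X n = B n 0" for n by (simp add: B_def)
      then show "range X \<subseteq> E" by (auto simp: E_def)
      show "emeasure M (X i) \<noteq> \<infinity>" for i using locally_finite_borelD(4)[OF M compact_X] .
    qed (use M N Un_X E_gen in \<open>auto simp: locally_finite_borel_def\<close>)
  qed
qed

lemma locally_finite_borel_eqI:
  assumes "locally_finite_borel M" "locally_finite_borel N"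
    "\<And>\<theta> :: 'x \<Rightarrow> real. test_function \<theta> \<Longrightarrow> (\<integral>x. \<theta> x \<partial>M) = (\<integral>x. \<theta> x \<partial>N)"
  shows "M = N"
  using determining_family assms by metis

end

section \<open>Haar measures\<close>

instance prod :: (topological_monoid_add, topological_monoid_add) topological_monoid_add
proof
  fix a b :: "'a \<times> 'b"
  have f: "(fst \<longlongrightarrow> a) (nhds a \<times>\<^sub>F nhds b)" "(snd \<longlongrightarrow> b) (nhds a \<times>\<^sub>F nhds b)"
    by (rule filterlim_fst filterlim_snd)+
  have "((\<lambda>x. (fst (fst x) + fst (snd x), snd (fst x) + snd (snd x))) \<longlongrightarrow> (fst a + fst b, snd a + snd b))
      (nhds a \<times>\<^sub>F nhds b)"
    by (intro tendsto_Pair tendsto_add tendsto_fst tendsto_snd f)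
  then show "LIM x nhds a \<times>\<^sub>F nhds b. fst x + snd x :> nhds (a + b)"
    by (simp add: plus_prod_def)
qed

instance prod :: (topological_group_add, topological_group_add) topological_group_add
proof
  fix a :: "'a \<times> 'b"
  have "((\<lambda>x. (- fst x, - snd x)) \<longlongrightarrow> (- fst a, - snd a)) (nhds a)"
    by (intro tendsto_Pair tendsto_minus tendsto_fst tendsto_snd filterlim_ident)
  then show "(uminus \<longlongrightarrow> - a) (nhds a)"
    by (simp add: uminus_prod_def[abs_def])
qed

lemma is_subgroupD:
  assumes "is_subgroup R"
  shows "0 \<in> R" "x \<in> R \<Longrightarrow> y \<in> R \<Longrightarrow> x + y \<in> R" "x \<in> R \<Longrightarrow> - x \<in> R"
    "x \<in> R \<Longrightarrow> y \<in> R \<Longrightarrow> x - y \<in> R" "x \<in> R \<Longrightarrow> x + y \<in> R \<longleftrightarrow> y \<in> R" "y \<in> R \<Longrightarrow> x + y \<in> R \<longleftrightarrow> x \<in> R"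
proof -
  show a: "0 \<in> R" "x \<in> R \<Longrightarrow> y \<in> R \<Longrightarrow> x + y \<in> R" "x \<in> R \<Longrightarrow> - x \<in> R" for x y
    using assms by (auto simp: is_subgroup_def)
  show "x \<in> R \<Longrightarrow> y \<in> R \<Longrightarrow> x - y \<in> R"
    using a(2)[of x "- y"] a(3) by simp
  show "x + y \<in> R \<longleftrightarrow> y \<in> R" if "x \<in> R"
    using a(2)[of x y] a(2)[of "- x" "x + y"] a(3)[OF that] that by auto
  show "x + y \<in> R \<longleftrightarrow> x \<in> R" if "y \<in> R"
    using a(2)[of x y] a(2)[of "x + y" "- y"] a(3)[OF that] that by auto
qed

lemma is_subgroup_Int: "is_subgroup A \<Longrightarrow> is_subgroup B \<Longrightarrow> is_subgroup (A \<inter> B)"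
  by (auto simp: is_subgroup_def)

lemma is_subgroup_UNIV: "is_subgroup UNIV"
  by (simp add: is_subgroup_def)

lemma is_subgroup_Times: "is_subgroup A \<Longrightarrow> is_subgroup B \<Longrightarrow> is_subgroup (A \<times> B)"
  by (auto simp: is_subgroup_def zero_prod_def)

lemma left_translate_vimage: "(\<lambda>x. a + x) ` A = (\<lambda>x. - a + x) -` (A :: 'g::group_add set)"
  by (force simp: add.assoc[symmetric])

lemma right_translate_vimage: "(\<lambda>x. x + a) ` A = (\<lambda>x. x - a) -` (A :: 'g::group_add set)"
  by (force simp: add.assoc)

lemma translate_subgroup:
  assumes "is_subgroup K" "r \<in> (\<lambda>x. a + x) ` K"
  shows "(\<lambda>x. r + x) ` K = (\<lambda>x. a + x) ` K"
proof -
  obtain k where k: "r = a + k" "k \<in> K" using assms(2) by auto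
  have "(- a + x \<in> K) = (- k + (- a + x) \<in> K)" for x
    using is_subgroupD(5)[OF assms(1) is_subgroupD(3)[OF assms(1) k(2)]] by simp
  moreover have "- (a + k) + x = - k + (- a + x)" for x
    by (simp add: minus_add add.assoc diff_conv_add_uminus del: add_uminus_conv_diff)
  ultimately show ?thesis unfolding left_translate_vimage k(1) by auto
qed

lemma continuous_on_left_translate: "continuous_on S (\<lambda>x. a + x :: 'g::topological_monoid_add)"
  by (intro continuous_on_add continuous_on_const continuous_on_id)

lemma continuous_on_right_translate: "continuous_on S (\<lambda>x. x + a :: 'g::topological_monoid_add)"
  by (intro continuous_on_add continuous_on_const continuous_on_id)

lemma open_left_translate: "open U \<Longrightarrow> open ((\<lambda>x. a + x :: 'g::topological_group_add) ` U)"
  unfolding left_translate_vimage by (rule open_vimage[OF _ continuous_on_left_translate])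

lemma open_right_translate: "open U \<Longrightarrow> open ((\<lambda>x. x + a :: 'g::topological_group_add) ` U)"
  unfolding right_translate_vimage using open_vimage[OF _ continuous_on_right_translate, of U "- a"] by simp

lemma compact_left_translate: "compact U \<Longrightarrow> compact ((\<lambda>x. a + x :: 'g::topological_group_add) ` U)"
  by (rule compact_continuous_image[OF continuous_on_left_translate])

lemma compact_right_translate: "compact U \<Longrightarrow> compact ((\<lambda>x. x + a :: 'g::topological_group_add) ` U)"
  by (rule compact_continuous_image[OF continuous_on_right_translate])

lemma borel_left_translate:
  fixes A :: "'g::topological_group_add set"
  assumes "A \<in> sets borel" shows "(\<lambda>x. a + x) ` A \<in> sets borel"
proof -
  have "(\<lambda>x. - a + x :: 'g) \<in> borel \<rightarrow>\<^sub>M borel"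
    by (intro borel_measurable_continuous_onI continuous_on_left_translate)
  from measurable_sets[OF this assms] show ?thesis by (simp add: left_translate_vimage)
qed

lemma compact_set_plus:
  fixes A B :: "'g::topological_monoid_add set"
  assumes "compact A" "compact B" shows "compact {x + y | x y. x \<in> A \<and> y \<in> B}"
proof -
  have "continuous_on (A \<times> B) (\<lambda>p. fst p + snd p)"
    by (intro continuous_on_add continuous_on_fst continuous_on_snd continuous_on_id)
  then have "compact ((\<lambda>p. fst p + snd p) ` (A \<times> B))"
    using assms by (intro compact_continuous_image compact_Times)
  also have "(\<lambda>p. fst p + snd p) ` (A \<times> B) = {x + y | x y. x \<in> A \<and> y \<in> B}" by force
  finally show ?thesis .
qed

lemma open_subgroup_closed:
  assumes "is_subgroup (D :: 'g::topological_group_add set)" "open D" shows "closed D"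
proof -
  have "- D = (\<Union>x\<in>- D. (\<lambda>d. x + d) ` D)"
  proof (intro equalityI subsetI)
    fix x assume "x \<in> - D"
    then show "x \<in> (\<Union>x\<in>- D. (\<lambda>d. x + d) ` D)" using is_subgroupD(1)[OF assms(1)]
      by (metis UN_I add.right_neutral imageI)
  qed (use is_subgroupD(6)[OF assms(1)] in auto)
  then have "open (- D)" using open_left_translate[OF assms(2)] by (metis (no_types, lifting) open_UN)
  then show ?thesis by (simp add: closed_def)
qed

lemma subgroup_openI:
  assumes "is_subgroup (D :: 'g::topological_group_add set)" "open U" "U \<noteq> {}" "U \<subseteq> D" shows "open D"
proof -
  obtain u where u: "u \<in> U" using assms(3) by blast
  have "D = (\<Union>x\<in>D. (\<lambda>d. (x - u) + d) ` U)"
  proof (intro equalityI subsetI)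
    fix x assume "x \<in> D"
    moreover have "x = (x - u) + u" by simp
    ultimately show "x \<in> (\<Union>x\<in>D. (\<lambda>d. (x - u) + d) ` U)" using u by blast
  next
    fix x assume "x \<in> (\<Union>x\<in>D. (\<lambda>d. (x - u) + d) ` U)"
    then obtain y v where "y \<in> D" "v \<in> U" "x = (y - u) + v" by blast
    then show "x \<in> D" using u assms(4) is_subgroupD(2,4)[OF assms(1)] by (metis subsetD)
  qed
  then show ?thesis using open_left_translate[OF assms(2)] by (metis (no_types, lifting) open_UN)
qed

lemma haar_measure_onD:
  assumes "haar_measure_on R \<mu>"
  shows "locally_finite_borel \<mu>" "sets \<mu> = sets borel" "emeasure \<mu> (- R) = 0" "emeasure \<mu> R \<noteq> 0"
    "r \<in> R \<Longrightarrow> A \<in> sets borel \<Longrightarrow> emeasure \<mu> ((\<lambda>x. r + x) ` A) = emeasure \<mu> A"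
  using assms by (auto simp: haar_measure_on_def locally_finite_borel_def)

text \<open>By the Lindelof property the union of all null open sets is a countable union of such
  sets, hence null. It shows that the complement of a support is null.\<close>

lemma null_on_open_cover:
  fixes M :: "'x::second_countable_topology measure"
  assumes "sets M = sets borel" "\<And>x. x \<in> B \<Longrightarrow> \<exists>U. open U \<and> x \<in> U \<and> emeasure M U = 0"
  shows "\<exists>B'. open B' \<and> B \<subseteq> B' \<and> emeasure M B' = 0"
proof -
  obtain F where F: "F \<subseteq> {U. open U \<and> emeasure M U = 0}" "countable F" "\<Union>F = \<Union>{U. open U \<and> emeasure M U = 0}"
    using Lindelof[of "{U. open U \<and> emeasure M U = 0}"] by blast
  have "(\<Union>U\<in>F. U) \<in> null_sets M"
    using F(1,2) assms(1) by (intro null_sets_UN') (auto simp: null_sets_def)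
  moreover have "B \<subseteq> \<Union>F"
  proof
    fix x assume "x \<in> B"
    then obtain U where "open U" "x \<in> U" "emeasure M U = 0" using assms(2) by blast
    then show "x \<in> \<Union>F" unfolding F(3) by blast
  qed
  ultimately show ?thesis using F(1) by (intro exI[of _ "\<Union>F"]) (auto simp: null_sets_def)
qed

text \<open>If an open set meeting \<open>R\<close> were null, its translates by elements of
  \<open>R\<close> would be null and would cover \<open>R\<close>.\<close>

lemma haar_charges_open:
  fixes R :: "'g::{topological_group_add,second_countable_topology} set"
  assumes R: "is_subgroup R" "haar_measure_on R \<mu>" and U: "open U" "U \<inter> R \<noteq> {}"
  shows "emeasure \<mu> U \<noteq> 0"
proof
  assume 0: "emeasure \<mu> U = 0"
  obtain u where u: "u \<in> U" "u \<in> R" using U(2) by blast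
  have "\<exists>V. open V \<and> x \<in> V \<and> emeasure \<mu> V = 0" if "x \<in> R" for x
  proof (intro exI[of _ "(\<lambda>y. (x - u) + y) ` U"] conjI)
    show "x \<in> (\<lambda>y. (x - u) + y) ` U" using u(1) by (intro image_eqI[of _ _ u]) auto
    show "emeasure \<mu> ((\<lambda>y. (x - u) + y) ` U) = 0"
      using haar_measure_onD(5)[OF R(2) is_subgroupD(4)[OF R(1) that u(2)], of U] U(1) 0 by simp
  qed (rule open_left_translate[OF U(1)])
  then obtain B where B: "open B" "R \<subseteq> B" "emeasure \<mu> B = 0"
    using null_on_open_cover[OF haar_measure_onD(2)[OF R(2)], of R] by blast
  have "emeasure \<mu> R \<le> emeasure \<mu> B" using B haar_measure_onD(2)[OF R(2)] by (intro emeasure_mono) auto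
  then show False using B(3) haar_measure_onD(4)[OF R(2)] by simp
qed

lemma (in compact_open_partition) sigma_finite_locally_finite:
  assumes "locally_finite_borel (M :: 'x measure)" shows "sigma_finite_measure M"
proof
  show "\<exists>A. countable A \<and> A \<subseteq> sets M \<and> \<Union>A = space M \<and> (\<forall>a\<in>A. emeasure M a \<noteq> \<infinity>)"
    using locally_finite_borelD(1,2)[OF assms] locally_finite_borelD(4)[OF assms compact_X] open_X Un_X
    by (intro exI[of _ "range X"]) auto
qed

section \<open>Uniqueness of Haar measures on closed subgroups\<close>

locale compact_open_subgroup =
  fixes K :: "'g::{topological_group_add,second_countable_topology,t2_space} set"
  assumes subgroup_K: "is_subgroup K" and open_K: "open K" and compact_K: "compact K"
begin

lemma partition_exists:
  obtains X :: "nat \<Rightarrow> 'g set" where "compact_open_partition X"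
proof (rule compact_open_partition_exists)
  fix x :: 'g
  show "\<exists>C. open C \<and> compact C \<and> x \<in> C"
    using open_left_translate[OF open_K, of x] compact_left_translate[OF compact_K, of x] is_subgroupD(1)[OF subgroup_K]
    by (intro exI[of _ "(\<lambda>y. x + y) ` K"]) (force intro: image_eqI[of _ _ 0])
qed

text \<open>Only inclusion in a coset is claimed, since taking differences leaves an empty set
  wherever the enumeration repeats a coset.\<close>

lemma coset_partition:
  obtains D :: "nat \<Rightarrow> 'g set" and a where "\<And>n. D n \<in> sets borel" "\<And>n. D n \<subseteq> (\<lambda>x. a n + x) ` K"
    "disjoint_family D" "(\<Union>n. D n) = UNIV"
proof -
  obtain F where F: "F \<subseteq> range (\<lambda>a. (\<lambda>x. a + x) ` K)" "countable F" "\<Union>F = \<Union>(range (\<lambda>a. (\<lambda>x. a + x) ` K))"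
    using Lindelof[of "range (\<lambda>a. (\<lambda>x. a + x) ` K)"] open_left_translate[OF open_K] by blast
  have "x \<in> (\<lambda>y. x + y) ` K" for x using is_subgroupD(1)[OF subgroup_K] by (force intro: image_eqI[of _ _ 0])
  then have UF: "\<Union>F = UNIV" using F(3) by blast
  then have "F \<noteq> {}" by auto
  define Y where "Y = from_nat_into F"
  have rY: "range Y = F" unfolding Y_def using F(2) \<open>F \<noteq> {}\<close> by (rule range_from_nat_into[rotated])
  then have "\<exists>a. Y n = (\<lambda>x. a + x) ` K" for n using F(1) by blast
  then obtain a where a: "\<And>n. Y n = (\<lambda>x. a n + x) ` K" by metis
  show thesis
  proof (rule that[of "disjointed Y" a])
    show "disjointed Y n \<in> sets borel" for n
      using open_left_translate[OF open_K] sets.range_disjointed_sets[of Y borel] by (force simp: a)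
    show "disjointed Y n \<subseteq> (\<lambda>x. a n + x) ` K" for n using disjointed_subset[of Y n] a by simp
  qed (simp_all add: disjoint_family_disjointed UN_disjointed_eq rY UF)
qed

lemma haar_K:
  assumes "is_subgroup R" "haar_measure_on R \<mu>"
  shows "emeasure \<mu> K \<noteq> 0" "emeasure \<mu> K \<noteq> \<infinity>"
  using haar_charges_open[OF assms open_K] is_subgroupD(1)[OF assms(1)] is_subgroupD(1)[OF subgroup_K]
    locally_finite_borelD(4)[OF haar_measure_onD(1)[OF assms(2)] compact_K] by auto

text \<open>On the compact group \<open>R \<inter> K\<close> a left Haar measure is compared with the inverse of another one
  by Fubini.\<close>

lemma haar_inverse_on_K:
  assumes R: "is_subgroup R" "closed R" and \<mu>: "haar_measure_on R \<mu>" and \<nu>: "haar_measure_on R \<nu>"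
    and A: "A \<in> sets borel" "A \<subseteq> K"
  shows "emeasure \<nu> K * emeasure \<mu> A = emeasure \<mu> K * emeasure \<nu> (uminus ` A)"
proof -
  obtain X :: "nat \<Rightarrow> 'g set" where "compact_open_partition X" by (rule partition_exists)
  then interpret X: compact_open_partition X .
  note s = haar_measure_onD(2)[OF \<mu>] haar_measure_onD(2)[OF \<nu>]
  interpret m: sigma_finite_measure \<mu> by (rule X.sigma_finite_locally_finite[OF haar_measure_onD(1)[OF \<mu>]])
  interpret n: sigma_finite_measure \<nu> by (rule X.sigma_finite_locally_finite[OF haar_measure_onD(1)[OF \<nu>]])
  interpret p: pair_sigma_finite \<nu> \<mu> ..
  \<comment> \<open>For fixed \<open>x\<close> in \<open>K\<close> this is the indicator of the
    translate of \<open>A\<close> by \<open>x\<close>; for fixed \<open>y\<close> in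
    \<open>K\<close> it is the indicator of the translate by \<open>y\<close> of the set of inverses
    of \<open>A\<close>.\<close>
  define f :: "'g \<Rightarrow> 'g \<Rightarrow> ennreal" where "f x y = indicator K x * (indicator K y * indicator A (- x + y))" for x y
  \<comment> \<open>Invariance is available only for translations by elements of \<open>R\<close>,
    so the inner integrals are evaluated almost everywhere.\<close>
  have AEm: "AE y in \<mu>. y \<in> R" and AEn: "AE y in \<nu>. y \<in> R"
    using haar_measure_onD(3)[OF \<mu>] haar_measure_onD(3)[OF \<nu>] R(2) s
    by (auto intro!: AE_I[of _ _ "- R"])
  have "(\<lambda>z. - fst z + snd z :: 'g) \<in> borel \<rightarrow>\<^sub>M borel"
    by (intro borel_measurable_continuous_onI continuous_on_add continuous_on_minus continuous_on_fst continuous_on_snd continuous_on_id)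
  then have [measurable]: "(\<lambda>z. - fst z + snd z :: 'g) \<in> borel \<Otimes>\<^sub>M borel \<rightarrow>\<^sub>M borel" by (simp add: borel_prod)
  have [measurable]: "A \<in> sets borel" "K \<in> sets borel" using A open_K by auto
  have "(\<lambda>z. f (fst z) (snd z)) \<in> borel_measurable (borel \<Otimes>\<^sub>M borel)"
    unfolding f_def by measurable
  then have f: "case_prod f \<in> borel_measurable (\<nu> \<Otimes>\<^sub>M \<mu>)"
    using s by (simp add: case_prod_unfold cong: measurable_cong_sets sets_pair_measure_cong)
  have "(\<integral>\<^sup>+x. (\<integral>\<^sup>+y. f x y \<partial>\<mu>) \<partial>\<nu>) = (\<integral>\<^sup>+x. emeasure \<mu> A * indicator K x \<partial>\<nu>)"
  proof (rule nn_integral_cong_AE)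
    show "AE x in \<nu>. (\<integral>\<^sup>+y. f x y \<partial>\<mu>) = emeasure \<mu> A * indicator K x"
      using AEn
    proof eventually_elim
      fix x assume x: "x \<in> R"
      show "(\<integral>\<^sup>+y. f x y \<partial>\<mu>) = emeasure \<mu> A * indicator K x"
      proof (cases "x \<in> K")
        case True
        have "f x y = indicator ((\<lambda>z. x + z) ` A) y" for y
        proof -
          have "y \<in> K" if "- x + y \<in> A"
            using that A(2) is_subgroupD(5)[OF subgroup_K is_subgroupD(3)[OF subgroup_K True]] by blast
          then show ?thesis using True by (auto simp: f_def left_translate_vimage indicator_def)
        qed
        then have "(\<integral>\<^sup>+y. f x y \<partial>\<mu>) = emeasure \<mu> ((\<lambda>z. x + z) ` A)"
          using borel_left_translate[OF A(1)] s by simp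
        then show ?thesis using haar_measure_onD(5)[OF \<mu> x A(1)] True by simp
      qed (simp add: f_def)
    qed
  qed
  also have "\<dots> = emeasure \<mu> A * emeasure \<nu> K"
    using open_K s by (intro nn_integral_cmult_indicator) auto
  finally have 1: "(\<integral>\<^sup>+x. (\<integral>\<^sup>+y. f x y \<partial>\<mu>) \<partial>\<nu>) = emeasure \<mu> A * emeasure \<nu> K" .
  have um: "uminus ` A = uminus -` A" by (force)
  have "(uminus :: 'g \<Rightarrow> 'g) \<in> borel \<rightarrow>\<^sub>M borel"
    by (intro borel_measurable_continuous_onI continuous_on_minus continuous_on_id)
  from measurable_sets[OF this A(1)] have uA: "uminus ` A \<in> sets borel" by (simp add: um)
  have "(\<integral>\<^sup>+y. (\<integral>\<^sup>+x. f x y \<partial>\<nu>) \<partial>\<mu>) = (\<integral>\<^sup>+y. emeasure \<nu> (uminus ` A) * indicator K y \<partial>\<mu>)"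
  proof (rule nn_integral_cong_AE)
    show "AE y in \<mu>. (\<integral>\<^sup>+x. f x y \<partial>\<nu>) = emeasure \<nu> (uminus ` A) * indicator K y"
      using AEm
    proof eventually_elim
      fix y assume y: "y \<in> R"
      show "(\<integral>\<^sup>+x. f x y \<partial>\<nu>) = emeasure \<nu> (uminus ` A) * indicator K y"
      proof (cases "y \<in> K")
        case True
        have "f x y = indicator ((\<lambda>z. y + z) ` uminus ` A) x" for x
        proof -
          have "x \<in> K" if "- x + y \<in> A"
            using that A(2) is_subgroupD(6)[OF subgroup_K True, of "- x"] is_subgroupD(3)[OF subgroup_K, of "- x"] by auto
          moreover have "x \<in> (\<lambda>z. y + z) ` uminus ` A \<longleftrightarrow> - x + y \<in> A"
            unfolding left_translate_vimage um by (simp add: minus_add)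
          ultimately show ?thesis using True by (auto simp: f_def indicator_def)
        qed
        then have "(\<integral>\<^sup>+x. f x y \<partial>\<nu>) = emeasure \<nu> ((\<lambda>z. y + z) ` uminus ` A)"
          using borel_left_translate[OF uA] s by simp
        then show ?thesis using haar_measure_onD(5)[OF \<nu> y uA] True by simp
      qed (simp add: f_def)
    qed
  qed
  also have "\<dots> = emeasure \<nu> (uminus ` A) * emeasure \<mu> K"
    using open_K s by (intro nn_integral_cmult_indicator) auto
  finally have 2: "(\<integral>\<^sup>+y. (\<integral>\<^sup>+x. f x y \<partial>\<nu>) \<partial>\<mu>) = emeasure \<nu> (uminus ` A) * emeasure \<mu> K" .
  show ?thesis using p.Fubini'[OF f] unfolding 1 2 by (simp add: mult.commute)
qed

text \<open>The preceding identity with both measures equal shows that a Haar measure is inversion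
  invariant on subsets of \<open>K\<close>; this removes the inverse from the comparison of two
  measures.\<close>

lemma haar_unique_on_K:
  assumes R: "is_subgroup R" "closed R" and \<mu>: "haar_measure_on R \<mu>" and \<nu>: "haar_measure_on R \<nu>"
    and A: "A \<in> sets borel" "A \<subseteq> K"
  shows "emeasure \<nu> K * emeasure \<mu> A = emeasure \<mu> K * emeasure \<nu> A"
proof -
  have "emeasure \<nu> K * emeasure \<nu> A = emeasure \<nu> K * emeasure \<nu> (uminus ` A)"
    by (rule haar_inverse_on_K[OF R \<nu> \<nu> A])
  then have "emeasure \<nu> A = emeasure \<nu> (uminus ` A)"
    using haar_K[OF R(1) \<nu>] by (simp add: ennreal_mult_cancel_left)
  then show ?thesis using haar_inverse_on_K[OF R \<mu> \<nu> A] by simp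
qed

text \<open>\<open>A\<close> is cut along cosets of \<open>K\<close>. A part that meets
  \<open>R\<close> at \<open>r\<close> is moved into \<open>K\<close> by \<open>- r\<close>, an
  element of \<open>R\<close>, without change of measure; a part that misses \<open>R\<close> is
  null.\<close>

lemma haar_unique:
  assumes R: "is_subgroup R" "closed R" and \<mu>: "haar_measure_on R \<mu>" and \<nu>: "haar_measure_on R \<nu>"
    and A: "A \<in> sets borel"
  shows "emeasure \<nu> K * emeasure \<mu> A = emeasure \<mu> K * emeasure \<nu> A"
proof -
  obtain D :: "nat \<Rightarrow> 'g set" and a where D: "\<And>n. D n \<in> sets borel" "\<And>n. D n \<subseteq> (\<lambda>x. a n + x) ` K"
    "disjoint_family D" "(\<Union>n. D n) = UNIV" by (rule coset_partition) blast
  have piece: "emeasure \<nu> K * emeasure \<mu> (A \<inter> D n) = emeasure \<mu> K * emeasure \<nu> (A \<inter> D n)" for n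
  proof (cases "A \<inter> D n \<inter> R = {}")
    case True
    have "emeasure M (A \<inter> D n) = 0" if "haar_measure_on R M" for M
    proof -
      have "emeasure M (A \<inter> D n) \<le> emeasure M (- R)"
        using True R(2) haar_measure_onD(2)[OF that] by (intro emeasure_mono) auto
      then show ?thesis using haar_measure_onD(3)[OF that] by simp
    qed
    then show ?thesis using \<mu> \<nu> by simp
  next
    case False
    then obtain r where r: "r \<in> A \<inter> D n" "r \<in> R" by blast
    have mr: "- r \<in> R" using r(2) R(1) by (rule is_subgroupD(3)[rotated])
    have B: "(\<lambda>x. - r + x) ` (A \<inter> D n) \<in> sets borel" using A D(1) by (intro borel_left_translate) auto
    have "D n \<subseteq> (\<lambda>x. r + x) ` K" using translate_subgroup[OF subgroup_K, of r "a n"] r D(2)[of n] by blast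
    then have "(\<lambda>x. - r + x) ` (A \<inter> D n) \<subseteq> K" by (auto simp: left_translate_vimage)
    from haar_unique_on_K[OF R \<mu> \<nu> B this]
    show ?thesis using haar_measure_onD(5)[OF \<mu> mr, of "A \<inter> D n"] haar_measure_onD(5)[OF \<nu> mr, of "A \<inter> D n"] A D(1) by simp
  qed
  have dec: "emeasure M A = (\<Sum>n. emeasure M (A \<inter> D n))" if "sets M = sets borel" for M
  proof -
    have "(\<Sum>n. emeasure M (A \<inter> D n)) = emeasure M (\<Union>n. A \<inter> D n)"
      using D(1,3) that A by (intro suminf_emeasure) (auto simp: disjoint_family_on_def)
    also have "(\<Union>n. A \<inter> D n) = A" using D(4) by auto
    finally show ?thesis by simp
  qed
  show ?thesis
    unfolding dec[OF haar_measure_onD(2)[OF \<mu>]] dec[OF haar_measure_onD(2)[OF \<nu>]] ennreal_suminf_cmult[symmetric]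
    by (rule suminf_cong) (rule piece)
qed

end

section \<open>Vague limits of Haar measures, and existence on closed subgroups\<close>

lemma filterlim_strict_mono_choice:
  assumes "\<And>k::nat. \<forall>\<^sub>F j in sequentially. P k j"
  obtains s :: "nat \<Rightarrow> nat" where "strict_mono s" "\<And>k. P k (s k)"
proof -
  have ex: "\<exists>j. n < j \<and> P k j" for k n
    using eventually_conj[OF assms[of k] eventually_gt_at_top[of n]]
    by (metis (no_types, lifting) eventually_sequentially order_refl)
  have "\<exists>s. \<forall>k. P k (s k) \<and> s k < s (Suc k)"
    by (rule dependent_nat_choice) (use ex in blast)+
  then obtain s where "\<And>k. P k (s k)" "\<And>k. s k < s (Suc k)" by blast
  then show thesis using that by (auto simp: strict_mono_Suc_iff)
qed

lemma nbhd_sequence: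
  fixes x :: "'x::first_countable_topology"
  obtains W :: "nat \<Rightarrow> 'x set" where "(\<forall>k. open (W k)) \<and> (\<forall>k. x \<in> W k) \<and>
    (\<forall>T. open T \<longrightarrow> x \<in> T \<longrightarrow> (\<forall>\<^sub>F k in sequentially. W k \<subseteq> T))"
proof (rule countable_basis_at_decseq[of x])
  fix A :: "nat \<Rightarrow> 'x set"
  assume "\<And>i. open (A i)" "\<And>i. x \<in> A i" "\<And>S. open S \<Longrightarrow> x \<in> S \<Longrightarrow> \<forall>\<^sub>F i in sequentially. A i \<subseteq> S"
  then show thesis by (intro that[of A]) simp
qed

lemma mem_left_coset: "is_subgroup K \<Longrightarrow> x \<in> (\<lambda>y. x + y) ` K"
  using is_subgroupD(1)[of K] by (metis add.right_neutral imageI)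

lemma compact_set_minus:
  fixes A B :: "'g::topological_group_add set"
  assumes "compact A" "compact B" shows "compact {- x + y | x y. x \<in> A \<and> y \<in> B}"
proof -
  have "continuous_on (A \<times> B) (\<lambda>p. - fst p + snd p)"
    by (intro continuous_on_add continuous_on_minus continuous_on_fst continuous_on_snd continuous_on_id)
  then have "compact ((\<lambda>p. - fst p + snd p) ` (A \<times> B))"
    using assms by (intro compact_continuous_image compact_Times)
  also have "(\<lambda>p. - fst p + snd p) ` (A \<times> B) = {- x + y | x y. x \<in> A \<and> y \<in> B}" by force
  finally show ?thesis .
qed

lemma test_function_translate:
  fixes \<theta> :: "'g::topological_group_add \<Rightarrow> real"
  assumes "test_function \<theta>" shows "test_function (\<lambda>y. \<theta> (x + y))"
proof -
  let ?S = "closure {x. \<theta> x \<noteq> 0}"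
  have S: "compact ?S" "continuous_on UNIV \<theta>" using assms by (auto simp: test_function_def)
  have c: "compact ((\<lambda>y. - x + y) ` ?S)" using S(1) by (rule compact_left_translate)
  have "closed ((\<lambda>y. - x + y) ` ?S)"
    unfolding left_translate_vimage by (intro closed_vimage continuous_on_left_translate) simp
  moreover have "{y. \<theta> (x + y) \<noteq> 0} \<subseteq> (\<lambda>y. - x + y) ` ?S"
    unfolding left_translate_vimage using closure_subset[of "{x. \<theta> x \<noteq> 0}"] by auto
  ultimately have "compact (closure {y. \<theta> (x + y) \<noteq> 0})"
    by (intro compact_closed_subset[OF c] closure_minimal) auto
  moreover have "continuous_on UNIV (\<lambda>y. \<theta> (x + y))"
    using continuous_on_compose2[OF S(2) continuous_on_left_translate] by simp
  ultimately show ?thesis by (simp add: test_function_def)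
qed

lemma distr_left_translate_invariant:
  fixes M :: "'g::topological_group_add measure"
  assumes "sets M = sets borel" "\<And>A. A \<in> sets borel \<Longrightarrow> emeasure M ((\<lambda>y. x + y) ` A) = emeasure M A"
  shows "distr M borel (\<lambda>y. x + y) = M"
proof (rule measure_eqI)
  have m: "(\<lambda>y. x + y) \<in> M \<rightarrow>\<^sub>M borel"
    using borel_measurable_continuous_onI[OF continuous_on_left_translate] assms(1) by (simp cong: measurable_cong_sets)
  fix A assume "A \<in> sets (distr M borel (\<lambda>y. x + y))"
  then have A: "A \<in> sets borel" by simp
  have "(\<lambda>y. x + y) -` A = (\<lambda>y. - x + y) ` A" by (simp add: left_translate_vimage)
  then have "emeasure (distr M borel (\<lambda>y. x + y)) A = emeasure M ((\<lambda>y. - x + y) ` A)"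
    using emeasure_distr[OF m A] sets_eq_imp_space_eq[OF assms(1)] by simp
  also have "\<dots> = emeasure M ((\<lambda>y. x + y) ` (\<lambda>y. - x + y) ` A)"
    using assms(2)[OF borel_left_translate[OF A]] by simp
  also have "(\<lambda>y. x + y) ` (\<lambda>y. - x + y) ` A = A" by (force simp: image_image)
  finally show "emeasure (distr M borel (\<lambda>y. x + y)) A = emeasure M A" .
qed (use assms in simp)

context compact_open_subgroup
begin

text \<open>By uniform continuity on a compact set, \<open>\<theta> (r j + y)\<close> and
  \<open>\<theta> (x + y)\<close> eventually differ little, uniformly in \<open>y\<close>, while the
  masses of a compact open set containing both supports stay bounded. So invariance under
  \<open>r j\<close> passes to invariance of the limit under \<open>x\<close>.\<close>

lemma vague_limit_invariant:
  assumes conv: "vague_converges \<mu> M" and M: "locally_finite_borel M" and \<mu>: "\<And>j. locally_finite_borel (\<mu> j)"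
    and r: "r \<longlonglongrightarrow> x"
    and inv: "\<And>j A. A \<in> sets borel \<Longrightarrow> emeasure (\<mu> j) ((\<lambda>y. r j + y) ` A) = emeasure (\<mu> j) A"
    and A: "(A :: 'g set) \<in> sets borel"
  shows "emeasure M ((\<lambda>y. x + y) ` A) = emeasure M A"
proof -
  obtain X :: "nat \<Rightarrow> 'g set" where "compact_open_partition X" by (rule partition_exists)
  then interpret X: compact_open_partition X .
  note s = locally_finite_borelD(1)[OF M] locally_finite_borelD(1)[OF \<mu>]
  have tm: "(\<lambda>y. z + y) \<in> N \<rightarrow>\<^sub>M borel" if "sets N = sets borel" for N and z :: 'g
    using borel_measurable_continuous_onI[OF continuous_on_left_translate] that by (simp cong: measurable_cong_sets)
  define N where "N = distr M borel (\<lambda>y. x + y)"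
  have emN: "emeasure N B = emeasure M ((\<lambda>y. - x + y) ` B)" if "B \<in> sets borel" for B
    unfolding N_def using emeasure_distr[OF tm[OF s(1)] that] locally_finite_borelD(2)[OF M]
    by (simp add: left_translate_vimage)
  have N: "locally_finite_borel N"
    unfolding locally_finite_borel_def
  proof (intro conjI allI impI)
    fix C :: "'g set" assume C: "compact C"
    then have "C \<in> sets borel" by (rule borel_compact)
    then show "emeasure N C < \<infinity>"
      using emN locally_finite_borelD(3)[OF M compact_left_translate[OF C]] by simp
  qed (simp add: N_def)
  have "N = M"
  proof (rule X.locally_finite_borel_eqI[OF N M])
    fix \<theta> :: "'g \<Rightarrow> real" assume \<theta>: "test_function \<theta>"
    define S where "S = closure {x. \<theta> x \<noteq> 0}"
    have S: "compact S" "continuous_on UNIV \<theta>" "\<And>y. y \<notin> S \<Longrightarrow> \<theta> y = 0"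
      using \<theta> closure_subset[of "{x. \<theta> x \<noteq> 0}"] by (auto simp: test_function_def S_def)
    have mth: "\<theta> \<in> borel_measurable borel" by (rule test_function_measurable[OF \<theta> refl])
    \<comment> \<open>A compact neighbourhood of \<open>x\<close>: the functions
      \<open>\<theta> (z + y)\<close> of \<open>y\<close>, for \<open>z\<close> in \<open>V\<close>,
      all vanish off one compact open set \<open>C\<close>.\<close>
    define V where "V = (\<lambda>y. x + y) ` K"
    have V: "open V" "compact V" "x \<in> V"
      unfolding V_def using open_left_translate[OF open_K] compact_left_translate[OF compact_K] mem_left_coset[OF subgroup_K]
      by auto
    obtain m where m: "{- v + y | v y. v \<in> V \<and> y \<in> S} \<subseteq> (\<Union>n\<le>m. X n)"
      by (rule X.compact_subset_pieces[OF compact_set_minus[OF V(2) S(1)]])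
    define C where "C = (\<Union>n\<le>m. X n)"
    have C: "open C" "compact C" unfolding C_def by (auto intro!: X.open_X X.compact_X)
    have zero: "\<theta> (z + y) = 0" if "z \<in> V" "y \<notin> C" for z y
    proof (rule S(3))
      show "z + y \<notin> S"
      proof
        assume "z + y \<in> S"
        moreover have "y = - z + (z + y)" by (simp add: add.assoc[symmetric])
        ultimately show False using that m unfolding C_def by blast
      qed
    qed
    have lim1: "(\<lambda>j. \<integral>y. \<theta> (x + y) \<partial>\<mu> j) \<longlonglongrightarrow> (\<integral>y. \<theta> (x + y) \<partial>M)"
      by (rule vague_convergesD[OF conv test_function_translate[OF \<theta>]])
    have eqj: "(\<integral>y. \<theta> (r j + y) \<partial>\<mu> j) = (\<integral>y. \<theta> y \<partial>\<mu> j)" for j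
    proof -
      have "(\<integral>y. \<theta> y \<partial>distr (\<mu> j) borel (\<lambda>y. r j + y)) = (\<integral>y. \<theta> (r j + y) \<partial>\<mu> j)"
        by (rule integral_distr[OF tm[OF s(2)] mth])
      moreover have "distr (\<mu> j) borel (\<lambda>y. r j + y) = \<mu> j"
        by (rule distr_left_translate_invariant[OF s(2) inv])
      ultimately show ?thesis by simp
    qed
    \<comment> \<open>The added 1 makes \<open>L\<close> positive and larger than the limit mass, so
      that it eventually bounds the masses.\<close>
    define L where "L = measure M C + 1"
    have Lpos: "L > 0" unfolding L_def by (simp add: add_nonneg_pos)
    have evL: "\<forall>\<^sub>F j in sequentially. measure (\<mu> j) C < L"
      using vague_converges_compact_open[OF conv C M \<mu>] by (rule order_tendstoD(2)) (simp add: L_def)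
    have lim2: "(\<lambda>j. (\<integral>y. \<theta> (r j + y) \<partial>\<mu> j) - (\<integral>y. \<theta> (x + y) \<partial>\<mu> j)) \<longlonglongrightarrow> 0"
    proof (rule tendstoI)
      fix e :: real assume e: "e > 0"
      define d where "d = e / (2 * L)"
      have d: "d > 0" "d * L < e" using e Lpos by (auto simp: d_def field_simps)
      have "continuous_on (UNIV \<times> C) (\<lambda>p. \<theta> (fst p + snd p))"
        by (rule continuous_on_compose2[OF S(2)])
          (auto intro!: continuous_on_add continuous_on_fst continuous_on_snd continuous_on_id)
      from continuous_on_prod_compactE[OF this C(2) UNIV_I d(1), of x]
      obtain W where W: "x \<in> W" "open W" "\<forall>z\<in>W \<inter> UNIV. \<forall>y\<in>C. dist (\<theta> (z + y)) (\<theta> (x + y)) \<le> d"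
        by auto
      have "\<forall>\<^sub>F j in sequentially. r j \<in> W \<inter> V"
        by (rule topological_tendstoD[OF r]) (use W V in auto)
      then show "\<forall>\<^sub>F j in sequentially. dist ((\<integral>y. \<theta> (r j + y) \<partial>\<mu> j) - (\<integral>y. \<theta> (x + y) \<partial>\<mu> j)) 0 < e"
        using evL
      proof eventually_elim
        fix j assume rj: "r j \<in> W \<inter> V" and mC: "measure (\<mu> j) C < L"
        have i: "integrable (\<mu> j) (\<lambda>y. \<theta> (z + y))" for z
          by (rule test_function_integrable[OF test_function_translate[OF \<theta>] s(2)]) (use \<mu>[of j] in \<open>auto simp: locally_finite_borel_def\<close>)
        have iC: "integrable (\<mu> j) (indicator C :: 'g \<Rightarrow> real)"
          by (rule test_function_integrable[OF test_function_indicator[OF C] s(2)]) (use \<mu>[of j] in \<open>auto simp: locally_finite_borel_def\<close>)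
        have le: "\<bar>\<theta> (r j + y) - \<theta> (x + y)\<bar> \<le> d * indicator C y" for y
        proof (cases "y \<in> C")
          case True
          then show ?thesis using W(3) rj by (auto simp: dist_real_def)
        next
          case False
          then show ?thesis using zero[of "r j" y] zero[of x y] rj V(3) by simp
        qed
        have "\<bar>(\<integral>y. \<theta> (r j + y) \<partial>\<mu> j) - (\<integral>y. \<theta> (x + y) \<partial>\<mu> j)\<bar> = \<bar>\<integral>y. \<theta> (r j + y) - \<theta> (x + y) \<partial>\<mu> j\<bar>"
          by (simp add: Bochner_Integration.integral_diff[OF i i])
        also have "\<dots> \<le> (\<integral>y. \<bar>\<theta> (r j + y) - \<theta> (x + y)\<bar> \<partial>\<mu> j)" by (rule integral_abs_bound)
        also have "\<dots> \<le> (\<integral>y. d * indicator C y \<partial>\<mu> j)"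
          by (intro integral_mono integrable_abs Bochner_Integration.integrable_diff i integrable_mult_right iC le)
        also have "\<dots> = d * measure (\<mu> j) C"
          using integral_test_indicator(1)[OF C \<mu>[of j]] by (subst integral_mult_right_zero) simp
        also have "\<dots> \<le> d * L" using mC d(1) by simp
        finally show "dist ((\<integral>y. \<theta> (r j + y) \<partial>\<mu> j) - (\<integral>y. \<theta> (x + y) \<partial>\<mu> j)) 0 < e"
          using d(2) by simp
      qed
    qed
    have "(\<lambda>j. \<integral>y. \<theta> y \<partial>\<mu> j) \<longlonglongrightarrow> (\<integral>y. \<theta> (x + y) \<partial>M)"
      using tendsto_add[OF lim2 lim1] by (simp add: eqj)
    then have "(\<integral>y. \<theta> (x + y) \<partial>M) = (\<integral>y. \<theta> y \<partial>M)"
      using vague_convergesD[OF conv \<theta>] by (rule LIMSEQ_unique)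
    moreover have "(\<integral>y. \<theta> y \<partial>N) = (\<integral>y. \<theta> (x + y) \<partial>M)"
      unfolding N_def by (rule integral_distr[OF tm[OF s(1)] mth])
    ultimately show "(\<integral>y. \<theta> y \<partial>N) = (\<integral>y. \<theta> y \<partial>M)" by simp
  qed
  then have "emeasure M ((\<lambda>y. x + y) ` A) = emeasure N ((\<lambda>y. x + y) ` A)" by simp
  also have "\<dots> = emeasure M ((\<lambda>y. - x + y) ` (\<lambda>y. x + y) ` A)"
    by (rule emN[OF borel_left_translate[OF A]])
  also have "(\<lambda>y. - x + y) ` (\<lambda>y. x + y) ` A = A" by (force simp: image_image add.assoc[symmetric])
  finally show ?thesis .
qed

text \<open>The group is the support \<open>S\<close> of \<open>M\<close>. Each point of
  \<open>S\<close> is a limit of points of the groups \<open>R j\<close> along a subsequence, hence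
  lies in the group \<open>I\<close> of translations preserving \<open>M\<close>, and
  \<open>I\<close> maps the support to itself; a nonempty \<open>S\<close> inside \<open>I\<close>
  is then a subgroup.\<close>

lemma vague_limit_haar:
  assumes conv: "vague_converges \<mu> M" and M: "locally_finite_borel (M :: 'g measure)"
    and R: "\<And>j. is_subgroup (R j)" "\<And>j. closed (R j)" and \<mu>: "\<And>j. haar_measure_on (R j) (\<mu> j)"
    and nz: "emeasure M UNIV \<noteq> 0"
  obtains S where "is_subgroup S" "closed S" "haar_measure_on S M"
proof -
  obtain X :: "nat \<Rightarrow> 'g set" where "compact_open_partition X" by (rule partition_exists)
  then interpret X: compact_open_partition X .
  note lf = haar_measure_onD(1)[OF \<mu>]
  define S where "S = {x :: 'g. \<forall>U. open U \<and> x \<in> U \<longrightarrow> emeasure M U \<noteq> 0}"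
  define I where "I = {x :: 'g. \<forall>A\<in>sets borel. emeasure M ((\<lambda>y. x + y) ` A) = emeasure M A}"
  note sM = locally_finite_borelD(1)[OF M]
  have SI: "x \<in> I" if x: "x \<in> S" for x
  proof -
    obtain U where U0: "(\<forall>k. open (U k)) \<and> (\<forall>k. x \<in> U k) \<and>
    (\<forall>T. open T \<longrightarrow> x \<in> T \<longrightarrow> (\<forall>\<^sub>F k in sequentially. U k \<subseteq> T))"
    by (rule nbhd_sequence[of "x"]) (rule that)
  have U: "open (U k)" "x \<in> U k" "open T \<Longrightarrow> x \<in> T \<Longrightarrow> \<forall>\<^sub>F k in sequentially. U k \<subseteq> T" for k T
    using U0 by auto
    have "\<forall>\<^sub>F j in sequentially. \<exists>r. r \<in> R j \<inter> U k" for k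
    proof -
      have "emeasure M (U k) \<noteq> 0" using x U by (auto simp: S_def)
      from X.vague_open_eventually_pos[OF conv M lf U(1) this]
      show ?thesis
      proof eventually_elim
        fix j assume "emeasure (\<mu> j) (U k) \<noteq> 0"
        moreover have "emeasure (\<mu> j) (U k) \<le> emeasure (\<mu> j) (- R j)" if "R j \<inter> U k = {}"
          using that R(2)[of j] haar_measure_onD(2)[OF \<mu>] by (intro emeasure_mono) auto
        ultimately show "\<exists>r. r \<in> R j \<inter> U k" using haar_measure_onD(3)[OF \<mu>[of j]] by auto
      qed
    qed
    then obtain s where s: "strict_mono s" "\<And>k. \<exists>r. r \<in> R (s k) \<inter> U k"
      using filterlim_strict_mono_choice[of "\<lambda>k j. \<exists>r. r \<in> R j \<inter> U k"] by blast
    then obtain r where r: "\<And>k. r k \<in> R (s k)" "\<And>k. r k \<in> U k" by (metis IntE)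
    have "r \<longlonglongrightarrow> x"
    proof (rule topological_tendstoI)
      fix T assume "open T" "x \<in> T"
      from U(3)[OF this] show "\<forall>\<^sub>F k in sequentially. r k \<in> T"
        by eventually_elim (use r(2) in blast)
    qed
    then show ?thesis
      unfolding I_def using vague_limit_invariant[OF vague_converges_subseq[OF conv s(1)] M, of r x]
        lf haar_measure_onD(5)[OF \<mu> r(1)] by simp
  qed
  have Iadd: "x + y \<in> I" if "x \<in> I" "y \<in> I" for x y
  proof -
    have "(\<lambda>z. x + y + z) ` A = (\<lambda>z. x + z) ` (\<lambda>z. y + z) ` A" for A :: "'g set" by (force simp: add.assoc image_image)
    then show ?thesis using that borel_left_translate[of _ y] unfolding I_def by auto
  qed
  have Imin: "- x \<in> I" if "x \<in> I" for x
    unfolding I_def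
  proof (intro CollectI ballI)
    fix A :: "'g set" assume A: "A \<in> sets borel"
    have "(\<lambda>z. x + z) ` (\<lambda>z. - x + z) ` A = A" by (force simp: image_image)
    moreover have "emeasure M ((\<lambda>z. x + z) ` (\<lambda>z. - x + z) ` A) = emeasure M ((\<lambda>z. - x + z) ` A)"
      using that borel_left_translate[OF A] unfolding I_def by blast
    ultimately show "emeasure M ((\<lambda>z. - x + z) ` A) = emeasure M A" by simp
  qed
  have SIadd: "x + y \<in> S" if "x \<in> I" "y \<in> S" for x y
    unfolding S_def
  proof (intro CollectI allI impI)
    fix U assume U: "open U \<and> x + y \<in> U"
    then have "open ((\<lambda>z. - x + z) ` U)" by (intro open_left_translate) simp
    moreover have "y \<in> (\<lambda>z. - x + z) ` U" using U by (simp add: left_translate_vimage)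
    ultimately have "emeasure M ((\<lambda>z. - x + z) ` U) \<noteq> 0" using that(2) unfolding S_def by blast
    then show "emeasure M U \<noteq> 0" using Imin[OF that(1)] U unfolding I_def by simp
  qed
  \<comment> \<open>Points off \<open>S\<close> have null neighbourhoods. A null open set containing
    all of them cannot meet \<open>S\<close>, so it equals the complement, which is thus open and
    null.\<close>
  obtain B where B: "open B" "- S \<subseteq> B" "emeasure M B = 0"
    using null_on_open_cover[OF sM, of "- S"] unfolding S_def by auto
  then have "B \<subseteq> - S" unfolding S_def by blast
  with B have BS: "B = - S" by blast
  then have cS: "closed S" using B(1) by (simp add: closed_def)
  have M0: "emeasure M (- S) = 0" using B BS by simp
  have MS: "emeasure M S \<noteq> 0"
  proof
    assume "emeasure M S = 0"
    then have "emeasure M (S \<union> - S) \<le> 0 + 0"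
      using M0 emeasure_subadditive[of S M "- S"] sM cS by simp
    then show False using nz by simp
  qed
  then have "S \<noteq> {}" by auto
  then obtain x0 where x0: "x0 \<in> S" by blast
  have "is_subgroup S"
    unfolding is_subgroup_def
  proof (intro conjI ballI)
    show S0: "0 \<in> S" using SIadd[OF Imin[OF SI[OF x0]] x0] by simp
    show "x + y \<in> S" if "x \<in> S" "y \<in> S" for x y using SIadd[OF SI[OF that(1)] that(2)] .
    show "- x \<in> S" if "x \<in> S" for x using SIadd[OF Imin[OF SI[OF that]] S0] by simp
  qed
  moreover have "haar_measure_on S M"
    unfolding haar_measure_on_def using sM M0 MS locally_finite_borelD(3)[OF M] SI by (auto simp: I_def)
  ultimately show thesis using that cS by blast
qed

text \<open>The neighbourhoods \<open>E k\<close> of \<open>S\<close> are invariant under left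
  translation by \<open>S\<close>. Normalisation on \<open>K\<close> bounds the measures on all
  cosets of \<open>K\<close>, so a vague limit exists; being compact and open, \<open>K\<close>
  keeps mass 1, and shrinking the neighbourhoods confines the limit to \<open>S\<close>.\<close>

lemma haar_measure_on_closed_subgroup:
  assumes H: "haar_measure_on UNIV (H :: 'g measure)" and S: "is_subgroup (S :: 'g set)" "closed S"
  obtains \<sigma> where "haar_measure_on S \<sigma>"
proof -
  obtain X :: "nat \<Rightarrow> 'g set" where "compact_open_partition X" by (rule partition_exists)
  then interpret X: compact_open_partition X .
  note sl = haar_measure_onD(2)[OF H]
  obtain W :: "nat \<Rightarrow> 'g set" where W0: "(\<forall>k. open (W k)) \<and> (\<forall>k. 0 \<in> W k) \<and>
    (\<forall>T. open T \<longrightarrow> 0 \<in> T \<longrightarrow> (\<forall>\<^sub>F k in sequentially. W k \<subseteq> T))"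
    by (rule nbhd_sequence[of "0::'g"]) (rule that)
  have W: "open (W k)" "0 \<in> W k" "open T \<Longrightarrow> 0 \<in> T \<Longrightarrow> \<forall>\<^sub>F k in sequentially. W k \<subseteq> T" for k T
    using W0 by auto
  \<comment> \<open>Intersecting with \<open>K\<close> ensures that a left coset of \<open>K\<close>
    meeting \<open>E k\<close> is a translate of \<open>K\<close> by an element of
    \<open>S\<close>.\<close>
  define E where "E k = (\<Union>s\<in>S. (\<lambda>y. s + y) ` (W k \<inter> K))" for k
  have oE: "open (E k)" for k
    unfolding E_def by (intro open_UN ballI open_left_translate open_Int W(1) open_K)
  define c where "c k = emeasure H (E k \<inter> K)" for k
  have c0: "c k \<noteq> 0" for k
  proof -
    have "0 \<in> E k \<inter> K" using W(2)[of k] is_subgroupD(1)[OF S(1)] is_subgroupD(1)[OF subgroup_K]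
      by (auto simp: E_def intro!: bexI[of _ 0])
    then show ?thesis unfolding c_def
      by (intro haar_charges_open[OF is_subgroup_UNIV H]) (use oE open_K in auto)
  qed
  have cfin: "c k \<noteq> \<infinity>" for k
  proof -
    have "c k \<le> emeasure H K" unfolding c_def using open_K sl by (intro emeasure_mono) auto
    then show ?thesis using haar_K(2)[OF is_subgroup_UNIV H] by (auto simp: top_unique)
  qed
  define \<mu> where "\<mu> k = scale_measure (inverse (c k)) (density H (indicator (E k)))" for k
  have em: "emeasure (\<mu> k) A = inverse (c k) * emeasure H (E k \<inter> A)" if "A \<in> sets borel" for k A
  proof -
    have "emeasure (density H (indicator (E k))) A = (\<integral>\<^sup>+x. indicator (E k) x * indicator A x \<partial>H)"
      using that sl oE by (intro emeasure_density) (auto intro!: borel_measurable_indicator)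
    also have "\<dots> = emeasure H (E k \<inter> A)"
      using that sl oE by (simp add: indicator_inter_arith[symmetric])
    finally show ?thesis by (simp add: \<mu>_def)
  qed
  have s\<mu>: "sets (\<mu> k) = sets borel" for k by (simp add: \<mu>_def sl)
  have EK: "emeasure (\<mu> k) K = 1" for k
    using em[of K k] open_K c0[of k] cfin[of k] ennreal_divide_self[of "c k"]
    by (simp add: c_def less_top mult.commute divide_ennreal_def)
  have inv: "emeasure (\<mu> k) ((\<lambda>y. s + y) ` A) = emeasure (\<mu> k) A" if "s \<in> S" "A \<in> sets borel" for s A k
  proof -
    have "E k \<inter> (\<lambda>y. s + y) ` A = (\<lambda>y. s + y) ` (E k \<inter> A)"
    proof -
      have "s + y \<in> E k \<longleftrightarrow> y \<in> E k" for y
      proof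
        assume "y \<in> E k"
        then obtain t v where "t \<in> S" "v \<in> W k \<inter> K" "y = t + v" by (auto simp: E_def)
        then show "s + y \<in> E k" using is_subgroupD(2)[OF S(1) that(1), of t]
          by (auto simp: E_def add.assoc[symmetric] intro!: bexI[of _ "s + t"])
      next
        assume "s + y \<in> E k"
        then obtain t v where tv: "t \<in> S" "v \<in> W k \<inter> K" "s + y = t + v" by (auto simp: E_def)
        then have "y = (- s + t) + v" by (metis add.assoc minus_add_cancel)
        then show "y \<in> E k" using tv is_subgroupD(2)[OF S(1) is_subgroupD(3)[OF S(1) that(1)], of t]
          by (auto simp: E_def intro!: bexI[of _ "- s + t"])
      qed
      then show ?thesis by auto
    qed
    then show ?thesis
      using em[OF that(2)] em[OF borel_left_translate[OF that(2)]] haar_measure_onD(5)[OF H, of s "E k \<inter> A"] oE that(2) by simp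
  qed
  have coset: "emeasure (\<mu> k) ((\<lambda>y. a + y) ` K) \<le> 1" for k a
  proof (cases "E k \<inter> (\<lambda>y. a + y) ` K = {}")
    case True
    then show ?thesis using em[of "(\<lambda>y. a + y) ` K" k] open_left_translate[OF open_K] by simp
  next
    case False
    then obtain z where z: "z \<in> E k" "z \<in> (\<lambda>y. a + y) ` K" by blast
    then obtain s v where "s \<in> S" "v \<in> W k \<inter> K" "z = s + v" unfolding E_def by blast
    with z(2) have sv: "s \<in> S" "v \<in> W k \<inter> K" "s + v \<in> (\<lambda>y. a + y) ` K" by simp_all
    have "(\<lambda>y. a + y) ` K = (\<lambda>y. (s + v) + y) ` K" using translate_subgroup[OF subgroup_K sv(3)] by simp
    also have "\<dots> = (\<lambda>y. s + y) ` (\<lambda>y. v + y) ` K" by (force simp: add.assoc image_image)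
    also have "(\<lambda>y. v + y) ` K = K"
      using translate_subgroup[OF subgroup_K, of v 0] sv(2) by simp
    finally show ?thesis using inv[OF sv(1), of K k] EK open_K by simp
  qed
  have "\<exists>b. \<forall>k. emeasure (\<mu> k) C \<le> ennreal b" if C: "compact C" for C
  proof -
    have "C \<subseteq> (\<Union>a\<in>C. (\<lambda>y. a + y) ` K)"
    proof
      fix x assume "x \<in> C"
      then show "x \<in> (\<Union>a\<in>C. (\<lambda>y. a + y) ` K)" by (rule UN_I) (rule mem_left_coset[OF subgroup_K])
    qed
    from compactE_image[OF C open_left_translate[OF open_K] this]
    obtain F where F: "finite F" "C \<subseteq> (\<Union>a\<in>F. (\<lambda>y. a + y) ` K)" by metis
    have "emeasure (\<mu> k) C \<le> ennreal (card F)" for k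
    proof -
      have "emeasure (\<mu> k) C \<le> emeasure (\<mu> k) (\<Union>a\<in>F. (\<lambda>y. a + y) ` K)"
        using open_left_translate[OF open_K] s\<mu> F by (intro emeasure_mono) auto
      also have "\<dots> \<le> (\<Sum>a\<in>F. emeasure (\<mu> k) ((\<lambda>y. a + y) ` K))"
        using open_left_translate[OF open_K] s\<mu> F by (intro emeasure_subadditive_finite) auto
      also have "\<dots> \<le> (\<Sum>a\<in>F. 1)" by (rule sum_mono) (rule coset)
      finally show ?thesis by (simp add: ennreal_of_nat_eq_real_of_nat)
    qed
    then show ?thesis by blast
  qed
  then have bX: "\<exists>b. \<forall>k. emeasure (\<mu> k) (X n) \<le> ennreal b" for n using X.compact_X by blast
  then obtain b where b: "\<And>k n. emeasure (\<mu> k) (X n) \<le> ennreal (b n)" by metis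
  obtain r M where r: "strict_mono r" and M: "sets M = sets borel" "\<And>C. compact C \<Longrightarrow> emeasure M C < \<infinity>"
    and conv: "vague_converges (\<mu> \<circ> r) M"
    using X.vague_seq_compact[of \<mu> b, OF s\<mu> b] by blast
  have lfM: "locally_finite_borel M" using M by (simp add: locally_finite_borel_def)
  have lf\<mu>: "locally_finite_borel ((\<mu> \<circ> r) k)" for k
    unfolding locally_finite_borel_def
  proof (intro conjI allI impI)
    fix C :: "'g set" assume "compact C"
    moreover have "emeasure (\<mu> j) (X n) < \<infinity>" for n j
      using le_less_trans[OF b ennreal_less_top] by simp
    ultimately show "emeasure ((\<mu> \<circ> r) k) C < \<infinity>" using X.finite_on_compact[of "\<mu> (r k)"] s\<mu> by simp
  qed (simp add: s\<mu>)
  have MK: "emeasure M K = 1"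
  proof -
    have "measure (\<mu> k) K = 1" for k using EK[of k] by (simp add: measure_def)
    then have "measure M K = 1"
      using vague_converges_compact_open[OF conv open_K compact_K lfM lf\<mu>] by (simp add: LIMSEQ_const_iff)
    then show ?thesis using integral_test_indicator(2)[OF open_K compact_K lfM] by simp
  qed
  have "haar_measure_on S M"
    unfolding haar_measure_on_def
  proof (intro conjI allI impI ballI)
    have "\<exists>U. open U \<and> x \<in> U \<and> emeasure M U = 0" if x: "x \<in> - S" for x
    proof -
      \<comment> \<open>If the differences from \<open>U\<close> and \<open>V\<close> avoid
        \<open>S\<close> and \<open>W k\<close> lies in \<open>V\<close>, then \<open>E k\<close>
        avoids \<open>U\<close>, because a point \<open>s + v\<close> of \<open>U\<close> would give
        \<open>(s + v) - v = s\<close>.\<close>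
      have "open ((\<lambda>p. fst p - snd p) -` (- S))"
        using S(2) by (intro open_vimage continuous_on_diff continuous_on_fst continuous_on_snd continuous_on_id) auto
      moreover have "(x, 0) \<in> (\<lambda>p. fst p - snd p) -` (- S)" using x by simp
      ultimately obtain U V where UV: "open U" "open V" "x \<in> U" "0 \<in> V" "U \<times> V \<subseteq> (\<lambda>p. fst p - snd p) -` (- S)"
        using open_prod_elim[of "(\<lambda>p. fst p - snd p) -` (- S)" "(x, 0)"] mem_Sigma_iff by metis
      have "\<forall>\<^sub>F k in sequentially. W k \<subseteq> V" using W(3) UV by blast
      then obtain k0 where k0: "\<And>k. k \<ge> k0 \<Longrightarrow> W k \<subseteq> V" unfolding eventually_sequentially by blast
      have "\<forall>\<^sub>F k in sequentially. emeasure ((\<mu> \<circ> r) k) U \<le> 0"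
        unfolding eventually_sequentially
      proof (intro exI[of _ k0] allI impI)
        fix k assume "k0 \<le> k"
        then have k: "W (r k) \<subseteq> V" using k0 seq_suble[OF r, of k] by simp
        have "E (r k) \<inter> U = {}"
        proof (rule ccontr)
          assume "E (r k) \<inter> U \<noteq> {}"
          then obtain z where z: "z \<in> E (r k)" "z \<in> U" by blast
          then obtain s v where "s \<in> S" "v \<in> W (r k)" "z = s + v" unfolding E_def by blast
          with z(2) have sv: "s \<in> S" "v \<in> W (r k)" "s + v \<in> U" by simp_all
          then have "(s + v, v) \<in> (\<lambda>p. fst p - snd p) -` (- S)" using UV(5) k by blast
          then show False using sv(1) by simp
        qed
        then show "emeasure ((\<mu> \<circ> r) k) U \<le> 0" using em[of U "r k"] UV(1) by simp
      qed
      then have "emeasure M U \<le> 0" by (rule X.vague_open_le[OF conv lfM lf\<mu> UV(1)])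
      then show ?thesis using UV by auto
    qed
    from null_on_open_cover[OF M(1) this] obtain B where B: "open B" "- S \<subseteq> B" "emeasure M B = 0" by blast
    have "emeasure M (- S) \<le> emeasure M B" using B M(1) by (intro emeasure_mono) auto
    then show 0: "emeasure M (- S) = 0" using B by simp
    show "emeasure M S \<noteq> 0"
    proof
      assume "emeasure M S = 0"
      then have "emeasure M (S \<union> - S) \<le> 0 + 0"
        using 0 emeasure_subadditive[of S M "- S"] M(1) S(2) by simp
      moreover have "emeasure M K \<le> emeasure M (S \<union> - S)" using M(1) by (intro emeasure_mono) auto
      ultimately show False using MK by simp
    qed
    show "emeasure M ((\<lambda>x. s + x) ` A) = emeasure M A" if "s \<in> S" "A \<in> sets borel" for s A
      using vague_limit_invariant[OF conv lfM lf\<mu> tendsto_const[of s] _ that(2)] inv[OF that(1)] by simp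
  qed (use M in auto)
  then show thesis by (rule that)
qed

end

section \<open>Relations with proper open projection\<close>

definition cosub :: "'g::{group_add,topological_space} set \<Rightarrow> bool" where
  "cosub U \<longleftrightarrow> is_subgroup U \<and> open U \<and> compact U"

lemma cosub_compact_open_subgroup:
  "cosub (U :: 'g::{topological_group_add,second_countable_topology,t2_space} set) \<Longrightarrow> compact_open_subgroup U"
  by (simp add: cosub_def compact_open_subgroup_def)

lemma cosub_Times: "cosub U \<Longrightarrow> cosub V \<Longrightarrow> cosub (U \<times> V)"
  by (simp add: cosub_def is_subgroup_Times open_Times compact_Times)

lemma is_subgroup_relations:
  assumes "is_subgroup R"
  shows "is_subgroup (Domain R)" "is_subgroup (Range R)" "is_subgroup (R\<inverse>)"
    "is_subgroup (indef_rel R)" "is_subgroup (ker_rel R)"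
proof -
  have 0: "(0, 0) \<in> R" and a: "(x, y) \<in> R \<Longrightarrow> (x', y') \<in> R \<Longrightarrow> (x + x', y + y') \<in> R"
    and m: "(x, y) \<in> R \<Longrightarrow> (- x, - y) \<in> R" for x y x' y'
    using is_subgroupD(1,2,3)[OF assms] by (force simp: zero_prod_def)+
  show "is_subgroup (Domain R)" "is_subgroup (Range R)"
    unfolding is_subgroup_def using 0 a m by blast+
  show "is_subgroup (R\<inverse>)"
    unfolding is_subgroup_def using 0 a m by (auto simp: zero_prod_def)
  show "is_subgroup (indef_rel R)" "is_subgroup (ker_rel R)"
    unfolding is_subgroup_def indef_rel_def ker_rel_def
    using 0 a[of 0 _ 0] a[of _ 0 _ 0] m[of 0] m[of _ 0] by auto
qed

lemma is_subgroup_relcomp: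
  assumes "is_subgroup R" "is_subgroup T" shows "is_subgroup (R O T)"
proof -
  have "(0, 0) \<in> R" "(0, 0) \<in> T" using is_subgroupD(1)[OF assms(1)] is_subgroupD(1)[OF assms(2)] by (simp_all add: zero_prod_def)
  moreover have "(x + x', z + z') \<in> R O T" if "(x, y) \<in> R" "(y, z) \<in> T" "(x', y') \<in> R" "(y', z') \<in> T" for x y z x' y' z'
    using is_subgroupD(2)[OF assms(1) that(1,3)] is_subgroupD(2)[OF assms(2) that(2,4)] by auto
  moreover have "(- x, - z) \<in> R O T" if "(x, y) \<in> R" "(y, z) \<in> T" for x y z
    using is_subgroupD(3)[OF assms(1) that(1)] is_subgroupD(3)[OF assms(2) that(2)] by auto
  ultimately show ?thesis unfolding is_subgroup_def by (auto simp: zero_prod_def)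
qed

lemma converse_rels [simp]: "indef_rel (R\<inverse>) = ker_rel R" "ker_rel (R\<inverse>) = indef_rel R"
  by (auto simp: indef_rel_def ker_rel_def)

lemma left_translate_eq_or_disjoint:
  assumes "is_subgroup K"
  shows "(\<lambda>x. a + x) ` K = (\<lambda>x. b + x) ` K \<or> (\<lambda>x. a + x) ` K \<inter> (\<lambda>x. b + x) ` K = {}"
  using translate_subgroup[OF assms] by blast

text \<open>By the Archimedean property, enough disjoint sets of equal positive measure exceed any
  finite mass. Families of cosets are shown finite in this way.\<close>

lemma finite_disjoint_equal_measure:
  assumes F: "disjoint F" "\<And>E. E \<in> F \<Longrightarrow> E \<in> sets M \<and> emeasure M E = c" and "c \<noteq> 0"
    and B: "\<Union>F \<subseteq> B" "B \<in> sets M" "emeasure M B < \<infinity>"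
  shows "finite F"
proof (rule ccontr)
  assume inf: "infinite F"
  have le: "of_nat n * c \<le> emeasure M B" for n
  proof -
    obtain G where G: "G \<subseteq> F" "finite G" "card G = n"
      using infinite_arbitrarily_large[OF inf] by blast
    have "of_nat n * c = (\<Sum>E\<in>G. emeasure M E)" using G F(2) by (simp add: subset_iff)
    also have "\<dots> = emeasure M (\<Union>G)"
      using sum_emeasure[of "\<lambda>E. E" G M] G F by (simp add: disjoint_family_on_def disjoint_def subset_iff)
    also have "\<dots> \<le> emeasure M B" using G B by (intro emeasure_mono) auto
    finally show ?thesis .
  qed
  have "c < \<infinity>" using le[of 1] B(3) by simp
  then obtain r where r: "c = ennreal r" "0 < r"
    using \<open>c \<noteq> 0\<close> by (cases c rule: ennreal_cases) auto
  obtain b where b: "emeasure M B = ennreal b" "0 \<le> b"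
    using B(3) by (cases "emeasure M B" rule: ennreal_cases) auto
  obtain n :: nat where n: "b < real n * r" using reals_Archimedean3[OF r(2)] by blast
  have "ennreal (real n * r) \<le> ennreal b"
    using le[of n] r b by (simp add: ennreal_of_nat_eq_real_of_nat ennreal_mult)
  then show False using n b by simp
qed

text \<open>A closed subgroup carries a nonzero polyhomomorphism, up to scaling of the measure, when it and its
  converse have this property.\<close>

definition proper_open_rel :: "('a::{group_add,topological_space} \<times> 'b::{group_add,topological_space}) set \<Rightarrow> bool" where
  "proper_open_rel R \<longleftrightarrow> is_subgroup R \<and> (\<forall>A. compact A \<longrightarrow> compact (R \<inter> (A \<times> UNIV))) \<and>
    (\<forall>U V. cosub U \<longrightarrow> cosub V \<longrightarrow> open (Domain (R \<inter> (U \<times> V))))"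

lemma proper_open_relD:
  assumes "proper_open_rel R"
  shows "is_subgroup R" "compact A \<Longrightarrow> compact (R \<inter> (A \<times> UNIV))"
    "cosub U \<Longrightarrow> cosub V \<Longrightarrow> open (Domain (R \<inter> (U \<times> V)))"
  using assms by (auto simp: proper_open_rel_def)

lemma Domain_fst_image: "Domain R = fst ` R" and Range_snd_image: "Range R = snd ` R"
  by force+

lemma compact_Domain: "compact R \<Longrightarrow> compact (Domain R)"
  and compact_Range: "compact R \<Longrightarrow> compact (Range R)"
  unfolding Domain_fst_image Range_snd_image
  by (intro compact_continuous_image continuous_on_fst continuous_on_snd continuous_on_id; assumption)+

lemma proper_open_rel_compact_Image:
  assumes "proper_open_rel R" "compact A" shows "compact (R `` A)"
proof -
  have "R `` A = Range (R \<inter> (A \<times> UNIV))" by auto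
  then show ?thesis using compact_Range[OF proper_open_relD(2)[OF assms]] by simp
qed

lemma compact_indef_rel:
  assumes "proper_open_rel R" shows "compact (indef_rel R)"
proof -
  have "indef_rel R = R `` {0}" by (auto simp: indef_rel_def)
  then show ?thesis using proper_open_rel_compact_Image[OF assms, of "{0}"] by simp
qed

text \<open>The swap turns results about the domain, \<alpha> and \<open>indef_rel\<close> into
  results about the range, \<beta> and \<open>ker_rel\<close>.\<close>

lemma haar_measure_on_converse:
  fixes \<rho> :: "('a::{topological_group_add,second_countable_topology,t2_space} \<times> 'b::{topological_group_add,second_countable_topology,t2_space}) measure"
  assumes \<rho>: "haar_measure_on R \<rho>"
  shows "haar_measure_on (R\<inverse>) (distr \<rho> borel prod.swap)"
    "A \<in> sets borel \<Longrightarrow> emeasure (distr \<rho> borel prod.swap) A = emeasure \<rho> (prod.swap -` A)"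
proof -
  note s = haar_measure_onD(2)[OF \<rho>]
  have sp: "space \<rho> = UNIV" using sets_eq_imp_space_eq[OF s] by simp
  have cont: "continuous_on UNIV (prod.swap :: 'x::topological_space \<times> 'y::topological_space \<Rightarrow> _)"
    unfolding prod.swap_def[abs_def] by (intro continuous_on_Pair continuous_on_fst continuous_on_snd continuous_on_id)
  have m: "prod.swap \<in> \<rho> \<rightarrow>\<^sub>M borel"
    using borel_measurable_continuous_onI[OF cont] s by (simp cong: measurable_cong_sets)
  have em: "emeasure (distr \<rho> borel prod.swap) A = emeasure \<rho> (prod.swap -` A)" if "A \<in> sets borel" for A
    using emeasure_distr[OF m that] sp by simp
  show "A \<in> sets borel \<Longrightarrow> emeasure (distr \<rho> borel prod.swap) A = emeasure \<rho> (prod.swap -` A)" by (rule em)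
  have swapR: "prod.swap -` (R\<inverse>) = R" for R :: "('a \<times> 'b) set" by auto
  have bor: "prod.swap -` A \<in> sets borel" if "A \<in> sets borel" for A :: "('b \<times> 'a) set"
    using measurable_sets[OF m that] sp s by simp
  \<comment> \<open>\<open>emeasure\<close> is 0 outside the sigma-algebra, so a nonzero value at
    \<open>R\<close> already forces \<open>R\<close> to be Borel.\<close>
  have R: "R \<in> sets borel" "- R \<in> sets borel"
  proof -
    show "R \<in> sets borel" using haar_measure_onD(4)[OF \<rho>] s emeasure_notin_sets by blast
    then show "- R \<in> sets borel" by (simp add: borel_comp)
  qed
  have "prod.swap \<in> borel \<rightarrow>\<^sub>M (borel :: ('a \<times> 'b) measure)"
    by (rule borel_measurable_continuous_onI[OF cont])
  from measurable_sets[OF this R(1)] have Rc: "R\<inverse> \<in> sets borel"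
    by (simp add: converse_def vimage_def prod.swap_def case_prod_unfold)
  show "haar_measure_on (R\<inverse>) (distr \<rho> borel prod.swap)"
    unfolding haar_measure_on_def
  proof (intro conjI allI impI ballI)
    show "emeasure (distr \<rho> borel prod.swap) (- (R\<inverse>)) = 0"
      using em[of "- (R\<inverse>)"] Rc haar_measure_onD(3)[OF \<rho>] by (simp add: borel_comp vimage_Compl swapR)
    show "emeasure (distr \<rho> borel prod.swap) (R\<inverse>) \<noteq> 0"
      using em[OF Rc] haar_measure_onD(4)[OF \<rho>] by (simp add: swapR)
    show "emeasure (distr \<rho> borel prod.swap) C < \<infinity>" if C: "compact C" for C
    proof -
      have "prod.swap -` C = prod.swap ` C" by force
      then have "compact (prod.swap -` C)"
        using C compact_continuous_image[OF continuous_on_subset[OF cont]] by (metis subset_UNIV)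
      then show ?thesis
        using em[OF borel_compact[OF C]] locally_finite_borelD(3)[OF haar_measure_onD(1)[OF \<rho>]] by simp
    qed
    fix r A assume r: "r \<in> R\<inverse>" and A: "A \<in> sets (borel :: ('b \<times> 'a) measure)"
    have "prod.swap -` ((\<lambda>x. r + x) ` A) = (\<lambda>x. prod.swap r + x) ` (prod.swap -` A)"
      unfolding left_translate_vimage by (auto simp: plus_prod_def uminus_prod_def)
    then show "emeasure (distr \<rho> borel prod.swap) ((\<lambda>x. r + x) ` A) = emeasure (distr \<rho> borel prod.swap) A"
      using em[OF A] em[OF borel_left_translate[OF A]] haar_measure_onD(5)[OF \<rho>, of "prod.swap r", OF _ bor[OF A]] r by auto
  qed simp
qed

locale haar_setting =
  fixes \<gamma> :: "'a::{topological_group_add,second_countable_topology,t2_space} measure"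
    and K0 :: "'a set"
  assumes K0: "cosub K0" and \<gamma>: "unimodular_haar \<gamma>"
begin

sublocale K: compact_open_subgroup K0
  using K0 by (rule cosub_compact_open_subgroup)

sublocale KK: compact_open_subgroup "K0 \<times> K0"
  by (intro cosub_compact_open_subgroup cosub_Times K0)

lemma haar_\<gamma>: "haar_measure_on UNIV \<gamma>"
  using \<gamma> by (simp add: unimodular_haar_def)

lemma sets_\<gamma> [simp]: "sets \<gamma> = sets borel" and \<gamma>_compact: "compact C \<Longrightarrow> emeasure \<gamma> C < \<infinity>"
  using haar_measure_onD(2)[OF haar_\<gamma>] locally_finite_borelD(3)[OF haar_measure_onD(1)[OF haar_\<gamma>]] by auto

lemma \<gamma>_left: "A \<in> sets borel \<Longrightarrow> emeasure \<gamma> ((\<lambda>x. r + x) ` A) = emeasure \<gamma> A"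
  and \<gamma>_right: "A \<in> sets borel \<Longrightarrow> emeasure \<gamma> ((\<lambda>x. x + r) ` A) = emeasure \<gamma> A"
  using \<gamma> by (auto simp: unimodular_haar_def haar_measure_on_def)

lemma \<gamma>_open: "open U \<Longrightarrow> U \<noteq> {} \<Longrightarrow> emeasure \<gamma> U \<noteq> 0"
  using haar_charges_open[OF is_subgroup_UNIV haar_\<gamma>] by simp

text \<open>The product \<open>C\<close> of \<open>K0\<close> and \<open>P\<close> is open, as a
  union of translates of \<open>K0\<close>, and compact, hence of finite measure. So it is a finite
  disjoint union of left cosets of \<open>P\<close>, and removing the other closed cosets leaves
  \<open>P\<close> open.\<close>

lemma compact_subgroup_open:
  assumes P: "is_subgroup P" "compact P" "emeasure \<gamma> P \<noteq> 0" shows "open P"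
proof -
  define C where "C = {x + y | x y. x \<in> K0 \<and> y \<in> P}"
  have C: "compact C" unfolding C_def by (rule compact_set_plus[OF K.compact_K P(2)])
  define F where "F = (\<lambda>x. (\<lambda>y. x + y) ` P) ` K0"
  have UF: "\<Union>F = C" unfolding F_def C_def by blast
  have bP: "P \<in> sets borel" using P(2) by (rule borel_compact)
  have "finite F"
  proof (rule finite_disjoint_equal_measure[where M=\<gamma> and B=C and c="emeasure \<gamma> P"])
    show "disjoint F"
      unfolding disjoint_def F_def using left_translate_eq_or_disjoint[OF P(1)] by blast
    show "E \<in> sets \<gamma> \<and> emeasure \<gamma> E = emeasure \<gamma> P" if "E \<in> F" for E
      using that bP \<gamma>_left borel_left_translate by (auto simp: F_def)
  qed (use UF C P \<gamma>_compact borel_compact in auto)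
  have PF: "P \<in> F" unfolding F_def using is_subgroupD(1)[OF K.subgroup_K] by (intro image_eqI[of _ _ 0]) auto
  have "closed (\<Union>(F - {P}))"
  proof (rule closed_Union)
    show "\<forall>E\<in>F - {P}. closed E"
      using compact_left_translate[OF P(2)] compact_imp_closed by (auto simp: F_def)
  qed (use \<open>finite F\<close> in simp)
  moreover have "open C"
  proof -
    have "C = (\<Union>y\<in>P. (\<lambda>x. x + y) ` K0)" unfolding C_def by blast
    then show ?thesis using open_right_translate[OF K.open_K] by auto
  qed
  moreover have "P = C - \<Union>(F - {P})"
  proof -
    have "P \<inter> E = {}" if "E \<in> F - {P}" for E
    proof -
      have "E \<noteq> (\<lambda>x. 0 + x) ` P" using that by simp
      then show ?thesis using that left_translate_eq_or_disjoint[OF P(1), of _ 0] by (auto simp: F_def)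
    qed
    then show ?thesis using PF UF by blast
  qed
  ultimately show ?thesis by (metis open_Diff)
qed

text \<open>Translates of \<open>K0 \<times> K0\<close> by elements of \<open>R\<close> over a
  compact set are disjoint or equal and have equal positive mass, while domination bounds the total;
  so finitely many cover. For openness, \<open>P\<close> is a compact subgroup whose
  \<gamma>-measure is at least the \<rho>-measure of \<open>U \<times> V\<close>, which is
  positive.\<close>

lemma proper_open_rel_if_dominated:
  fixes R :: "('a \<times> 'a) set"
  assumes R: "is_subgroup R" "closed R" "haar_measure_on R \<rho>"
    and dom: "\<And>A. compact A \<Longrightarrow> emeasure \<rho> (A \<times> UNIV) \<le> emeasure \<gamma> A"
  shows "proper_open_rel R"
  unfolding proper_open_rel_def
proof (intro conjI allI impI)
  note s = haar_measure_onD(2)[OF R(3)]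
  fix A :: "'a set" assume A: "compact A"
  have "A \<subseteq> (\<Union>a\<in>A. (\<lambda>y. a + y) ` K0)"
  proof
    fix x assume "x \<in> A"
    then show "x \<in> (\<Union>a\<in>A. (\<lambda>y. a + y) ` K0)" by (rule UN_I) (rule mem_left_coset[OF K.subgroup_K])
  qed
  from compactE_image[OF A open_left_translate[OF K.open_K] this]
  obtain I where I: "finite I" "A \<subseteq> (\<Union>a\<in>I. (\<lambda>y. a + y) ` K0)" by metis
  \<comment> \<open>Enlarging \<open>A\<close> to whole cosets of \<open>K0\<close> keeps the
    translates of \<open>K0 \<times> K0\<close> over \<open>C\<close>.\<close>
  define C where "C = (\<Union>a\<in>I. (\<lambda>y. a + y) ` K0)"
  have C: "compact C" unfolding C_def using I(1) compact_left_translate[OF K.compact_K] by blast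
  have CK: "(\<lambda>y. g + y) ` K0 \<subseteq> C" if "g \<in> C" for g
    using that translate_subgroup[OF K.subgroup_K] unfolding C_def by blast
  define F where "F = (\<lambda>r. (\<lambda>y. r + y) ` (K0 \<times> K0)) ` (R \<inter> (C \<times> UNIV))"
  have prodc: "(\<lambda>y. r + y) ` (K0 \<times> K0) = ((\<lambda>y. fst r + y) ` K0) \<times> ((\<lambda>y. snd r + y) ` K0)" for r :: "'a \<times> 'a"
    by (force simp: plus_prod_def)
  have bKK: "K0 \<times> K0 \<in> sets borel" using KK.open_K by simp
  have "finite F"
  proof (rule finite_disjoint_equal_measure[where M=\<rho> and B="C \<times> UNIV" and c="emeasure \<rho> (K0 \<times> K0)"])
    show "disjoint F"
      unfolding disjoint_def F_def using left_translate_eq_or_disjoint[OF KK.subgroup_K] by blast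
    show "E \<in> sets \<rho> \<and> emeasure \<rho> E = emeasure \<rho> (K0 \<times> K0)" if "E \<in> F" for E
      using that bKK haar_measure_onD(5)[OF R(3)] borel_left_translate s unfolding F_def by auto
    show "\<Union>F \<subseteq> C \<times> UNIV"
    proof
      fix z assume "z \<in> \<Union>F"
      then obtain r where "r \<in> R \<inter> (C \<times> UNIV)" "z \<in> (\<lambda>y. r + y) ` (K0 \<times> K0)" unfolding F_def by blast
      then show "z \<in> C \<times> UNIV" using CK[of "fst r"] unfolding prodc by (auto simp: mem_Times_iff)
    qed
    show "C \<times> UNIV \<in> sets \<rho>" using s borel_closed[OF closed_Times[OF compact_imp_closed[OF C] closed_UNIV]] by simp
    show "emeasure \<rho> (C \<times> UNIV) < \<infinity>" using le_less_trans[OF dom[OF C] \<gamma>_compact[OF C]] .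
    show "emeasure \<rho> (K0 \<times> K0) \<noteq> 0" using KK.haar_K(1)[OF R(1,3)] .
  qed
  then have "compact (\<Union>F)"
    using compact_left_translate[OF KK.compact_K] by (intro compact_Union) (auto simp: F_def)
  moreover have "R \<inter> (A \<times> UNIV) \<subseteq> \<Union>F"
    using I(2) mem_left_coset[OF KK.subgroup_K] by (fastforce simp: F_def C_def)
  moreover have "closed (R \<inter> (A \<times> UNIV))"
    by (intro closed_Int R closed_Times compact_imp_closed[OF A] closed_UNIV)
  ultimately show "compact (R \<inter> (A \<times> UNIV))" using compact_closed_subset by blast
next
  note s = haar_measure_onD(2)[OF R(3)]
  fix U V :: "'a set" assume U: "cosub U" and V: "cosub V"
  define P where "P = Domain (R \<inter> (U \<times> V))"
  have UV: "is_subgroup (U \<times> V)" "open (U \<times> V)" "compact (U \<times> V)" using cosub_Times[OF U V] by (auto simp: cosub_def)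
  have cP: "compact P" unfolding P_def
    using compact_Int_closed[OF UV(3) R(2)] by (intro compact_Domain) (simp add: Int_commute)
  have "0 \<in> (U \<times> V) \<inter> R" using is_subgroupD(1)[OF R(1)] is_subgroupD(1)[OF UV(1)] by (rule IntI[rotated])
  then have "(U \<times> V) \<inter> R \<noteq> {}" by (metis empty_iff)
  then have "emeasure \<rho> (U \<times> V) \<noteq> 0" by (rule haar_charges_open[OF R(1,3) UV(2)])
  moreover have "emeasure \<rho> (U \<times> V) \<le> emeasure \<rho> (P \<times> UNIV)"
  proof (rule emeasure_mono_AE)
    show "AE x in \<rho>. x \<in> U \<times> V \<longrightarrow> x \<in> P \<times> UNIV"
      by (rule AE_I[of _ _ "- R"]) (use haar_measure_onD(3)[OF R(3)] s R(2) in \<open>auto simp: P_def\<close>)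
    show "P \<times> UNIV \<in> sets \<rho>" using s borel_closed[OF closed_Times[OF compact_imp_closed[OF cP] closed_UNIV]] by simp
  qed
  ultimately have "emeasure \<gamma> P \<noteq> 0" using dom[OF cP] by (metis le_zero_eq order_trans)
  moreover have "is_subgroup P"
    unfolding P_def by (intro is_subgroup_relations is_subgroup_Int R UV)
  ultimately show "open (Domain (R \<inter> (U \<times> V)))" using compact_subgroup_open cP unfolding P_def by blast
qed (rule R)

lemma proper_open_rel_closed:
  assumes "proper_open_rel (R :: ('a \<times> 'a) set)" shows "closed R"
proof -
  have "\<exists>T. open T \<and> x \<in> T \<and> T \<subseteq> - R" if x: "x \<in> - R" for x
  proof -
    define A where "A = (\<lambda>y. fst x + y) ` K0"
    have A: "open A" "compact A" "fst x \<in> A"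
      unfolding A_def using open_left_translate[OF K.open_K] compact_left_translate[OF K.compact_K] mem_left_coset[OF K.subgroup_K] by auto
    have "open (A \<times> UNIV - R \<inter> (A \<times> UNIV))"
      by (intro open_Diff open_Times A open_UNIV compact_imp_closed proper_open_relD(2)[OF assms])
    then show ?thesis using x A by (intro exI[of _ "A \<times> UNIV - R \<inter> (A \<times> UNIV)"]) (auto simp: mem_Times_iff)
  qed
  then show ?thesis unfolding closed_def open_subopen[of "- R"] by blast
qed

lemma open_Domain:
  assumes "proper_open_rel (R :: ('a \<times> 'a) set)" shows "open (Domain R)"
proof (rule subgroup_openI)
  show "is_subgroup (Domain R)" using proper_open_relD(1)[OF assms] by (rule is_subgroup_relations)
  show "open (Domain (R \<inter> (K0 \<times> K0)))" using proper_open_relD(3)[OF assms K0 K0] .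
  show "Domain (R \<inter> (K0 \<times> K0)) \<noteq> {}"
    using is_subgroupD(1)[OF proper_open_relD(1)[OF assms]] is_subgroupD(1)[OF KK.subgroup_K]
    unfolding zero_prod_def by blast
qed blast

lemma cosub_Domain:
  assumes "proper_open_rel (R :: ('a \<times> 'a) set)" "cosub U" "cosub V"
  shows "cosub (Domain (R \<inter> (U \<times> V)))"
proof -
  have "compact (R \<inter> (U \<times> V))"
    using cosub_Times[OF assms(2,3)] compact_Int_closed[of "U \<times> V" R] proper_open_rel_closed[OF assms(1)]
    by (simp add: cosub_def Int_commute)
  then show ?thesis
    using assms cosub_Times[OF assms(2,3)] proper_open_relD[OF assms(1)]
    by (auto simp: cosub_def intro!: compact_Domain is_subgroup_relations is_subgroup_Int)
qed

text \<open>Properness: the part of \<open>R O T\<close> over \<open>A\<close> is the image of a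
  compact fibre product over the middle group. Openness: the domain contains
  \<open>Domain (R \<inter> (U \<times> W))\<close>, where \<open>W\<close> is the compact open
  group of points of \<open>K0\<close> that \<open>T\<close> relates to a point of
  \<open>V\<close>.\<close>

lemma proper_open_rel_relcomp:
  fixes R T :: "('a \<times> 'a) set"
  assumes R: "proper_open_rel R" and T: "proper_open_rel T"
  shows "proper_open_rel (R O T)"
  unfolding proper_open_rel_def
proof (intro conjI allI impI)
  show sg: "is_subgroup (R O T)" using R T by (intro is_subgroup_relcomp proper_open_relD)
  fix A :: "'a set" assume A: "compact A"
  define P where "P = R \<inter> (A \<times> UNIV)"
  have P: "compact P" unfolding P_def by (rule proper_open_relD(2)[OF R A])
  define Q where "Q = T \<inter> (Range P \<times> UNIV)"
  have Q: "compact Q" unfolding Q_def by (rule proper_open_relD(2)[OF T compact_Range[OF P]])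
  define Z where "Z = (P \<times> Q) \<inter> {z. snd (fst z) = fst (snd z)}"
  have "closed {z :: ('a \<times> 'a) \<times> 'a \<times> 'a. snd (fst z) = fst (snd z)}"
    by (intro closed_Collect_eq continuous_on_fst continuous_on_snd continuous_on_id)
  then have "compact Z" unfolding Z_def by (intro compact_Int_closed compact_Times P Q)
  moreover have "continuous_on Z (\<lambda>z. (fst (fst z), snd (snd z)))"
    by (intro continuous_on_Pair continuous_on_fst continuous_on_snd continuous_on_id)
  ultimately have "compact ((\<lambda>z. (fst (fst z), snd (snd z))) ` Z)" by (intro compact_continuous_image)
  also have "(\<lambda>z. (fst (fst z), snd (snd z))) ` Z = (R O T) \<inter> (A \<times> UNIV)"
    unfolding Z_def P_def Q_def by force
  finally show "compact ((R O T) \<inter> (A \<times> UNIV))" .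
next
  fix U V :: "'a set" assume U: "cosub U" and V: "cosub V"
  define W where "W = Domain (T \<inter> (K0 \<times> V))"
  have W: "cosub W" unfolding W_def by (rule cosub_Domain[OF T K0 V])
  show "open (Domain ((R O T) \<inter> (U \<times> V)))"
  proof (rule subgroup_openI)
    show "is_subgroup (Domain ((R O T) \<inter> (U \<times> V)))"
      using U V R T by (intro is_subgroup_relations is_subgroup_Int is_subgroup_relcomp proper_open_relD(1) is_subgroup_Times)
        (auto simp: cosub_def)
    show "open (Domain (R \<inter> (U \<times> W)))" by (rule proper_open_relD(3)[OF R U W])
    have "0 \<in> R \<inter> (U \<times> W)"
      using is_subgroupD(1)[OF proper_open_relD(1)[OF R]] U W by (simp add: cosub_def is_subgroupD(1) zero_prod_def)
    then have "(0, 0) \<in> R \<inter> (U \<times> W)" by (simp add: zero_prod_def)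
    then show "Domain (R \<inter> (U \<times> W)) \<noteq> {}" by blast
    show "Domain (R \<inter> (U \<times> W)) \<subseteq> Domain ((R O T) \<inter> (U \<times> V))" unfolding W_def by blast
  qed
qed

text \<open>Properness makes the image of \<rho> finite on compact sets, so it is a Haar measure on
  the open subgroup \<open>Domain R\<close>. The restriction of \<gamma> is another one, and
  uniqueness gives the factor.\<close>

lemma Domain_haar:
  assumes R: "proper_open_rel (R :: ('a \<times> 'a) set)" "haar_measure_on R \<rho>"
  shows "\<exists>a>0. \<forall>A\<in>sets borel. emeasure \<rho> (A \<times> UNIV) = ennreal a * emeasure \<gamma> (A \<inter> Domain R)"
proof -
  note s = haar_measure_onD(2)[OF R(2)]
  note sub = proper_open_relD(1)[OF R(1)]
  have cR: "closed R" by (rule proper_open_rel_closed[OF R(1)])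
  define D where "D = Domain R"
  have D: "is_subgroup D" "open D" "closed D"
    unfolding D_def using is_subgroup_relations(1)[OF sub] open_Domain[OF R(1)] open_subgroup_closed by auto
  have D0: "0 \<in> D" using is_subgroupD(1)[OF D(1)] .
  have fm: "fst \<in> \<rho> \<rightarrow>\<^sub>M (borel :: 'a measure)"
  proof -
    have "(fst :: 'a \<times> 'a \<Rightarrow> 'a) \<in> borel \<rightarrow>\<^sub>M borel"
      by (intro borel_measurable_continuous_onI continuous_on_fst continuous_on_id)
    then show ?thesis using s by (simp cong: measurable_cong_sets)
  qed
  define \<rho>1 where "\<rho>1 = distr \<rho> borel fst"
  have em: "emeasure \<rho>1 A = emeasure \<rho> (A \<times> UNIV)" if "A \<in> sets borel" for A
  proof -
    have "fst -` A = A \<times> (UNIV :: 'a set)" by auto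
    then show ?thesis unfolding \<rho>1_def using emeasure_distr[OF fm that] sets_eq_imp_space_eq[OF s] by simp
  qed
  have nullR: "A \<inter> R = {} \<Longrightarrow> A \<in> sets borel \<Longrightarrow> emeasure \<rho> A = 0" for A
    using emeasure_mono[of A "- R" \<rho>] haar_measure_onD(3)[OF R(2)] s cR by auto
  have bT: "A \<times> (UNIV :: 'a set) \<in> sets borel" if "A \<in> sets borel" for A :: "'a set"
    using borel_Times[OF that borel_open[OF open_UNIV]] .
  have h1: "haar_measure_on D \<rho>1"
    unfolding haar_measure_on_def
  proof (intro conjI allI impI ballI)
    show "emeasure \<rho>1 (- D) = 0"
    proof -
      have "- D \<in> sets borel" using D(2) by (simp add: borel_comp)
      moreover from this have "emeasure \<rho> ((- D) \<times> UNIV) = 0" by (intro nullR bT) (auto simp: D_def)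
      ultimately show ?thesis using em by simp
    qed
    show "emeasure \<rho>1 D \<noteq> 0"
    proof -
      have "emeasure \<rho> R \<le> emeasure \<rho> (D \<times> UNIV)"
        using s bT[of D] D(2) by (intro emeasure_mono) (auto simp: D_def)
      then show ?thesis using haar_measure_onD(4)[OF R(2)] em[of D] D(2) by auto
    qed
    show "emeasure \<rho>1 C < \<infinity>" if C: "compact C" for C
    proof -
      have bC: "C \<times> (UNIV :: 'a set) \<in> sets borel" by (rule bT[OF borel_compact[OF C]])
      have cp: "compact (R \<inter> (C \<times> UNIV))" by (rule proper_open_relD(2)[OF R(1) C])
      have "emeasure \<rho> (C \<times> UNIV) \<le> emeasure \<rho> (R \<inter> (C \<times> UNIV))"
      proof (rule emeasure_mono_AE)
        show "AE x in \<rho>. x \<in> C \<times> UNIV \<longrightarrow> x \<in> R \<inter> (C \<times> UNIV)"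
          by (rule AE_I[of _ _ "- R"]) (use haar_measure_onD(3)[OF R(2)] s cR in auto)
        show "R \<inter> (C \<times> UNIV) \<in> sets \<rho>" using borel_compact[OF cp] s by simp
      qed
      also have "\<dots> < \<infinity>" using locally_finite_borelD(3)[OF haar_measure_onD(1)[OF R(2)] cp] .
      finally show ?thesis using em[OF borel_compact[OF C]] by simp
    qed
    fix g A assume g: "g \<in> D" and A: "A \<in> sets (borel :: 'a measure)"
    obtain h where h: "(g, h) \<in> R" using g by (auto simp: D_def)
    have "((\<lambda>x. g + x) ` A) \<times> UNIV = (\<lambda>x. (g, h) + x) ` (A \<times> UNIV)"
      unfolding left_translate_vimage by (auto simp: plus_prod_def uminus_prod_def)
    then show "emeasure \<rho>1 ((\<lambda>x. g + x) ` A) = emeasure \<rho>1 A"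
      using em[OF A] em[OF borel_left_translate[OF A]] haar_measure_onD(5)[OF R(2) h bT[OF A]] by simp
  qed (simp add: \<rho>1_def)
  define \<gamma>D where "\<gamma>D = density \<gamma> (indicator D)"
  have emD: "emeasure \<gamma>D A = emeasure \<gamma> (A \<inter> D)" if "A \<in> sets borel" for A
  proof -
    have "emeasure \<gamma>D A = (\<integral>\<^sup>+x. indicator D x * indicator A x \<partial>\<gamma>)"
      unfolding \<gamma>D_def using that D(2) by (intro emeasure_density) (auto intro!: borel_measurable_indicator)
    also have "\<dots> = emeasure \<gamma> (A \<inter> D)"
      using that D(2) by (simp add: indicator_inter_arith[symmetric] Int_commute)
    finally show ?thesis .
  qed
  have h2: "haar_measure_on D \<gamma>D"
    unfolding haar_measure_on_def
  proof (intro conjI allI impI ballI)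
    show "emeasure \<gamma>D (- D) = 0" using emD[of "- D"] D(2) by (simp add: borel_comp)
    show "emeasure \<gamma>D D \<noteq> 0" using emD[of D] D(2) \<gamma>_open[OF D(2)] D0 by auto
    show "emeasure \<gamma>D C < \<infinity>" if C: "compact C" for C
      using le_less_trans[OF emeasure_mono[of "C \<inter> D" C \<gamma>] \<gamma>_compact[OF C]] emD[OF borel_compact[OF C]] borel_compact[OF C] by simp
    fix g A assume g: "g \<in> D" and A: "A \<in> sets (borel :: 'a measure)"
    have "((\<lambda>x. g + x) ` A) \<inter> D = (\<lambda>x. g + x) ` (A \<inter> D)"
      using is_subgroupD(5)[OF D(1) g] by auto
    then show "emeasure \<gamma>D ((\<lambda>x. g + x) ` A) = emeasure \<gamma>D A"
      using emD[OF A] emD[OF borel_left_translate[OF A]] \<gamma>_left[of "A \<inter> D" g] A D(2) by simp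
  qed (simp add: \<gamma>D_def)
  obtain p where p: "emeasure \<rho>1 K0 = ennreal p" "p > 0"
    using K.haar_K[OF D(1) h1] by (cases "emeasure \<rho>1 K0" rule: ennreal_cases) auto
  obtain q where q: "emeasure \<gamma>D K0 = ennreal q" "q > 0"
    using K.haar_K[OF D(1) h2] by (cases "emeasure \<gamma>D K0" rule: ennreal_cases) auto
  show ?thesis
  proof (intro exI[of _ "p / q"] conjI ballI)
    fix A assume A: "A \<in> sets (borel :: 'a measure)"
    have "ennreal q * emeasure \<rho>1 A = ennreal p * emeasure \<gamma>D A"
      using K.haar_unique[OF D(1,3) h1 h2 A] p q by simp
    then have "ennreal (1 / q) * (ennreal q * emeasure \<rho>1 A) = ennreal (1 / q) * (ennreal p * emeasure \<gamma>D A)" by simp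
    then have "emeasure \<rho>1 A = ennreal (p / q) * emeasure \<gamma>D A"
      using p(2) q(2) by (simp add: mult.assoc[symmetric] ennreal_mult[symmetric])
    then show "emeasure \<rho> (A \<times> UNIV) = ennreal (p / q) * emeasure \<gamma> (A \<inter> Domain R)"
      using em[OF A] emD[OF A] by (simp add: D_def)
  qed (use p q in simp)
qed

text \<open>Two candidate factors are compared on \<open>K0 \<inter> Domain R\<close>, whose measure
  is positive and finite.\<close>

lemma polh_alpha_eqI:
  assumes R: "proper_open_rel (R :: ('a \<times> 'a) set)" and a: "a > 0"
    "\<And>A. A \<in> sets borel \<Longrightarrow> emeasure \<rho> (A \<times> UNIV) = ennreal a * emeasure \<gamma> (A \<inter> Domain R)"
  shows "polh_alpha \<gamma> R \<rho> = a"
  unfolding polh_alpha_def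
proof (rule the_equality)
  fix b assume b: "0 < b \<and> (\<forall>A\<in>sets borel. emeasure \<rho> (A \<times> UNIV) = ennreal b * emeasure \<gamma> (A \<inter> Domain R))"
  let ?U = "K0 \<inter> Domain R"
  have "emeasure \<gamma> ?U \<noteq> 0"
    using is_subgroupD(1)[OF is_subgroup_relations(1)[OF proper_open_relD(1)[OF R]]] is_subgroupD(1)[OF K.subgroup_K]
    by (intro \<gamma>_open open_Int K.open_K open_Domain[OF R]) auto
  moreover have "emeasure \<gamma> ?U < \<infinity>"
    using le_less_trans[OF emeasure_mono[of ?U K0 \<gamma>] \<gamma>_compact[OF K.compact_K]] K.open_K by simp
  moreover have "ennreal b * emeasure \<gamma> ?U = ennreal a * emeasure \<gamma> ?U"
    using b a(2)[of K0] K.open_K by (metis borel_open)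
  ultimately have "ennreal b = ennreal a"
    by (auto simp add: ennreal_mult_cancel_left mult.commute[of _ "emeasure \<gamma> ?U"])
  then show "b = a" using a b by simp
qed (use a in auto)

lemma polh_alpha:
  assumes R: "proper_open_rel (R :: ('a \<times> 'a) set)" "haar_measure_on R \<rho>"
  shows "polh_alpha \<gamma> R \<rho> > 0"
    "A \<in> sets borel \<Longrightarrow> emeasure \<rho> (A \<times> UNIV) = ennreal (polh_alpha \<gamma> R \<rho>) * emeasure \<gamma> (A \<inter> Domain R)"
proof -
  obtain a where a: "a > 0" "\<And>A. A \<in> sets borel \<Longrightarrow> emeasure \<rho> (A \<times> UNIV) = ennreal a * emeasure \<gamma> (A \<inter> Domain R)"
    using Domain_haar[OF R] by blast
  have "polh_alpha \<gamma> R \<rho> = a" by (rule polh_alpha_eqI[OF R(1) a])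
  then show "polh_alpha \<gamma> R \<rho> > 0"
    "A \<in> sets borel \<Longrightarrow> emeasure \<rho> (A \<times> UNIV) = ennreal (polh_alpha \<gamma> R \<rho>) * emeasure \<gamma> (A \<inter> Domain R)"
    using a by auto
qed

lemma polh_beta_converse:
  fixes R :: "('a \<times> 'a) set"
  assumes "haar_measure_on R \<rho>"
  shows "polh_beta \<gamma> R \<rho> = polh_alpha \<gamma> (R\<inverse>) (distr \<rho> borel prod.swap)"
proof -
  have "prod.swap -` (B \<times> UNIV) = (UNIV \<times> B :: ('a \<times> 'a) set)" for B by auto
  moreover have "B \<in> sets borel \<Longrightarrow> B \<times> (UNIV :: 'a set) \<in> sets borel" for B :: "'a set"
    using borel_Times[of B UNIV] by simp
  ultimately have "emeasure (distr \<rho> borel prod.swap) (B \<times> UNIV) = emeasure \<rho> (UNIV \<times> B)" if "B \<in> sets borel" for B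
    using haar_measure_on_converse(2)[OF assms] that by simp
  then show ?thesis unfolding polh_beta_def polh_alpha_def by simp
qed

end

section \<open>Indices and products\<close>

lemma subgroup_index_alt: "subgroup_index A B = card ((\<lambda>a. (\<lambda>x. a + x) ` B) ` A)"
  by (simp add: subgroup_index_def elt_set_plus_def image_def)

lemma left_coset_eq_iff:
  assumes "is_subgroup M"
  shows "(\<lambda>x. a + x) ` M = (\<lambda>x. b + x) ` M \<longleftrightarrow> - a + b \<in> M"
proof
  assume "(\<lambda>x. a + x) ` M = (\<lambda>x. b + x) ` M"
  then have "b \<in> (\<lambda>x. a + x) ` M" using mem_left_coset[OF assms, of b] by simp
  then show "- a + b \<in> M" by (simp add: left_translate_vimage)
next
  assume "- a + b \<in> M"
  then have "b \<in> (\<lambda>x. a + x) ` M" by (simp add: left_translate_vimage)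
  then show "(\<lambda>x. a + x) ` M = (\<lambda>x. b + x) ` M" using translate_subgroup[OF assms] by blast
qed

text \<open>Both images are in bijection with one set of representatives. It compares numbers of
  cosets of different subgroups.\<close>

lemma card_image_eq_if_same_fibres:
  assumes "\<And>a b. a \<in> L \<Longrightarrow> b \<in> L \<Longrightarrow> f a = f b \<longleftrightarrow> g a = g b"
  shows "card (f ` L) = card (g ` L)"
proof -
  obtain I where I: "I \<subseteq> L" "inj_on f I" "f ` L = f ` I"
    using subset_image_inj[of "f ` L" f L] by auto
  have "inj_on g I" using I(1,2) assms by (auto simp: inj_on_def subset_iff)
  moreover have "g ` L = g ` I"
  proof (intro equalityI subsetI)
    fix y assume "y \<in> g ` L"
    then obtain l where l: "l \<in> L" "y = g l" by blast
    then obtain i where "i \<in> I" "f l = f i" using I(3) by blast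
    then show "y \<in> g ` I" using l I(1) assms by blast
  qed (use I in blast)
  ultimately show ?thesis using I by (simp add: card_image)
qed

text \<open>Finitely many cosets of \<open>D\<close> cover the compact group \<open>L\<close>.
  Positivity excludes the default value 0 of \<open>subgroup_index\<close> for infinitely many
  cosets, so that division by the index is meaningful.\<close>

lemma finite_cosets:
  fixes L :: "'g::topological_group_add set"
  assumes L: "is_subgroup L" "compact L" and D: "is_subgroup D" "open D"
  shows "finite ((\<lambda>a. (\<lambda>x. a + x) ` (L \<inter> D)) ` L)" "subgroup_index L (L \<inter> D) > 0"
proof -
  have "L \<subseteq> (\<Union>l\<in>L. (\<lambda>x. l + x) ` D)"
  proof
    fix x assume "x \<in> L"
    then show "x \<in> (\<Union>l\<in>L. (\<lambda>x. l + x) ` D)" by (rule UN_I) (rule mem_left_coset[OF D(1)])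
  qed
  from compactE_image[OF L(2) open_left_translate[OF D(2)] this]
  obtain I where I: "finite I" "I \<subseteq> L" "L \<subseteq> (\<Union>l\<in>I. (\<lambda>x. l + x) ` D)" by metis
  have "(\<lambda>a. (\<lambda>x. a + x) ` (L \<inter> D)) ` L \<subseteq> (\<lambda>a. (\<lambda>x. a + x) ` (L \<inter> D)) ` I"
  proof
    fix Z assume "Z \<in> (\<lambda>a. (\<lambda>x. a + x) ` (L \<inter> D)) ` L"
    then obtain l where l: "l \<in> L" "Z = (\<lambda>x. l + x) ` (L \<inter> D)" by blast
    then obtain i where i: "i \<in> I" "l \<in> (\<lambda>x. i + x) ` D" using I(3) by blast
    then have "- i + l \<in> D" by (simp add: left_translate_vimage)
    moreover have "- i + l \<in> L" using i(1) I(2) l(1) is_subgroupD(2,3)[OF L(1)] by blast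
    ultimately have "(\<lambda>x. i + x) ` (L \<inter> D) = Z"
      unfolding l(2) left_coset_eq_iff[OF is_subgroup_Int[OF L(1) D(1)]] by simp
    then show "Z \<in> (\<lambda>a. (\<lambda>x. a + x) ` (L \<inter> D)) ` I" using i(1) by blast
  qed
  then show fin: "finite ((\<lambda>a. (\<lambda>x. a + x) ` (L \<inter> D)) ` L)" using I(1) finite_subset by blast
  have "(\<lambda>a. (\<lambda>x. a + x) ` (L \<inter> D)) ` L \<noteq> {}" using is_subgroupD(1)[OF L(1)] by blast
  then show "subgroup_index L (L \<inter> D) > 0"
    unfolding subgroup_index_alt using fin by (simp add: card_gt_0_iff)
qed

text \<open>One set for each coset survives, and these are disjoint. The family \<open>E\<close> is
  abstract because the count is applied to left translates, to right translates by inverses and to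
  translates by \<open>(0, l)\<close> in the product group.\<close>

lemma emeasure_Union_cosets:
  assumes M: "is_subgroup M" and fin: "finite ((\<lambda>a. (\<lambda>x. a + x) ` M) ` L)"
    and E: "\<And>l. l \<in> L \<Longrightarrow> E l \<in> sets \<mu>" "\<And>l. l \<in> L \<Longrightarrow> emeasure \<mu> (E l) = c"
    and eq: "\<And>l l'. l \<in> L \<Longrightarrow> l' \<in> L \<Longrightarrow> - l + l' \<in> M \<Longrightarrow> E l \<subseteq> E l'"
    and dj: "\<And>l l'. l \<in> L \<Longrightarrow> l' \<in> L \<Longrightarrow> - l + l' \<notin> M \<Longrightarrow> E l \<inter> E l' = {}"
  shows "emeasure \<mu> (\<Union>l\<in>L. E l) = of_nat (subgroup_index L M) * c"
proof -
  let ?f = "\<lambda>a. (\<lambda>x. a + x) ` M"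
  obtain I where I: "I \<subseteq> L" "inj_on ?f I" "?f ` L = ?f ` I"
    using subset_image_inj[of "?f ` L" ?f L] by auto
  have finI: "finite I" using fin I by (metis finite_image_iff)
  have card: "card I = subgroup_index L M" unfolding subgroup_index_alt I(3) using I(2) by (simp add: card_image)
  have "(\<Union>l\<in>L. E l) = (\<Union>l\<in>I. E l)"
  proof (intro equalityI UN_least)
    fix l assume l: "l \<in> L"
    then have "?f l \<in> ?f ` I" unfolding I(3)[symmetric] by (rule imageI)
    then obtain i where i: "i \<in> I" "?f l = ?f i" by (rule imageE)
    have "- l + i \<in> M" using i(2) unfolding left_coset_eq_iff[OF M] .
    then have "E l \<subseteq> E i" using I(1) i(1) by (intro eq l) auto
    then show "E l \<subseteq> (\<Union>l\<in>I. E l)" using i(1) by blast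
  qed (use I(1) in blast)
  moreover have "disjoint_family_on E I"
    unfolding disjoint_family_on_def
  proof (intro ballI impI)
    fix a b assume ab: "a \<in> I" "b \<in> I" "a \<noteq> b"
    then have "?f a \<noteq> ?f b" using I(2) by (auto simp: inj_on_def)
    then have "- a + b \<notin> M" unfolding left_coset_eq_iff[OF M] .
    then show "E a \<inter> E b = {}" using ab I(1) by (intro dj) auto
  qed
  then have "(\<Sum>l\<in>I. emeasure \<mu> (E l)) = emeasure \<mu> (\<Union>l\<in>I. E l)"
    using E(1) I(1) finI by (intro sum_emeasure) auto
  moreover have "(\<Sum>l\<in>I. emeasure \<mu> (E l)) = (\<Sum>l\<in>I. c)" using E(2) I(1) by (intro sum.cong) auto
  ultimately show ?thesis using card by simp
qed

lemma is_subgroup_product: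
  assumes A: "is_subgroup A" and W: "is_subgroup W" and norm: "\<And>w a. w \<in> W \<Longrightarrow> a \<in> A \<Longrightarrow> w + a - w \<in> A"
  shows "is_subgroup {a + w | a w. a \<in> A \<and> w \<in> W}"
  unfolding is_subgroup_def
proof (intro conjI ballI)
  show "0 \<in> {a + w | a w. a \<in> A \<and> w \<in> W}"
    using is_subgroupD(1)[OF A] is_subgroupD(1)[OF W] by force
next
  fix x y assume "x \<in> {a + w | a w. a \<in> A \<and> w \<in> W}" "y \<in> {a + w | a w. a \<in> A \<and> w \<in> W}"
  then obtain a w b v where ab: "x = a + w" "y = b + v" "a \<in> A" "w \<in> W" "b \<in> A" "v \<in> W" by blast
  have "x + y = (a + (w + b - w)) + (w + v)" unfolding ab by (simp add: add.assoc diff_conv_add_uminus del: add_uminus_conv_diff)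
  moreover have "a + (w + b - w) \<in> A" "w + v \<in> W"
    using is_subgroupD(2)[OF A ab(3) norm[OF ab(4,5)]] is_subgroupD(2)[OF W ab(4,6)] by auto
  ultimately show "x + y \<in> {a + w | a w. a \<in> A \<and> w \<in> W}" by blast
next
  fix x assume "x \<in> {a + w | a w. a \<in> A \<and> w \<in> W}"
  then obtain a w where ab: "x = a + w" "a \<in> A" "w \<in> W" by blast
  have "- x = (- w + - a - - w) + - w" unfolding ab by (simp add: minus_add)
  moreover have "- w + - a - - w \<in> A" "- w \<in> W"
    using norm[OF is_subgroupD(3)[OF W ab(3)] is_subgroupD(3)[OF A ab(2)]] is_subgroupD(3)[OF W ab(3)] by auto
  ultimately show "- x \<in> {a + w | a w. a \<in> A \<and> w \<in> W}" by blast
qed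

text \<open>Multiplying \<open>L\<close> and \<open>L \<inter> D\<close> by a small compact open subgroup that normalises both of them
  makes them open without changing the index.\<close>

lemma (in compact_open_subgroup) index_in_semigroup:
  fixes L N D :: "'g set"
  assumes L: "is_subgroup L" "compact L" and N: "is_subgroup N" "open N" and D: "is_subgroup D" "open D"
    and norm: "\<And>n l. n \<in> N \<Longrightarrow> l \<in> L \<Longrightarrow> n + l - n \<in> L"
  shows "subgroup_index L (L \<inter> D) \<in> index_semigroup TYPE('g)"
proof -
  \<comment> \<open>Inside \<open>K\<close> for compactness, inside \<open>N\<close> to normalise
    \<open>L\<close>, and inside \<open>D\<close> to normalise \<open>L \<inter> D\<close> as well
    and to add nothing to it within \<open>L\<close>.\<close>
  define W where "W = K \<inter> N \<inter> D"
  have W: "is_subgroup W" "open W" "compact W"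
    unfolding W_def
    using is_subgroup_Int[OF is_subgroup_Int[OF subgroup_K N(1)] D(1)] open_Int[OF open_Int[OF open_K N(2)] D(2)]
      compact_Int_closed[OF compact_Int_closed[OF compact_K open_subgroup_closed[OF N]] open_subgroup_closed[OF D]] by auto
  define M where "M = L \<inter> D"
  have M: "is_subgroup M" "compact M"
    unfolding M_def using is_subgroup_Int[OF L(1) D(1)] compact_Int_closed[OF L(2) open_subgroup_closed[OF D]] by auto
  define K1 where "K1 = {l + w | l w. l \<in> L \<and> w \<in> W}"
  define K2 where "K2 = {l + w | l w. l \<in> M \<and> w \<in> W}"
  have normM: "w + l - w \<in> M" if "w \<in> W" "l \<in> M" for w l
    using that norm is_subgroupD(2,4)[OF D(1)] by (auto simp: W_def M_def)
  have op: "open {l + w | l w. l \<in> A \<and> w \<in> W}" for A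
  proof -
    have "{l + w | l w. l \<in> A \<and> w \<in> W} = (\<Union>l\<in>A. (\<lambda>w. l + w) ` W)" by blast
    then show ?thesis using open_left_translate[OF W(2)] by auto
  qed
  have K1: "is_subgroup K1" "open K1" "compact K1"
  proof -
    show "is_subgroup K1" unfolding K1_def by (rule is_subgroup_product[OF L(1) W(1)]) (use norm in \<open>auto simp: W_def\<close>)
    show "open K1" "compact K1" unfolding K1_def by (rule op compact_set_plus[OF L(2) W(3)])+
  qed
  have K2: "is_subgroup K2" "open K2" "compact K2"
  proof -
    show "is_subgroup K2" unfolding K2_def by (rule is_subgroup_product[OF M(1) W(1) normM])
    show "open K2" "compact K2" unfolding K2_def by (rule op compact_set_plus[OF M(2) W(3)])+
  qed
  have "K2 \<subseteq> K1" unfolding K1_def K2_def M_def by blast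
  then have "subgroup_index K1 K2 \<in> index_semigroup TYPE('g)"
    using K1 K2 by (intro index_semigroup.index)
  moreover have "subgroup_index K1 K2 = subgroup_index L M"
  proof -
    have "(\<lambda>a. (\<lambda>x. a + x) ` K2) ` K1 = (\<lambda>a. (\<lambda>x. a + x) ` K2) ` L"
    proof (intro equalityI subsetI)
      fix Z assume "Z \<in> (\<lambda>a. (\<lambda>x. a + x) ` K2) ` K1"
      then obtain l w where lw: "l \<in> L" "w \<in> W" "Z = (\<lambda>x. (l + w) + x) ` K2" unfolding K1_def by blast
      have "- l + (l + w) \<in> K2"
        using lw(2) is_subgroupD(1)[OF M(1)] unfolding K2_def by (force simp: add.assoc[symmetric])
      then have "Z = (\<lambda>x. l + x) ` K2" unfolding lw(3) using left_coset_eq_iff[OF K2(1), of l "l + w"] by simp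
      then show "Z \<in> (\<lambda>a. (\<lambda>x. a + x) ` K2) ` L" using lw(1) by blast
    next
      fix Z assume "Z \<in> (\<lambda>a. (\<lambda>x. a + x) ` K2) ` L"
      then obtain l where l: "l \<in> L" "Z = (\<lambda>x. l + x) ` K2" by blast
      have "l + 0 \<in> K1" unfolding K1_def using l(1) is_subgroupD(1)[OF W(1)] by blast
      then show "Z \<in> (\<lambda>a. (\<lambda>x. a + x) ` K2) ` K1" using l(2) by auto
    qed
    moreover have "card ((\<lambda>a. (\<lambda>x. a + x) ` K2) ` L) = card ((\<lambda>a. (\<lambda>x. a + x) ` M) ` L)"
    proof (rule card_image_eq_if_same_fibres)
      fix a b assume ab: "a \<in> L" "b \<in> L"
      \<comment> \<open>\<open>M\<close> and \<open>W\<close> both lie in \<open>D\<close>, hence so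
        does \<open>K2\<close>, and \<open>L \<inter> K2 = M\<close>.\<close>
      have "- a + b \<in> K2 \<longleftrightarrow> - a + b \<in> M"
      proof
        assume "- a + b \<in> M"
        then have "(- a + b) + 0 \<in> K2" unfolding K2_def using is_subgroupD(1)[OF W(1)] by blast
        then show "- a + b \<in> K2" by simp
      next
        assume "- a + b \<in> K2"
        then obtain m w where mw: "- a + b = m + w" "m \<in> M" "w \<in> W" unfolding K2_def by blast
        then have "- a + b \<in> D" using is_subgroupD(2)[OF D(1)] by (auto simp: M_def W_def)
        moreover have "- a + b \<in> L" using ab is_subgroupD(2,3)[OF L(1)] by blast
        ultimately show "- a + b \<in> M" by (simp add: M_def)
      qed
      then show "((\<lambda>x. a + x) ` K2 = (\<lambda>x. b + x) ` K2) = ((\<lambda>x. a + x) ` M = (\<lambda>x. b + x) ` M)"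
        unfolding left_coset_eq_iff[OF K2(1)] left_coset_eq_iff[OF M(1)] .
    qed
    ultimately show ?thesis unfolding subgroup_index_alt by simp
  qed
  ultimately show ?thesis by (simp add: M_def)
qed

lemma haar_measure_on_scale:
  assumes "haar_measure_on R \<rho>" "c > 0"
  shows "haar_measure_on R (scale_measure (ennreal c) \<rho>)"
  using assms unfolding haar_measure_on_def by (simp add: ennreal_mult_less_top)

section \<open>Indices attached to a relation, and the measure of a product\<close>

context haar_setting
begin

text \<open>Lift \<open>n\<close> to \<open>(m, n)\<close> in \<open>R\<close> and conjugate
  \<open>(0, l)\<close> by it: the first coordinate stays 0.\<close>

lemma indef_rel_normal:
  fixes R :: "('a \<times> 'a) set"
  assumes "is_subgroup R" "n \<in> Range R" "l \<in> indef_rel R" shows "n + l - n \<in> indef_rel R"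
proof -
  obtain m where m: "(m, n) \<in> R" using assms(2) by blast
  have "(0, l) \<in> R" using assms(3) by (simp add: indef_rel_def)
  then have "(m, n) + (0, l) - (m, n) \<in> R" using is_subgroupD(2,4)[OF assms(1)] m by blast
  then show ?thesis by (simp add: indef_rel_def)
qed

lemma indef_index_in_semigroup:
  fixes R :: "('a \<times> 'a) set"
  assumes "proper_open_rel R" "proper_open_rel (R\<inverse>)" "is_subgroup D" "open D"
  shows "subgroup_index (indef_rel R) (indef_rel R \<inter> D) \<in> index_semigroup TYPE('a)"
proof (rule K.index_in_semigroup)
  show "is_subgroup (indef_rel R)" "is_subgroup (Range R)"
    using is_subgroup_relations[OF proper_open_relD(1)[OF assms(1)]] by auto
  show "open (Range R)" using open_Domain[OF assms(2)] by simp
  show "n + l - n \<in> indef_rel R" if "n \<in> Range R" "l \<in> indef_rel R" for n l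
    using indef_rel_normal[OF proper_open_relD(1)[OF assms(1)] that] .
qed (use assms compact_indef_rel in auto)

text \<open>Over the domain of \<open>Q = R \<inter> (U \<times> V)\<close>, the group
  \<open>R\<close> is the union of the translates of \<open>Q\<close> by \<open>(0, l)\<close> with
  \<open>l\<close> in \<open>indef_rel R\<close>, and two translates coincide exactly when the
  \<open>l\<close> agree modulo \<open>V\<close>. So the index counts disjoint translates of equal
  mass.\<close>

lemma haar_rectangle:
  fixes R :: "('a \<times> 'a) set"
  assumes R: "proper_open_rel R" "haar_measure_on R \<rho>" and U: "cosub U" and V: "cosub V"
  shows "emeasure \<rho> (U \<times> V) * of_nat (subgroup_index (indef_rel R) (indef_rel R \<inter> V)) =
    ennreal (polh_alpha \<gamma> R \<rho>) * emeasure \<gamma> (Domain (R \<inter> (U \<times> V)))"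
proof -
  define L where "L = indef_rel R"
  define Q where "Q = R \<inter> (U \<times> V)"
  define P where "P = Domain Q"
  note s = haar_measure_onD(2)[OF R(2)]
  note sub = proper_open_relD(1)[OF R(1)]
  have cR: "closed R" by (rule proper_open_rel_closed[OF R(1)])
  have UV: "is_subgroup (U \<times> V)" "open (U \<times> V)" using cosub_Times[OF U V] by (auto simp: cosub_def)
  have L: "is_subgroup L" "compact L" unfolding L_def using is_subgroup_relations(4)[OF sub] compact_indef_rel[OF R(1)] by auto
  have V': "is_subgroup V" "open V" using V by (auto simp: cosub_def)
  have Q: "is_subgroup Q" "Q \<in> sets borel"
    unfolding Q_def using is_subgroup_Int[OF sub UV(1)] cR UV(2) by auto
  have P: "P \<in> sets borel" "P \<subseteq> Domain R"
    using cosub_Domain[OF R(1) U V] unfolding P_def Q_def cosub_def by auto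
  have null: "AE x in \<rho>. x \<in> R"
    by (rule AE_I[of _ _ "- R"]) (use haar_measure_onD(3)[OF R(2)] s cR in auto)
  have 0: "(0, l) \<in> R" if "l \<in> L" for l using that by (simp add: L_def indef_rel_def)
  have PQ: "R \<inter> (P \<times> UNIV) = (\<Union>l\<in>L. (\<lambda>y. (0, l) + y) ` Q)"
  proof (intro equalityI subsetI)
    fix z assume z: "z \<in> R \<inter> (P \<times> UNIV)"
    obtain g h where gh: "z = (g, h)" by force
    then obtain v where v: "(g, v) \<in> Q" using z by (auto simp: P_def)
    have "(g, h) - (g, v) \<in> R" using z v unfolding gh by (intro is_subgroupD(4)[OF sub]) (auto simp: Q_def)
    then have "h - v \<in> L" by (simp add: L_def indef_rel_def)
    moreover have "z = (0, h - v) + (g, v)" by (simp add: gh)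
    ultimately show "z \<in> (\<Union>l\<in>L. (\<lambda>y. (0, l) + y) ` Q)" using v by blast
  next
    fix z assume "z \<in> (\<Union>l\<in>L. (\<lambda>y. (0, l) + y) ` Q)"
    then obtain l g v where "l \<in> L" "(g, v) \<in> Q" "z = (0, l) + (g, v)" by auto
    then show "z \<in> R \<inter> (P \<times> UNIV)"
      using is_subgroupD(2)[OF sub 0, of l "(g, v)"] by (auto simp: Q_def P_def)
  qed
  have "emeasure \<rho> (\<Union>l\<in>L. (\<lambda>y. (0, l) + y) ` Q) = of_nat (subgroup_index L (L \<inter> V)) * emeasure \<rho> Q"
  proof (rule emeasure_Union_cosets)
    show "is_subgroup (L \<inter> V)" by (rule is_subgroup_Int[OF L(1) V'(1)])
    show "finite ((\<lambda>a. (\<lambda>x. a + x) ` (L \<inter> V)) ` L)" by (rule finite_cosets(1)[OF L V'])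
    show "(\<lambda>y. (0, l) + y) ` Q \<in> sets \<rho>" for l using s borel_left_translate[OF Q(2)] by simp
    show "emeasure \<rho> ((\<lambda>y. (0, l) + y) ` Q) = emeasure \<rho> Q" if "l \<in> L" for l
      by (rule haar_measure_onD(5)[OF R(2) 0[OF that] Q(2)])
    fix l l' assume l: "l \<in> L" "l' \<in> L"
    have iff: "- (0, l) + (0, l') \<in> Q \<longleftrightarrow> - l + l' \<in> L \<inter> V"
    proof -
      have "0 \<in> U" using U is_subgroupD(1) by (auto simp: cosub_def)
      moreover have "- l + l' \<in> L" by (rule is_subgroupD(2)[OF L(1) is_subgroupD(3)[OF L(1) l(1)] l(2)])
      moreover from this have "(0, - l + l') \<in> R" by (rule 0)
      ultimately show ?thesis by (simp add: Q_def)
    qed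
    show "(\<lambda>y. (0, l) + y) ` Q \<subseteq> (\<lambda>y. (0, l') + y) ` Q" if "- l + l' \<in> L \<inter> V"
      using iff that left_coset_eq_iff[OF Q(1), of "(0, l)" "(0, l')"] by (metis subset_refl)
    show "(\<lambda>y. (0, l) + y) ` Q \<inter> (\<lambda>y. (0, l') + y) ` Q = {}" if "- l + l' \<notin> L \<inter> V"
      using iff that left_coset_eq_iff[OF Q(1), of "(0, l)" "(0, l')"] left_translate_eq_or_disjoint[OF Q(1), of "(0, l)" "(0, l')"] by metis
  qed
  moreover have "emeasure \<rho> (P \<times> UNIV) = emeasure \<rho> (R \<inter> (P \<times> UNIV))"
  proof (rule emeasure_eq_AE)
    show "AE x in \<rho>. (x \<in> P \<times> UNIV) = (x \<in> R \<inter> (P \<times> UNIV))" using null by eventually_elim simp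
    have "P \<times> (UNIV :: 'a set) \<in> sets borel" using P(1) borel_open[OF open_UNIV] by (rule borel_Times)
    then show "P \<times> UNIV \<in> sets \<rho>" "R \<inter> (P \<times> UNIV) \<in> sets \<rho>"
      unfolding s by (blast intro: sets.Int borel_closed[OF cR])+
  qed
  moreover have "emeasure \<rho> Q = emeasure \<rho> (U \<times> V)"
    unfolding Q_def
  proof (rule emeasure_eq_AE)
    show "AE x in \<rho>. (x \<in> R \<inter> (U \<times> V)) = (x \<in> U \<times> V)" using null by eventually_elim simp
    show "R \<inter> (U \<times> V) \<in> sets \<rho>" "U \<times> V \<in> sets \<rho>"
      unfolding s by (intro sets.Int borel_closed[OF cR] borel_open[OF UV(2)])+
  qed
  moreover have "P \<inter> Domain R = P" using P(2) by blast
  ultimately show ?thesis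
    using polh_alpha(2)[OF R P(1)] PQ unfolding L_def[symmetric] P_def[symmetric] Q_def[symmetric]
    by (simp add: mult.commute)
qed

lemma polh_beta:
  fixes R :: "('a \<times> 'a) set"
  assumes R: "proper_open_rel (R\<inverse>)" "haar_measure_on R \<rho>"
  shows "polh_beta \<gamma> R \<rho> > 0"
    "A \<in> sets borel \<Longrightarrow> emeasure \<rho> (UNIV \<times> A) = ennreal (polh_beta \<gamma> R \<rho>) * emeasure \<gamma> (A \<inter> Range R)"
proof -
  note h = haar_measure_on_converse[OF R(2)]
  show "polh_beta \<gamma> R \<rho> > 0" unfolding polh_beta_converse[OF R(2)] by (rule polh_alpha(1)[OF R(1) h(1)])
  assume A: "A \<in> sets borel"
  have "prod.swap -` (A \<times> UNIV) = (UNIV \<times> A :: ('a \<times> 'a) set)" by auto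
  then show "emeasure \<rho> (UNIV \<times> A) = ennreal (polh_beta \<gamma> R \<rho>) * emeasure \<gamma> (A \<inter> Range R)"
    unfolding polh_beta_converse[OF R(2)]
    using polh_alpha(2)[OF R(1) h(1) A] h(2)[OF borel_Times[OF A borel_open[OF open_UNIV]]] by simp
qed

text \<open>Because \<open>A\<close> is stable under \<open>ker_rel R\<close>, a point of
  \<open>R\<close> has its first coordinate in \<open>A\<close> exactly when its second is in the
  image of \<open>A\<close>. The mass of this part of \<open>R\<close> is computed through either
  projection.\<close>

lemma alpha_beta_saturated:
  fixes R :: "('a \<times> 'a) set"
  assumes R: "proper_open_rel R" "proper_open_rel (R\<inverse>)" "haar_measure_on R \<rho>"
    and A: "compact A" "A \<subseteq> Domain R" "\<And>a n. a \<in> A \<Longrightarrow> n \<in> ker_rel R \<Longrightarrow> a + n \<in> A"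
  shows "polh_alpha \<gamma> R \<rho> * measure \<gamma> A = polh_beta \<gamma> R \<rho> * measure \<gamma> (R `` A)"
proof -
  note s = haar_measure_onD(2)[OF R(3)]
  note sub = proper_open_relD(1)[OF R(1)]
  have cR: "closed R" by (rule proper_open_rel_closed[OF R(1)])
  have B: "compact (R `` A)" by (rule proper_open_rel_compact_Image[OF R(1) A(1)])
  have null: "AE x in \<rho>. x \<in> R"
    by (rule AE_I[of _ _ "- R"]) (use haar_measure_onD(3)[OF R(3)] s cR in auto)
  have iff: "(g, h) \<in> A \<times> UNIV \<longleftrightarrow> (g, h) \<in> UNIV \<times> R `` A" if "(g, h) \<in> R" for g h
  proof
    assume "(g, h) \<in> UNIV \<times> R `` A"
    then obtain a where a: "a \<in> A" "(a, h) \<in> R" by blast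
    have "- (a, h) + (g, h) \<in> R" using is_subgroupD(2)[OF sub is_subgroupD(3)[OF sub a(2)] that] .
    then have "a + (- a + g) \<in> A" using A(3)[OF a(1), of "- a + g"] by (simp add: ker_rel_def)
    then show "(g, h) \<in> A \<times> UNIV" by simp
  qed (use that in blast)
  have "emeasure \<rho> (A \<times> UNIV) = emeasure \<rho> (UNIV \<times> R `` A)"
  proof (rule emeasure_eq_AE)
    show "AE x in \<rho>. (x \<in> A \<times> UNIV) = (x \<in> UNIV \<times> R `` A)"
      using null by eventually_elim (use iff in force)
    show "A \<times> UNIV \<in> sets \<rho>" "UNIV \<times> R `` A \<in> sets \<rho>"
      unfolding s by (intro borel_Times borel_compact A B borel_open open_UNIV)+
  qed
  moreover have "A \<inter> Domain R = A" "R `` A \<inter> Range R = R `` A" using A(2) by blast+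
  ultimately have "ennreal (polh_alpha \<gamma> R \<rho>) * emeasure \<gamma> A = ennreal (polh_beta \<gamma> R \<rho>) * emeasure \<gamma> (R `` A)"
    using polh_alpha(2)[OF R(1,3) borel_compact[OF A(1)]] polh_beta(2)[OF R(2,3) borel_compact[OF B]] by simp
  then have "ennreal (polh_alpha \<gamma> R \<rho> * measure \<gamma> A) = ennreal (polh_beta \<gamma> R \<rho> * measure \<gamma> (R `` A))"
    using \<gamma>_compact[OF A(1)] \<gamma>_compact[OF B] less_imp_le[OF polh_alpha(1)[OF R(1,3)]] less_imp_le[OF polh_beta(1)[OF R(2,3)]]
    by (simp add: ennreal_mult emeasure_eq_ennreal_measure less_top)
  then show ?thesis
    using less_imp_le[OF polh_alpha(1)[OF R(1,3)]] less_imp_le[OF polh_beta(1)[OF R(2,3)]] by (simp add: ennreal_inj)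
qed

text \<open>The right translate of \<open>Y\<close> by \<open>- l\<close> depends only on the left
  coset of \<open>l\<close> modulo \<open>L \<inter> D\<close>, and distinct cosets give disjoint
  translates. Their equal measure is right invariance of \<gamma>, so unimodularity enters
  here.\<close>

lemma measure_right_cosets:
  assumes L: "is_subgroup L" "compact L" and D: "is_subgroup D" "open D" and Y: "compact Y"
    and stab: "\<And>y m. y \<in> Y \<Longrightarrow> m \<in> L \<inter> D \<Longrightarrow> y + m \<in> Y" and diff: "\<And>y z. y \<in> Y \<Longrightarrow> z \<in> Y \<Longrightarrow> - y + z \<in> D"
  shows "measure \<gamma> (\<Union>l\<in>L. (\<lambda>x. x + - l) ` Y) = real (subgroup_index L (L \<inter> D)) * measure \<gamma> Y"
proof -
  have "emeasure \<gamma> (\<Union>l\<in>L. (\<lambda>x. x + - l) ` Y) = of_nat (subgroup_index L (L \<inter> D)) * emeasure \<gamma> Y"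
  proof (rule emeasure_Union_cosets)
    show "is_subgroup (L \<inter> D)" by (rule is_subgroup_Int[OF L(1) D(1)])
    show "finite ((\<lambda>a. (\<lambda>x. a + x) ` (L \<inter> D)) ` L)" by (rule finite_cosets(1)[OF L D])
    show "(\<lambda>x. x + - l) ` Y \<in> sets \<gamma>" for l unfolding sets_\<gamma> by (rule borel_compact[OF compact_right_translate[OF Y]])
    show "emeasure \<gamma> ((\<lambda>x. x + - l) ` Y) = emeasure \<gamma> Y" for l by (rule \<gamma>_right[OF borel_compact[OF Y]])
    fix l l' assume l: "l \<in> L" "l' \<in> L"
    show "(\<lambda>x. x + - l) ` Y \<subseteq> (\<lambda>x. x + - l') ` Y" if "- l + l' \<in> L \<inter> D"
    proof
      fix z assume "z \<in> (\<lambda>x. x + - l) ` Y"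
      then obtain y where y: "y \<in> Y" "z = y + - l" by blast
      have "y + (- l + l') \<in> Y" using stab y(1) that by blast
      moreover have "z = y + (- l + l') + - l'" unfolding y(2) by (simp only: add.assoc right_minus add_0_right)
      ultimately show "z \<in> (\<lambda>x. x + - l') ` Y" by blast
    qed
    show "(\<lambda>x. x + - l) ` Y \<inter> (\<lambda>x. x + - l') ` Y = {}" if "- l + l' \<notin> L \<inter> D"
    proof (rule ccontr)
      assume "(\<lambda>x. x + - l) ` Y \<inter> (\<lambda>x. x + - l') ` Y \<noteq> {}"
      then obtain y z where yz: "y \<in> Y" "z \<in> Y" "y + - l = z + - l'" by blast
      then have "- y + (y + - l) + l' = - y + (z + - l') + l'" by simp
      then have "- l + l' = - y + z" by (simp only: add.assoc left_minus add_0_right minus_add_cancel)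
      then have "- l + l' \<in> D" using diff[OF yz(1,2)] by simp
      moreover have "- l + l' \<in> L" using l is_subgroupD(2,3)[OF L(1)] by blast
      ultimately show False using that by blast
    qed
  qed
  then show ?thesis unfolding measure_def by (simp add: enn2real_mult)
qed

text \<open>This identity makes the two normalisations in the definition of the product compatible. It
  compares the measures of \<open>A\<close>, of \<open>R[A]\<close>, of \<open>R[A] \<inter> dom T\<close>, of its \<open>ker T\<close>-saturation and of
  \<open>T[R[A]]\<close>, for a compact \<open>A \<subseteq> dom TR\<close> that is saturated under \<open>ker TR\<close>.\<close>

lemma product_consistent:
  fixes R T :: "('a \<times> 'a) set"
  assumes R: "proper_open_rel R" "proper_open_rel (R\<inverse>)" "haar_measure_on R \<rho>"
    and T: "proper_open_rel T" "proper_open_rel (T\<inverse>)" "haar_measure_on T \<tau>"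
    and \<sigma>: "haar_measure_on (R O T) \<sigma>"
  shows "polh_alpha \<gamma> (R O T) \<sigma> * (polh_beta \<gamma> R \<rho> * polh_beta \<gamma> T \<tau>) *
      real (subgroup_index (indef_rel R) (indef_rel R \<inter> Domain T)) =
    polh_beta \<gamma> (R O T) \<sigma> * (polh_alpha \<gamma> R \<rho> * polh_alpha \<gamma> T \<tau>) *
      real (subgroup_index (ker_rel T) (ker_rel T \<inter> Range R))"
proof -
  define S where "S = R O T"
  note subR = proper_open_relD(1)[OF R(1)]
  note subT = proper_open_relD(1)[OF T(1)]
  have S: "proper_open_rel S" "proper_open_rel (S\<inverse>)"
    unfolding S_def converse_relcomp by (intro proper_open_rel_relcomp R T)+
  note subS = proper_open_relD(1)[OF S(1)]
  define L where "L = indef_rel R"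
  define N where "N = ker_rel T"
  define D where "D = Domain T"
  define J where "J = Range R"
  have L: "is_subgroup L" "compact L" unfolding L_def by (rule is_subgroup_relations[OF subR] compact_indef_rel[OF R(1)])+
  have N: "is_subgroup N" "compact N"
    unfolding N_def using is_subgroup_relations[OF subT] compact_indef_rel[OF T(2)] by auto
  have D: "is_subgroup D" "open D" unfolding D_def by (rule is_subgroup_relations[OF subT] open_Domain[OF T(1)])+
  have J: "is_subgroup J" "open J" unfolding J_def using is_subgroup_relations[OF subR] open_Domain[OF R(2)] by auto
  have kerS: "is_subgroup (ker_rel S)" "compact (ker_rel S)"
    using is_subgroup_relations[OF subS] compact_indef_rel[OF S(2)] by auto
  define U where "U = Domain (S \<inter> (K0 \<times> K0))"
  have U: "is_subgroup U" "open U" "compact U" using cosub_Domain[OF S(1) K0 K0] by (auto simp: U_def cosub_def)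
  \<comment> \<open>Multiplying the compact open group \<open>U\<close> by the compact group
    \<open>ker_rel S\<close> enforces saturation and keeps \<open>A\<close> compact and of positive
    measure.\<close>
  define A where "A = {u + n | u n. u \<in> U \<and> n \<in> ker_rel S}"
  have A: "compact A" unfolding A_def by (rule compact_set_plus[OF U(3) kerS(2)])
  have AS: "A \<subseteq> Domain S"
    unfolding A_def U_def ker_rel_def using is_subgroupD(2)[OF is_subgroup_relations(1)[OF subS]] by blast
  have Asat: "a + n \<in> A" if an: "a \<in> A" "n \<in> ker_rel S" for a n
  proof -
    obtain u m where "u \<in> U" "m \<in> ker_rel S" "a = u + m" using an(1) by (auto simp: A_def)
    then show ?thesis using is_subgroupD(2)[OF kerS(1), of m n] an(2) unfolding A_def by (auto simp: add.assoc)
  qed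
  have kerRS: "ker_rel R \<subseteq> ker_rel S"
    unfolding ker_rel_def S_def using is_subgroupD(1)[OF subT] by (auto simp: zero_prod_def)
  have UA: "U \<subseteq> A"
  proof
    fix u assume "u \<in> U"
    then have "u + 0 \<in> A" unfolding A_def using is_subgroupD(1)[OF kerS(1)] by blast
    then show "u \<in> A" by simp
  qed
  have A0: "measure \<gamma> A \<noteq> 0"
  proof -
    have "emeasure \<gamma> U \<noteq> 0" using \<gamma>_open[OF U(2)] is_subgroupD(1)[OF U(1)] by blast
    moreover have "emeasure \<gamma> U \<le> emeasure \<gamma> A" using UA borel_compact[OF A] by (intro emeasure_mono) auto
    ultimately show ?thesis using \<gamma>_compact[OF A] by (auto simp: measure_def enn2real_eq_0_iff)
  qed
  define B where "B = R `` A"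
  have B: "compact B" unfolding B_def by (rule proper_open_rel_compact_Image[OF R(1) A])
  have BJ: "B \<subseteq> J" by (auto simp: B_def J_def)
  define Y where "Y = B \<inter> D"
  have Y: "compact Y" unfolding Y_def by (rule compact_Int_closed[OF B open_subgroup_closed[OF D]])
  define C where "C = (\<Union>n\<in>N. (\<lambda>x. x + - n) ` Y)"
  have ND: "N \<subseteq> D" by (auto simp: N_def D_def ker_rel_def)
  have C_alt: "C = {y + n | y n. y \<in> Y \<and> n \<in> N}"
  proof (intro equalityI subsetI)
    fix z assume "z \<in> C"
    then obtain n y where "n \<in> N" "y \<in> Y" "z = y + - n" by (auto simp: C_def)
    then show "z \<in> {y + n | y n. y \<in> Y \<and> n \<in> N}" using is_subgroupD(3)[OF N(1)] by blast
  next
    fix z assume "z \<in> {y + n | y n. y \<in> Y \<and> n \<in> N}"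
    then obtain n y where "n \<in> N" "y \<in> Y" "z = y + n" by blast
    moreover from this have "- n \<in> N" "z = y + - (- n)" using is_subgroupD(3)[OF N(1)] by auto
    ultimately show "z \<in> C" unfolding C_def by blast
  qed
  have C: "compact C" unfolding C_alt by (rule compact_set_plus[OF Y N(2)])
  \<comment> \<open>Since \<open>A\<close> lies in the domain of \<open>S\<close>, every fibre of
    \<open>R\<close> over \<open>A\<close> contains a point of \<open>D\<close>; so right
    translation by \<open>L\<close> recovers \<open>B\<close> from \<open>Y\<close>.\<close>
  have mB: "measure \<gamma> B = real (subgroup_index L (L \<inter> D)) * measure \<gamma> Y"
  proof -
    have Badd: "b + l \<in> B" if "b \<in> B" "l \<in> L" for b l
    proof -
      obtain a where a: "a \<in> A" "(a, b) \<in> R" using \<open>b \<in> B\<close> by (auto simp: B_def)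
      have "(a, b) + (0, l) \<in> R" using is_subgroupD(2)[OF subR a(2), of "(0, l)"] that(2) by (simp add: L_def indef_rel_def)
      then show ?thesis using a(1) by (auto simp: B_def)
    qed
    have "B = (\<Union>l\<in>L. (\<lambda>x. x + - l) ` Y)"
    proof (intro equalityI subsetI)
      fix b assume "b \<in> B"
      then obtain a where a: "a \<in> A" "(a, b) \<in> R" by (auto simp: B_def)
      have "a \<in> Domain S" using AS a(1) by (rule subsetD)
      then obtain h where h: "(a, h) \<in> R" "h \<in> D" by (auto simp: S_def D_def)
      have "- (a, b) + (a, h) \<in> R" using is_subgroupD(2)[OF subR is_subgroupD(3)[OF subR a(2)] h(1)] .
      then have "- b + h \<in> L" by (simp add: L_def indef_rel_def)
      moreover have "h \<in> Y" using a(1) h by (auto simp: Y_def B_def)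
      moreover have "b = h + - (- b + h)" by (simp add: minus_add)
      ultimately show "b \<in> (\<Union>l\<in>L. (\<lambda>x. x + - l) ` Y)" by blast
    next
      fix b assume "b \<in> (\<Union>l\<in>L. (\<lambda>x. x + - l) ` Y)"
      then obtain l y where "l \<in> L" "y \<in> B" "b = y + - l" by (auto simp: Y_def)
      then show "b \<in> B" using Badd is_subgroupD(3)[OF L(1)] by blast
    qed
    moreover have "measure \<gamma> (\<Union>l\<in>L. (\<lambda>x. x + - l) ` Y) = real (subgroup_index L (L \<inter> D)) * measure \<gamma> Y"
    proof (rule measure_right_cosets[OF L D Y])
      show "y + m \<in> Y" if "y \<in> Y" "m \<in> L \<inter> D" for y m
        using that Badd is_subgroupD(2)[OF D(1)] by (auto simp: Y_def)
      show "- y + z \<in> D" if "y \<in> Y" "z \<in> Y" for y z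
        using that is_subgroupD(2,3)[OF D(1)] by (auto simp: Y_def)
    qed
    ultimately show ?thesis by simp
  qed
  \<comment> \<open>An element of \<open>N \<inter> J\<close> lifts through \<open>R\<close> to
    \<open>ker_rel S\<close>, under which \<open>A\<close> is saturated; hence right translation by
    it preserves \<open>Y\<close>.\<close>
  have mC: "measure \<gamma> C = real (subgroup_index N (N \<inter> J)) * measure \<gamma> Y"
    unfolding C_def
  proof (rule measure_right_cosets[OF N J Y])
    show "y + m \<in> Y" if ym: "y \<in> Y" "m \<in> N \<inter> J" for y m
    proof -
      obtain a where a: "a \<in> A" "(a, y) \<in> R" using ym(1) by (auto simp: Y_def B_def)
      obtain a' where a': "(a', m) \<in> R" using ym(2) by (auto simp: J_def)
      have "a' \<in> ker_rel S" using a' ym(2) by (auto simp: ker_rel_def S_def N_def)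
      then have "a + a' \<in> A" using Asat a(1) by blast
      moreover have "(a + a', y + m) \<in> R" using is_subgroupD(2)[OF subR a(2) a'] by simp
      ultimately have "y + m \<in> B" by (auto simp: B_def)
      moreover have "y + m \<in> D" using ym ND is_subgroupD(2)[OF D(1)] by (auto simp: Y_def)
      ultimately show ?thesis by (simp add: Y_def)
    qed
    show "- y + z \<in> J" if "y \<in> Y" "z \<in> Y" for y z
    proof -
      have "y \<in> J" "z \<in> J" using that BJ by (auto simp: Y_def)
      then show ?thesis using is_subgroupD(2,3)[OF J(1)] by blast
    qed
  qed
  have TC: "T `` C = S `` A"
  proof (intro equalityI subsetI)
    fix k assume "k \<in> T `` C"
    then obtain y n where yn: "y \<in> Y" "n \<in> N" "(y + n, k) \<in> T" by (auto simp: C_alt)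
    have "(y + n, k) - (n, 0) \<in> T" using is_subgroupD(4)[OF subT yn(3), of "(n, 0)"] yn(2) by (simp add: N_def ker_rel_def)
    then have "(y, k) \<in> T" by simp
    then show "k \<in> S `` A" using yn(1) by (auto simp: Y_def B_def S_def)
  next
    fix k assume "k \<in> S `` A"
    then obtain a h where h: "a \<in> A" "(a, h) \<in> R" "(h, k) \<in> T" by (auto simp: S_def)
    then have "h \<in> Y" by (auto simp: Y_def B_def D_def)
    then have "h + 0 \<in> C" unfolding C_alt using is_subgroupD(1)[OF N(1)] by blast
    then show "k \<in> T `` C" using h by auto
  qed
  have 1: "polh_alpha \<gamma> S \<sigma> * measure \<gamma> A = polh_beta \<gamma> S \<sigma> * measure \<gamma> (S `` A)"
    using \<sigma> by (intro alpha_beta_saturated S A AS Asat) (simp_all add: S_def)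
  have 2: "polh_alpha \<gamma> R \<rho> * measure \<gamma> A = polh_beta \<gamma> R \<rho> * measure \<gamma> B"
    unfolding B_def
  proof (rule alpha_beta_saturated[OF R A])
    show "A \<subseteq> Domain R" using AS by (auto simp: S_def)
    show "a + n \<in> A" if "a \<in> A" "n \<in> ker_rel R" for a n using that Asat kerRS by blast
  qed
  have 3: "polh_alpha \<gamma> T \<tau> * measure \<gamma> C = polh_beta \<gamma> T \<tau> * measure \<gamma> (T `` C)"
  proof (rule alpha_beta_saturated[OF T C])
    show "C \<subseteq> Domain T" using ND is_subgroupD(2)[OF D(1)] unfolding C_alt D_def[symmetric] by (auto simp: Y_def)
    show "c + n \<in> C" if cn: "c \<in> C" "n \<in> ker_rel T" for c n
    proof -
      obtain y m where "y \<in> Y" "m \<in> N" "c = y + m" using cn(1) by (auto simp: C_alt)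
      then show ?thesis using is_subgroupD(2)[OF N(1), of m n] cn(2) unfolding C_alt N_def by (auto simp: add.assoc)
    qed
  qed
  define g where "g = measure \<gamma> Y"
  have g0: "g \<noteq> 0" using 2 A0 mB polh_alpha(1)[OF R(1,3)] by (auto simp: g_def)
  \<comment> \<open>Relations 2, 1 and 3 are applied in this order, moving from \<open>B\<close> to
    \<open>A\<close>, to its image under \<open>S\<close> and to \<open>C\<close>; both ends are
    multiples of \<open>g\<close>, which cancels.\<close>
  have "polh_alpha \<gamma> S \<sigma> * polh_beta \<gamma> R \<rho> * polh_beta \<gamma> T \<tau> * real (subgroup_index L (L \<inter> D)) * g =
      polh_alpha \<gamma> S \<sigma> * polh_beta \<gamma> T \<tau> * (polh_beta \<gamma> R \<rho> * measure \<gamma> B)" by (simp add: mB g_def)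
  also have "\<dots> = polh_alpha \<gamma> R \<rho> * polh_beta \<gamma> T \<tau> * (polh_alpha \<gamma> S \<sigma> * measure \<gamma> A)" by (simp add: 2[symmetric])
  also have "\<dots> = polh_alpha \<gamma> R \<rho> * polh_beta \<gamma> S \<sigma> * (polh_beta \<gamma> T \<tau> * measure \<gamma> (T `` C))" by (simp add: 1 TC)
  also have "\<dots> = polh_beta \<gamma> S \<sigma> * polh_alpha \<gamma> R \<rho> * polh_alpha \<gamma> T \<tau> * real (subgroup_index N (N \<inter> J)) * g"
    by (simp add: 3[symmetric] mC g_def)
  finally show ?thesis using g0 unfolding S_def[symmetric] L_def[symmetric] N_def[symmetric] D_def[symmetric] J_def[symmetric]
    by (simp add: mult.assoc)
qed

text \<open>Provides the ambient measure from which Haar measures on closed subgroups of the square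
  of the group are obtained.\<close>

lemma haar_pair: "haar_measure_on UNIV (\<gamma> \<Otimes>\<^sub>M \<gamma>)"
proof -
  obtain X :: "nat \<Rightarrow> 'a set" where "compact_open_partition X" by (rule K.partition_exists)
  then interpret X: compact_open_partition X .
  interpret g: sigma_finite_measure \<gamma> by (rule X.sigma_finite_locally_finite[OF haar_measure_onD(1)[OF haar_\<gamma>]])
  interpret p: pair_sigma_finite \<gamma> \<gamma> ..
  have s: "sets (\<gamma> \<Otimes>\<^sub>M \<gamma>) = sets borel"
    by (metis borel_prod sets_\<gamma> sets_pair_measure_cong)
  have nz: "emeasure \<gamma> UNIV \<noteq> 0" using haar_measure_onD(4)[OF haar_\<gamma>] .
  show ?thesis
    unfolding haar_measure_on_def
  proof (intro conjI allI impI ballI)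
    have "emeasure (\<gamma> \<Otimes>\<^sub>M \<gamma>) (UNIV \<times> UNIV) = emeasure \<gamma> UNIV * emeasure \<gamma> UNIV"
      by (rule g.emeasure_pair_measure_Times) auto
    then show "emeasure (\<gamma> \<Otimes>\<^sub>M \<gamma>) UNIV \<noteq> 0" using nz by simp
    show "emeasure (\<gamma> \<Otimes>\<^sub>M \<gamma>) C < \<infinity>" if C: "compact C" for C
    proof -
      have c: "compact (Domain C)" "compact (Range C)" using compact_Domain[OF C] compact_Range[OF C] .
      have "emeasure (\<gamma> \<Otimes>\<^sub>M \<gamma>) C \<le> emeasure (\<gamma> \<Otimes>\<^sub>M \<gamma>) (Domain C \<times> Range C)"
        using borel_compact[OF c(1)] borel_compact[OF c(2)] by (intro emeasure_mono) auto
      also have "\<dots> = emeasure \<gamma> (Domain C) * emeasure \<gamma> (Range C)"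
        using borel_compact[OF c(1)] borel_compact[OF c(2)] by (intro g.emeasure_pair_measure_Times) auto
      also have "\<dots> < \<infinity>" using \<gamma>_compact[OF c(1)] \<gamma>_compact[OF c(2)] by (simp add: ennreal_mult_less_top)
      finally show ?thesis .
    qed
    fix r :: "'a \<times> 'a" and A assume A: "A \<in> sets (borel :: ('a \<times> 'a) measure)"
    have m: "(\<lambda>x. a + x) \<in> \<gamma> \<rightarrow>\<^sub>M \<gamma>" for a :: 'a
      using borel_measurable_continuous_onI[OF continuous_on_left_translate, of a] by (simp cong: measurable_cong_sets)
    have d: "distr \<gamma> \<gamma> (\<lambda>x. a + x) = \<gamma>" for a
      using distr_left_translate_invariant[OF sets_\<gamma> \<gamma>_left, of a] by (metis distr_cong sets_\<gamma>)
    have "distr \<gamma> \<gamma> (\<lambda>x. fst r + x) \<Otimes>\<^sub>M distr \<gamma> \<gamma> (\<lambda>x. snd r + x) =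
        distr (\<gamma> \<Otimes>\<^sub>M \<gamma>) (\<gamma> \<Otimes>\<^sub>M \<gamma>) (\<lambda>(x, y). (fst r + x, snd r + y))"
      by (rule pair_measure_distr[OF m m]) (simp add: d g.sigma_finite_measure_axioms)
    then have D: "distr (\<gamma> \<Otimes>\<^sub>M \<gamma>) (\<gamma> \<Otimes>\<^sub>M \<gamma>) (\<lambda>x. r + x) = \<gamma> \<Otimes>\<^sub>M \<gamma>"
      by (simp add: d plus_prod_def case_prod_unfold)
    have mr: "(\<lambda>x. r + x) \<in> (\<gamma> \<Otimes>\<^sub>M \<gamma>) \<rightarrow>\<^sub>M (\<gamma> \<Otimes>\<^sub>M \<gamma>)"
      using borel_measurable_continuous_onI[OF continuous_on_left_translate, of r] s by (simp cong: measurable_cong_sets)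
    have "emeasure (\<gamma> \<Otimes>\<^sub>M \<gamma>) ((\<lambda>x. r + x) ` A) = emeasure (distr (\<gamma> \<Otimes>\<^sub>M \<gamma>) (\<gamma> \<Otimes>\<^sub>M \<gamma>) (\<lambda>x. r + x)) ((\<lambda>x. r + x) ` A)"
      by (simp add: D)
    also have "\<dots> = emeasure (\<gamma> \<Otimes>\<^sub>M \<gamma>) ((\<lambda>x. r + x) -` ((\<lambda>x. r + x) ` A) \<inter> space (\<gamma> \<Otimes>\<^sub>M \<gamma>))"
      by (rule emeasure_distr[OF mr]) (use borel_left_translate[OF A] s in simp)
    also have "(\<lambda>x. r + x) -` ((\<lambda>x. r + x) ` A) \<inter> space (\<gamma> \<Otimes>\<^sub>M \<gamma>) = A"
      using sets_eq_imp_space_eq[OF s] by auto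
    finally show "emeasure (\<gamma> \<Otimes>\<^sub>M \<gamma>) ((\<lambda>x. r + x) ` A) = emeasure (\<gamma> \<Otimes>\<^sub>M \<gamma>) A" .
  next
    show "sets (\<gamma> \<Otimes>\<^sub>M \<gamma>) = sets borel" by (rule s)
    show "emeasure (\<gamma> \<Otimes>\<^sub>M \<gamma>) (- UNIV) = 0" by simp
  qed
qed

text \<open>Haar measures on \<open>S\<close> are proportional, and \<alpha> fixes the mass of
  \<open>K0 \<times> UNIV\<close>, which is positive and finite; so the factor is 1.\<close>

lemma haar_eqI_alpha:
  fixes S :: "('a \<times> 'a) set"
  assumes S: "proper_open_rel S" and \<sigma>: "haar_measure_on S \<sigma>" "haar_measure_on S \<sigma>'"
    and eq: "polh_alpha \<gamma> S \<sigma> = polh_alpha \<gamma> S \<sigma>'"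
  shows "\<sigma> = \<sigma>'"
proof -
  note U = KK.haar_unique[OF proper_open_relD(1)[OF S] proper_open_rel_closed[OF S] \<sigma>]
  have bK: "K0 \<in> sets borel" using K.open_K by simp
  let ?B = "K0 \<times> (UNIV :: 'a set)"
  have B: "?B \<in> sets borel" using borel_Times[OF bK borel_open[OF open_UNIV]] .
  have e: "emeasure \<sigma> ?B = emeasure \<sigma>' ?B"
    using polh_alpha(2)[OF S \<sigma>(1) bK] polh_alpha(2)[OF S \<sigma>(2) bK] eq by simp
  have fin: "emeasure \<sigma> ?B < \<infinity>"
  proof -
    have "emeasure \<gamma> (K0 \<inter> Domain S) \<le> emeasure \<gamma> K0" using bK by (intro emeasure_mono) auto
    then show ?thesis
      using polh_alpha(2)[OF S \<sigma>(1) bK] le_less_trans[OF _ \<gamma>_compact[OF K.compact_K]] by (simp add: ennreal_mult_less_top)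
  qed
  have "emeasure \<sigma> (K0 \<times> K0) \<le> emeasure \<sigma> ?B"
    using B haar_measure_onD(2)[OF \<sigma>(1)] by (intro emeasure_mono) auto
  then have nz: "emeasure \<sigma> ?B \<noteq> 0" using KK.haar_K(1)[OF proper_open_relD(1)[OF S] \<sigma>(1)] by auto
  have "emeasure \<sigma>' (K0 \<times> K0) = emeasure \<sigma> (K0 \<times> K0)"
    using U[OF B] nz fin unfolding e[symmetric] by (auto simp: ennreal_mult_cancel_left mult.commute[of _ "emeasure \<sigma> ?B"])
  then show ?thesis
    using U KK.haar_K[OF proper_open_relD(1)[OF S] \<sigma>(1)] haar_measure_onD(2)[OF \<sigma>(1)] haar_measure_onD(2)[OF \<sigma>(2)]
    by (intro measure_eqI) (auto simp: ennreal_mult_cancel_left)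
qed

text \<open>A Haar measure on the closed subgroup \<open>R O T\<close> can be rescaled to the
  required \<alpha>; then \<beta> is forced by \<open>product_consistent\<close>, and \<alpha>
  determines the measure. Hence the definite description in \<open>polh_mult\<close>
  denotes.\<close>

lemma product_measure:
  fixes R T :: "('a \<times> 'a) set"
  assumes R: "proper_open_rel R" "proper_open_rel (R\<inverse>)" "haar_measure_on R \<rho>"
    and T: "proper_open_rel T" "proper_open_rel (T\<inverse>)" "haar_measure_on T \<tau>"
  shows "\<exists>!\<sigma>. haar_measure_on (R O T) \<sigma> \<and>
      polh_alpha \<gamma> (R O T) \<sigma> = polh_alpha \<gamma> R \<rho> * polh_alpha \<gamma> T \<tau>
        / real (subgroup_index (indef_rel R) (indef_rel R \<inter> Domain T)) \<and>
      polh_beta \<gamma> (R O T) \<sigma> = polh_beta \<gamma> R \<rho> * polh_beta \<gamma> T \<tau>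
        / real (subgroup_index (ker_rel T) (ker_rel T \<inter> Range R))"
    (is "\<exists>!\<sigma>. haar_measure_on ?S \<sigma> \<and> polh_alpha \<gamma> ?S \<sigma> = ?a \<and> polh_beta \<gamma> ?S \<sigma> = ?b")
proof -
  have S: "proper_open_rel ?S" by (rule proper_open_rel_relcomp[OF R(1) T(1)])
  note subR = proper_open_relD(1)[OF R(1)]
  note subT = proper_open_relD(1)[OF T(1)]
  let ?l = "subgroup_index (indef_rel R) (indef_rel R \<inter> Domain T)"
  let ?n = "subgroup_index (ker_rel T) (ker_rel T \<inter> Range R)"
  have l: "?l > 0"
    by (rule finite_cosets(2)[OF is_subgroup_relations(4)[OF subR] compact_indef_rel[OF R(1)] is_subgroup_relations(1)[OF subT] open_Domain[OF T(1)]])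
  have n: "?n > 0"
    using compact_indef_rel[OF T(2)] open_Domain[OF R(2)]
    by (intro finite_cosets(2) is_subgroup_relations subR subT) auto
  have pos: "polh_alpha \<gamma> R \<rho> > 0" "polh_alpha \<gamma> T \<tau> > 0" "polh_beta \<gamma> R \<rho> > 0" "polh_beta \<gamma> T \<tau> > 0"
    by (intro polh_alpha(1) polh_beta(1) R T)+
  have apos: "?a > 0" using pos l by simp
  obtain \<sigma>0 where \<sigma>0: "haar_measure_on ?S \<sigma>0"
    using KK.haar_measure_on_closed_subgroup[OF haar_pair proper_open_relD(1)[OF S] proper_open_rel_closed[OF S]] by blast
  define c where "c = ?a / polh_alpha \<gamma> ?S \<sigma>0"
  have c: "c > 0" unfolding c_def by (intro divide_pos_pos apos polh_alpha(1)[OF S \<sigma>0])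
  define \<sigma> where "\<sigma> = scale_measure (ennreal c) \<sigma>0"
  have \<sigma>: "haar_measure_on ?S \<sigma>" unfolding \<sigma>_def by (rule haar_measure_on_scale[OF \<sigma>0 c])
  have a: "polh_alpha \<gamma> ?S \<sigma> = ?a"
  proof (rule polh_alpha_eqI[OF S apos])
    fix A assume A: "A \<in> sets (borel :: 'a measure)"
    have "emeasure \<sigma> (A \<times> UNIV) = ennreal c * (ennreal (polh_alpha \<gamma> ?S \<sigma>0) * emeasure \<gamma> (A \<inter> Domain ?S))"
      unfolding \<sigma>_def using polh_alpha(2)[OF S \<sigma>0 A] by simp
    also have "\<dots> = ennreal (c * polh_alpha \<gamma> ?S \<sigma>0) * emeasure \<gamma> (A \<inter> Domain ?S)"
      using c polh_alpha(1)[OF S \<sigma>0] by (simp add: ennreal_mult mult.assoc)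
    also have "c * polh_alpha \<gamma> ?S \<sigma>0 = ?a" unfolding c_def using polh_alpha(1)[OF S \<sigma>0] by simp
    finally show "emeasure \<sigma> (A \<times> UNIV) = ennreal ?a * emeasure \<gamma> (A \<inter> Domain ?S)" .
  qed
  have b: "polh_beta \<gamma> ?S \<sigma> = ?b"
    using product_consistent[OF R T \<sigma>] pos l n unfolding a by (simp add: field_simps)
  show ?thesis
    using \<sigma> a b haar_eqI_alpha[OF S] by (intro ex1I[of _ \<sigma>]) auto
qed

end

section \<open>Compactness\<close>

text \<open>An open subgroup of a compact group has finite index, so the default 0 never enters the
  semigroup.\<close>

lemma index_semigroup_pos:
  assumes "n \<in> index_semigroup TYPE('g::{topological_group_add,t2_space})" shows "n > 0"
  using assms
proof induction
  case (index K1 K2)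
  have "K1 \<inter> K2 = K2" using index(7) by blast
  then show ?case using finite_cosets(2)[of K1 K2] index by simp
qed simp

lemma inverse_index_le_1:
  assumes "inverse a \<in> real ` index_semigroup TYPE('g::{topological_group_add,t2_space})" "a > 0"
  shows "a \<le> 1"
proof -
  obtain n where n: "inverse a = real n" "n \<in> index_semigroup TYPE('g)" using assms(1) by blast
  have "1 \<le> inverse a" using index_semigroup_pos[OF n(2)] n(1) by simp
  then show ?thesis using assms(2) by (simp add: one_le_inverse_iff)
qed

lemma vague_converges_converse:
  fixes \<rho> :: "nat \<Rightarrow> ('a::{topological_group_add,second_countable_topology,t2_space} \<times> 'b::{topological_group_add,second_countable_topology,t2_space}) measure"
  assumes conv: "vague_converges \<rho> M" and s: "\<And>j. sets (\<rho> j) = sets borel" "sets M = sets borel"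
  shows "vague_converges (\<lambda>j. distr (\<rho> j) borel prod.swap) (distr M borel prod.swap)"
  unfolding vague_converges_def
proof (intro allI impI)
  fix \<theta> :: "'b \<times> 'a \<Rightarrow> real" assume \<theta>: "test_function \<theta>"
  have cont: "continuous_on UNIV (prod.swap :: 'x::topological_space \<times> 'y::topological_space \<Rightarrow> _)"
    unfolding prod.swap_def[abs_def] by (intro continuous_on_Pair continuous_on_fst continuous_on_snd continuous_on_id)
  have eq: "(\<integral>x. \<theta> x \<partial>distr N borel prod.swap) = (\<integral>x. \<theta> (prod.swap x) \<partial>N)" if "sets N = sets borel" for N :: "('a \<times> 'b) measure"
  proof (rule integral_distr)
    show "prod.swap \<in> N \<rightarrow>\<^sub>M borel"
      using borel_measurable_continuous_onI[OF cont] that by (simp cong: measurable_cong_sets)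
    show "\<theta> \<in> borel_measurable borel" by (rule test_function_measurable[OF \<theta> refl])
  qed
  let ?S = "closure {x. \<theta> x \<noteq> 0}"
  have S: "compact (prod.swap ` ?S)"
    using \<theta> by (intro compact_continuous_image continuous_on_subset[OF cont]) (auto simp: test_function_def)
  have "{x. \<theta> (prod.swap x) \<noteq> 0} \<subseteq> prod.swap ` ?S"
  proof
    fix x assume "x \<in> {x. \<theta> (prod.swap x) \<noteq> 0}"
    then have "prod.swap x \<in> ?S" using closure_subset[of "{x. \<theta> x \<noteq> 0}"] by blast
    then show "x \<in> prod.swap ` ?S" by (metis image_eqI swap_swap)
  qed
  then have "closure {x. \<theta> (prod.swap x) \<noteq> 0} \<subseteq> prod.swap ` ?S"
    by (rule closure_minimal[OF _ compact_imp_closed[OF S]])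
  then have "compact (closure {x. \<theta> (prod.swap x) \<noteq> 0})" by (intro compact_closed_subset[OF S]) auto
  moreover have "continuous_on UNIV (\<lambda>x. \<theta> (prod.swap x))"
    using \<theta> continuous_on_compose2[OF _ cont] by (auto simp: test_function_def)
  ultimately have "test_function (\<lambda>x. \<theta> (prod.swap x))" by (simp add: test_function_def)
  then show "(\<lambda>j. \<integral>x. \<theta> x \<partial>distr (\<rho> j) borel prod.swap) \<longlonglongrightarrow> (\<integral>x. \<theta> x \<partial>distr M borel prod.swap)"
    unfolding eq[OF s(1)] eq[OF s(2)] by (rule vague_convergesD[OF conv])
qed

lemma closed_converse:
  fixes R :: "('a::topological_space \<times> 'b::topological_space) set"
  assumes "closed R" shows "closed (R\<inverse>)"
proof -
  have "closed ((\<lambda>p. (snd p, fst p)) -` R)"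
    by (intro closed_vimage assms continuous_on_Pair continuous_on_fst continuous_on_snd continuous_on_id)
  also have "(\<lambda>p. (snd p, fst p)) -` R = R\<inverse>" by auto
  finally show ?thesis .
qed

text \<open>Each group charges every open set it meets, while the complement of the other is open
  and null.\<close>

lemma haar_measure_on_unique_support:
  fixes R S :: "'g::{topological_group_add,second_countable_topology} set"
  assumes R: "is_subgroup R" "closed R" "haar_measure_on R M" and S: "is_subgroup S" "closed S" "haar_measure_on S M"
  shows "R = S"
proof -
  have "A \<subseteq> B" if A: "is_subgroup A" "haar_measure_on A M" and B: "closed B" "haar_measure_on B M" for A B :: "'g set"
    using haar_charges_open[OF A, of "- B"] B(1) haar_measure_onD(3)[OF B(2)] by blast
  then show ?thesis using R S by blast
qed

section \<open>Membership in \<open>Polh_Lambda\<close>, products and limits\<close>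

context haar_setting
begin

text \<open>The complement of \<open>R\<close> is null, so the bounds on parts of \<open>R\<close>
  are bounds on whole strips. Applied to \<rho> and to its swap, they make both projections proper
  and open.\<close>

lemma PolhD:
  assumes "Polyhom R \<rho> \<in> Polh \<gamma> \<gamma>"
  shows "is_subgroup R" "closed R" "haar_measure_on R \<rho>" "proper_open_rel R" "proper_open_rel (R\<inverse>)"
    "A \<in> sets borel \<Longrightarrow> emeasure \<rho> (A \<times> UNIV) \<le> emeasure \<gamma> A"
    "A \<in> sets borel \<Longrightarrow> emeasure \<rho> (UNIV \<times> A) \<le> emeasure \<gamma> A"
proof -
  show R: "is_subgroup R" "closed R" "haar_measure_on R \<rho>" using assms by (auto simp: Polh_def)
  note s = haar_measure_onD(2)[OF R(3)]
  have null: "AE x in \<rho>. x \<in> R"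
    by (rule AE_I[of _ _ "- R"]) (use haar_measure_onD(3)[OF R(3)] s R(2) in auto)
  have eq: "emeasure \<rho> B = emeasure \<rho> (R \<inter> B)" if "B \<in> sets borel" for B
  proof (rule emeasure_eq_AE)
    show "AE x in \<rho>. (x \<in> B) = (x \<in> R \<inter> B)" using null by eventually_elim simp
  qed (use that s R(2) in auto)
  have d1: "emeasure \<rho> (A \<times> UNIV) \<le> emeasure \<gamma> A" if A: "A \<in> sets borel" for A
    using assms A eq[OF borel_Times[OF A borel_open[OF open_UNIV]]] by (auto simp: Polh_def)
  have d2: "emeasure \<rho> (UNIV \<times> A) \<le> emeasure \<gamma> A" if A: "A \<in> sets borel" for A
    using assms A eq[OF borel_Times[OF borel_open[OF open_UNIV] A]] by (auto simp: Polh_def)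
  show "A \<in> sets borel \<Longrightarrow> emeasure \<rho> (A \<times> UNIV) \<le> emeasure \<gamma> A" by (rule d1)
  show "A \<in> sets borel \<Longrightarrow> emeasure \<rho> (UNIV \<times> A) \<le> emeasure \<gamma> A" by (rule d2)
  show "proper_open_rel R" by (rule proper_open_rel_if_dominated[OF R d1[OF borel_compact]])
  show "proper_open_rel (R\<inverse>)"
  proof (rule proper_open_rel_if_dominated)
    show "is_subgroup (R\<inverse>)" by (rule is_subgroup_relations(3)[OF R(1)])
    show "closed (R\<inverse>)" by (rule closed_converse[OF R(2)])
    show "haar_measure_on (R\<inverse>) (distr \<rho> borel prod.swap)" by (rule haar_measure_on_converse(1)[OF R(3)])
    fix A :: "'a set" assume A: "compact A"
    have "prod.swap -` (A \<times> UNIV) = (UNIV \<times> A :: ('a \<times> 'a) set)" by auto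
    then show "emeasure (distr \<rho> borel prod.swap) (A \<times> UNIV) \<le> emeasure \<gamma> A"
      using haar_measure_on_converse(2)[OF R(3) borel_Times[OF borel_compact[OF A] borel_open[OF open_UNIV]]] d2[OF borel_compact[OF A]] by simp
  qed
qed

text \<open>Members of \<Lambda> are at least 1, so \<alpha> and \<beta> are at most 1 and
  domination by \<gamma> follows from integrality.\<close>

lemma Polh_LambdaI:
  fixes R :: "('a \<times> 'a) set"
  assumes R: "proper_open_rel R" "proper_open_rel (R\<inverse>)" "haar_measure_on R \<rho>"
    and a: "inverse (polh_alpha \<gamma> R \<rho>) \<in> real ` index_semigroup TYPE('a)"
    and b: "inverse (polh_beta \<gamma> R \<rho>) \<in> real ` index_semigroup TYPE('a)"
  shows "Polyhom R \<rho> \<in> Polh_Lambda \<gamma>"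
proof -
  note s = haar_measure_onD(2)[OF R(3)]
  have scale: "ennreal c * emeasure \<gamma> (A \<inter> B) \<le> emeasure \<gamma> A" if "c \<le> 1" "A \<in> sets borel" for c A B
  proof -
    have "ennreal c * emeasure \<gamma> (A \<inter> B) \<le> 1 * emeasure \<gamma> A"
      using that by (intro mult_mono emeasure_mono) (auto simp: ennreal_le_1)
    then show ?thesis by simp
  qed
  have "emeasure \<rho> (R \<inter> (A \<times> UNIV)) \<le> emeasure \<gamma> A" if A: "A \<in> sets borel" for A
  proof -
    have "emeasure \<rho> (R \<inter> (A \<times> UNIV)) \<le> emeasure \<rho> (A \<times> UNIV)"
      using s borel_Times[OF A borel_open[OF open_UNIV]] by (intro emeasure_mono) auto
    also have "\<dots> \<le> emeasure \<gamma> A"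
      using scale[OF inverse_index_le_1[OF a polh_alpha(1)[OF R(1,3)]] A] polh_alpha(2)[OF R(1,3) A] by simp
    finally show ?thesis .
  qed
  moreover have "emeasure \<rho> (R \<inter> (UNIV \<times> A)) \<le> emeasure \<gamma> A" if A: "A \<in> sets borel" for A
  proof -
    have "emeasure \<rho> (R \<inter> (UNIV \<times> A)) \<le> emeasure \<rho> (UNIV \<times> A)"
      using s borel_Times[OF borel_open[OF open_UNIV] A] by (intro emeasure_mono) auto
    also have "\<dots> \<le> emeasure \<gamma> A"
      using scale[OF inverse_index_le_1[OF b polh_beta(1)[OF R(2,3)]] A] polh_beta(2)[OF R(2,3) A] by simp
    finally show ?thesis .
  qed
  ultimately have "Polyhom R \<rho> \<in> Polh \<gamma> \<gamma>"
    using R(3) proper_open_relD(1)[OF R(1)] proper_open_rel_closed[OF R(1)] by (auto simp: Polh_def)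
  then show ?thesis using a b by (simp add: Polh_Lambda_def)
qed

lemma Polh_Lambda_subset: "Polh_Lambda \<gamma> \<subseteq> Polh \<gamma> \<gamma>"
  by (auto simp: Polh_Lambda_def Polh_def)

lemma Polh_LambdaD:
  assumes "Polyhom R \<rho> \<in> Polh_Lambda \<gamma>"
  shows "Polyhom R \<rho> \<in> Polh \<gamma> \<gamma>" "inverse (polh_alpha \<gamma> R \<rho>) \<in> real ` index_semigroup TYPE('a)"
    "inverse (polh_beta \<gamma> R \<rho>) \<in> real ` index_semigroup TYPE('a)"
  using assms by (auto simp: Polh_Lambda_def)

text \<open>The inverse of \<alpha> of a product is the product of the two inverses and an index,
  which lies in \<Lambda> because the range of \<open>R\<close> normalises its indefiniteness; for
  \<beta> the same holds by passing to converses.\<close>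

lemma Polh_Lambda_mult:
  assumes "T \<in> Polh_Lambda \<gamma>" "R \<in> Polh_Lambda \<gamma>"
  shows "polh_mult \<gamma> \<gamma> \<gamma> T R \<in> Polh_Lambda \<gamma>"
proof (cases T)
  case ZeroPolh
  then show ?thesis by (simp add: Polh_Lambda_def)
next
  case T: (Polyhom T' \<tau>)
  show ?thesis
  proof (cases R)
    case ZeroPolh
    then show ?thesis using T by (simp add: Polh_Lambda_def)
  next
    case R: (Polyhom R' \<rho>)
    note lR = Polh_LambdaD[OF assms(2)[unfolded R]]
    note lT = Polh_LambdaD[OF assms(1)[unfolded T]]
    note pR = PolhD[OF lR(1)]
    note pT = PolhD[OF lT(1)]
    let ?l = "subgroup_index (indef_rel R') (indef_rel R' \<inter> Domain T')"
    let ?n = "subgroup_index (ker_rel T') (ker_rel T' \<inter> Range R')"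
    have l: "?l \<in> index_semigroup TYPE('a)"
      by (intro indef_index_in_semigroup pR(4,5) is_subgroup_relations(1) pT(1) open_Domain pT(4))
    have n: "?n \<in> index_semigroup TYPE('a)"
      using indef_index_in_semigroup[OF pT(5), of "Range R'"] pT(4) is_subgroup_relations(2)[OF pR(1)] open_Domain[OF pR(5)] by simp
    have mult: "inverse (x * y / real k) \<in> real ` index_semigroup TYPE('a)"
      if xy: "inverse x \<in> real ` index_semigroup TYPE('a)" "inverse y \<in> real ` index_semigroup TYPE('a)"
        and k: "k \<in> index_semigroup TYPE('a)" for x y k
    proof -
      obtain p q where pq: "inverse x = real p" "p \<in> index_semigroup TYPE('a)" "inverse y = real q" "q \<in> index_semigroup TYPE('a)"
        using xy by blast
      have "inverse (x * y / real k) = inverse x * inverse y * real k"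
        by (simp add: divide_inverse inverse_mult_distrib)
      also have "\<dots> = real (p * q * k)" using pq by simp
      finally show ?thesis using index_semigroup.mult[OF index_semigroup.mult[OF pq(2,4)] k] by blast
    qed
    define \<sigma> where "\<sigma> = (THE \<sigma>. haar_measure_on (R' O T') \<sigma> \<and>
      polh_alpha \<gamma> (R' O T') \<sigma> = polh_alpha \<gamma> R' \<rho> * polh_alpha \<gamma> T' \<tau> / real ?l \<and>
      polh_beta \<gamma> (R' O T') \<sigma> = polh_beta \<gamma> R' \<rho> * polh_beta \<gamma> T' \<tau> / real ?n)"
    have \<sigma>: "haar_measure_on (R' O T') \<sigma>"
      "polh_alpha \<gamma> (R' O T') \<sigma> = polh_alpha \<gamma> R' \<rho> * polh_alpha \<gamma> T' \<tau> / real ?l"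
      "polh_beta \<gamma> (R' O T') \<sigma> = polh_beta \<gamma> R' \<rho> * polh_beta \<gamma> T' \<tau> / real ?n"
      using theI'[OF product_measure[OF pR(4,5,3) pT(4,5,3)]] unfolding \<sigma>_def[symmetric] by auto
    have "Polyhom (R' O T') \<sigma> \<in> Polh_Lambda \<gamma>"
    proof (rule Polh_LambdaI)
      show "proper_open_rel (R' O T')" by (rule proper_open_rel_relcomp[OF pR(4) pT(4)])
      show "proper_open_rel ((R' O T')\<inverse>)" unfolding converse_relcomp by (rule proper_open_rel_relcomp[OF pT(5) pR(5)])
      show "inverse (polh_alpha \<gamma> (R' O T') \<sigma>) \<in> real ` index_semigroup TYPE('a)"
        unfolding \<sigma>(2) by (rule mult[OF lR(2) lT(2) l])
      show "inverse (polh_beta \<gamma> (R' O T') \<sigma>) \<in> real ` index_semigroup TYPE('a)"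
        unfolding \<sigma>(3) by (rule mult[OF lR(3) lT(3) n])
    qed (rule \<sigma>(1))
    then show ?thesis by (simp add: R T \<sigma>_def)
  qed
qed

text \<open>Strips over \<open>A\<close> need not be compact, so the limit may lose mass, but it
  gains none: lower semicontinuity bounds open strips, and these shrink to the strip over
  \<open>A\<close>.\<close>

lemma vague_limit_dominated:
  fixes \<rho> :: "nat \<Rightarrow> ('a \<times> 'a) measure"
  assumes conv: "vague_converges \<rho> M" and M: "locally_finite_borel M" and \<rho>: "\<And>j. locally_finite_borel (\<rho> j)"
    and dom: "\<And>j A. A \<in> sets borel \<Longrightarrow> emeasure (\<rho> j) (A \<times> UNIV) \<le> emeasure \<gamma> A"
    and A: "compact A"
  shows "emeasure M (A \<times> UNIV) \<le> emeasure \<gamma> A"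
proof -
  obtain X :: "nat \<Rightarrow> 'a set" where "compact_open_partition X" by (rule K.partition_exists)
  then interpret X: compact_open_partition X .
  obtain Y :: "nat \<Rightarrow> ('a \<times> 'a) set" where "compact_open_partition Y" by (rule KK.partition_exists)
  then interpret Y: compact_open_partition Y .
  obtain O' where O': "\<And>n. open (O' n)" "\<And>n. A \<subseteq> O' n"
    "\<And>M. locally_finite_borel M \<Longrightarrow> (\<lambda>n. emeasure M (O' n)) \<longlonglongrightarrow> emeasure M A"
    using X.compact_outer_approx[OF A] by metis
  have "emeasure M (A \<times> UNIV) \<le> emeasure \<gamma> (O' n)" for n
  proof -
    have op: "open (O' n \<times> (UNIV :: 'a set))" by (intro open_Times O'(1) open_UNIV)
    have "emeasure M (A \<times> UNIV) \<le> emeasure M (O' n \<times> UNIV)"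
      using O'(2)[of n] locally_finite_borelD(1)[OF M] op by (intro emeasure_mono) auto
    also have "\<dots> \<le> emeasure \<gamma> (O' n)"
      by (rule Y.vague_open_le[OF conv M \<rho> op]) (use dom O'(1) in simp)
    finally show ?thesis .
  qed
  then show ?thesis
    by (intro LIMSEQ_le_const[OF O'(3)[OF haar_measure_onD(1)[OF haar_\<gamma>]]]) auto
qed

lemma cosub_index_measure:
  assumes "cosub U" "cosub U'" "U' \<subseteq> U"
  shows "measure \<gamma> U = real (subgroup_index U U') * measure \<gamma> U'"
proof -
  have U: "is_subgroup U" "compact U" and U': "is_subgroup U'" "open U'" "compact U'"
    using assms by (auto simp: cosub_def)
  have i: "U \<inter> U' = U'" using assms(3) by blast
  have b: "U' \<in> sets borel" using U' by simp
  have "emeasure \<gamma> (\<Union>l\<in>U. (\<lambda>x. l + x) ` U') = of_nat (subgroup_index U U') * emeasure \<gamma> U'"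
  proof (rule emeasure_Union_cosets[OF U'(1)])
    show "finite ((\<lambda>a. (\<lambda>x. a + x) ` U') ` U)" using finite_cosets(1)[OF U U'(1,2)] i by simp
    show "(\<lambda>x. l + x) ` U' \<in> sets \<gamma>" for l unfolding sets_\<gamma> by (rule borel_left_translate[OF b])
    show "emeasure \<gamma> ((\<lambda>x. l + x) ` U') = emeasure \<gamma> U'" for l by (rule \<gamma>_left[OF b])
    fix l l' :: 'a
    show "(\<lambda>x. l + x) ` U' \<subseteq> (\<lambda>x. l' + x) ` U'" if "- l + l' \<in> U'"
      using that left_coset_eq_iff[OF U'(1), of l l'] by simp
    show "(\<lambda>x. l + x) ` U' \<inter> (\<lambda>x. l' + x) ` U' = {}" if "- l + l' \<notin> U'"
      using that left_coset_eq_iff[OF U'(1), of l l'] left_translate_eq_or_disjoint[OF U'(1), of l l'] by simp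
  qed
  moreover have "(\<Union>l\<in>U. (\<lambda>x. l + x) ` U') = U"
  proof (intro equalityI subsetI)
    fix z assume "z \<in> (\<Union>l\<in>U. (\<lambda>x. l + x) ` U')"
    then obtain l x where "l \<in> U" "x \<in> U'" "z = l + x" by blast
    then show "z \<in> U" using assms(3) is_subgroupD(2)[OF U(1)] by blast
  next
    fix z assume "z \<in> U"
    then show "z \<in> (\<Union>l\<in>U. (\<lambda>x. l + x) ` U')" by (rule UN_I) (rule mem_left_coset[OF U'(1)])
  qed
  ultimately show ?thesis unfolding measure_def by (simp add: enn2real_mult)
qed

text \<open>The image of \<open>\<rho>\<close> in \<open>G\<close> need not depend continuously on \<open>\<rho>\<close>, but its value on a rectangle
  \<open>U \<times> V\<close> of compact open subgroups does. If \<open>V\<close> contains the indefiniteness of the limit, then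
  \<open>\<gamma>(U) / \<rho>(U \<times> V)\<close> is the inverse of \<open>\<alpha>\<close> for the limit, and lies in \<open>\<Lambda>\<close> along the sequence.\<close>

lemma vague_limit_alpha:
  fixes \<rho> :: "nat \<Rightarrow> ('a \<times> 'a) measure"
  assumes conv: "vague_converges \<rho> M"
    and R: "\<And>j. proper_open_rel (R j)" "\<And>j. proper_open_rel ((R j)\<inverse>)" "\<And>j. haar_measure_on (R j) (\<rho> j)"
    and S: "proper_open_rel S" "proper_open_rel (S\<inverse>)" "haar_measure_on S M"
    and \<alpha>: "\<And>j. inverse (polh_alpha \<gamma> (R j) (\<rho> j)) \<in> real ` index_semigroup TYPE('a)"
  shows "inverse (polh_alpha \<gamma> S M) \<in> real ` index_semigroup TYPE('a)"
proof -
  note subS = proper_open_relD(1)[OF S(1)]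
  define L where "L = indef_rel S"
  have L: "is_subgroup L" "compact L" unfolding L_def by (rule is_subgroup_relations[OF subS] compact_indef_rel[OF S(1)])+
  have J: "is_subgroup (Range S)" "open (Range S)" using is_subgroup_relations(2)[OF subS] open_Domain[OF S(2)] by auto
  define W where "W = K0 \<inter> Range S"
  have W: "is_subgroup W" "open W" "compact W"
    unfolding W_def using is_subgroup_Int[OF K.subgroup_K J(1)] open_Int[OF K.open_K J(2)]
      compact_Int_closed[OF K.compact_K open_subgroup_closed[OF J]] by auto
  \<comment> \<open>\<open>W\<close> lies in the range of \<open>S\<close> and so normalises
    \<open>L\<close>; the product is a compact open subgroup containing \<open>indef_rel S\<close>,
    which makes the index for \<open>S\<close> equal to 1.\<close>
  define V where "V = {l + w | l w. l \<in> L \<and> w \<in> W}"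
  have V: "cosub V"
    unfolding cosub_def
  proof (intro conjI)
    show "is_subgroup V" unfolding V_def
      by (rule is_subgroup_product[OF L(1) W(1)]) (use indef_rel_normal[OF subS] in \<open>auto simp: W_def L_def\<close>)
    have "V = (\<Union>l\<in>L. (\<lambda>w. l + w) ` W)" unfolding V_def by blast
    then show "open V" using open_left_translate[OF W(2)] by auto
    show "compact V" unfolding V_def by (rule compact_set_plus[OF L(2) W(3)])
  qed
  have LV: "L \<inter> V = L"
  proof -
    have "l \<in> V" if "l \<in> L" for l
    proof -
      have "l + 0 \<in> V" unfolding V_def using that is_subgroupD(1)[OF W(1)] by blast
      then show ?thesis by simp
    qed
    then show ?thesis by blast
  qed
  have idx1: "subgroup_index L L = 1"
  proof -
    have "(\<lambda>a. (\<lambda>x. a + x) ` L) ` L = {L}"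
    proof -
      have "(\<lambda>x. a + x) ` L = L" if "a \<in> L" for a
        using translate_subgroup[OF L(1), of a 0] that by simp
      then show ?thesis using is_subgroupD(1)[OF L(1)] by auto
    qed
    then show ?thesis by (simp add: subgroup_index_alt)
  qed
  \<comment> \<open>With this choice the domain of \<open>S \<inter> (U \<times> V)\<close> is
    \<open>U\<close> itself, so the rectangle identity for \<open>S\<close> isolates
    \<alpha>.\<close>
  define U where "U = Domain (S \<inter> (K0 \<times> V))"
  have U: "cosub U" unfolding U_def by (rule cosub_Domain[OF S(1) K0 V])
  have DU: "Domain (S \<inter> (U \<times> V)) = U" unfolding U_def by blast
  have UV: "open (U \<times> V)" "compact (U \<times> V)" using cosub_Times[OF U V] by (auto simp: cosub_def)
  have cU: "compact U" "open U" "is_subgroup U" using U by (auto simp: cosub_def)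
  have gU: "measure \<gamma> U > 0"
    using \<gamma>_open[OF cU(2)] is_subgroupD(1)[OF cU(3)] \<gamma>_compact[OF cU(1)]
    by (auto simp: measure_def enn2real_positive_iff zero_less_iff_neq_zero)
  have fin: "emeasure \<gamma> C = ennreal (measure \<gamma> C)" if "compact C" for C
    using \<gamma>_compact[OF that] by (simp add: emeasure_eq_ennreal_measure less_top)
  have rect: "measure \<sigma> (U \<times> V) * real (subgroup_index (indef_rel T) (indef_rel T \<inter> V)) =
      polh_alpha \<gamma> T \<sigma> * measure \<gamma> (Domain (T \<inter> (U \<times> V)))"
    if T: "proper_open_rel T" "haar_measure_on T \<sigma>" for T \<sigma>
    using arg_cong[OF haar_rectangle[OF T U V], of enn2real] less_imp_le[OF polh_alpha(1)[OF T]]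
    by (simp add: enn2real_mult measure_def)
  have S_eq: "measure M (U \<times> V) = polh_alpha \<gamma> S M * measure \<gamma> U"
    using rect[OF S(1,3)] unfolding DU L_def[symmetric] LV idx1 by simp
  have lim: "(\<lambda>j. measure (\<rho> j) (U \<times> V)) \<longlonglongrightarrow> measure M (U \<times> V)"
    by (rule vague_converges_compact_open[OF conv UV haar_measure_onD(1)[OF S(3)] haar_measure_onD(1)[OF R(3)]])
  have apos: "polh_alpha \<gamma> S M > 0" by (rule polh_alpha(1)[OF S(1,3)])
  have "(\<lambda>j. measure \<gamma> U / measure (\<rho> j) (U \<times> V)) \<longlonglongrightarrow> measure \<gamma> U / measure M (U \<times> V)"
    by (intro tendsto_divide tendsto_const lim) (use S_eq apos gU in simp)
  also have "measure \<gamma> U / measure M (U \<times> V) = inverse (polh_alpha \<gamma> S M)"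
    using S_eq gU by (simp add: field_simps)
  finally have lim': "(\<lambda>j. measure \<gamma> U / measure (\<rho> j) (U \<times> V)) \<longlonglongrightarrow> inverse (polh_alpha \<gamma> S M)" .
  \<comment> \<open>The quotient is the index \<open>k\<close> of \<open>U'\<close> in
    \<open>U\<close> times the index \<open>i\<close> of the rectangle identity times the inverse of
    \<alpha>, all three in \<Lambda>.\<close>
  have mem: "measure \<gamma> U / measure (\<rho> j) (U \<times> V) \<in> real ` index_semigroup TYPE('a)" for j
  proof -
    obtain p where p: "inverse (polh_alpha \<gamma> (R j) (\<rho> j)) = real p" "p \<in> index_semigroup TYPE('a)" using \<alpha> by blast
    define U' where "U' = Domain (R j \<inter> (U \<times> V))"
    have U': "cosub U'" "U' \<subseteq> U" unfolding U'_def using cosub_Domain[OF R(1) U V] by auto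
    define k where "k = subgroup_index U U'"
    define i where "i = subgroup_index (indef_rel (R j)) (indef_rel (R j) \<inter> V)"
    have k: "k \<in> index_semigroup TYPE('a)"
      unfolding k_def using U U' by (intro index_semigroup.index) (auto simp: cosub_def)
    have i: "i \<in> index_semigroup TYPE('a)"
      unfolding i_def using V by (intro indef_index_in_semigroup R) (auto simp: cosub_def)
    have gk: "measure \<gamma> U = real k * measure \<gamma> U'" unfolding k_def by (rule cosub_index_measure[OF U U'])
    have r: "measure (\<rho> j) (U \<times> V) * real i = polh_alpha \<gamma> (R j) (\<rho> j) * measure \<gamma> U'"
      unfolding i_def U'_def by (rule rect[OF R(1,3)])
    have pos: "real i > 0" "real k > 0" "polh_alpha \<gamma> (R j) (\<rho> j) > 0" "measure \<gamma> U' > 0"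
      using index_semigroup_pos[OF i] index_semigroup_pos[OF k] polh_alpha(1)[OF R(1,3)] gk gU
      by (auto simp: zero_less_mult_iff)
    have rp: "measure (\<rho> j) (U \<times> V) = polh_alpha \<gamma> (R j) (\<rho> j) * measure \<gamma> U' / real i"
      using r pos(1) by (simp add: field_simps)
    have "measure \<gamma> U / measure (\<rho> j) (U \<times> V) = real k * real i * inverse (polh_alpha \<gamma> (R j) (\<rho> j))"
      unfolding rp gk using pos by (simp add: field_simps)
    also have "\<dots> = real (k * i * p)" by (simp add: p)
    finally show ?thesis using index_semigroup.mult[OF index_semigroup.mult[OF k i] p(2)] by blast
  qed
  \<comment> \<open>A set of natural numbers is closed in the reals, so the limit of the quotients
    stays in \<Lambda>.\<close>
  show ?thesis by (rule closed_sequentially[OF closed_of_nat_image mem lim'])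
qed

lemma Polh_measure:
  assumes "P \<in> Polh \<gamma> \<gamma>"
  shows "locally_finite_borel (polh_measure P)" "A \<in> sets borel \<Longrightarrow> emeasure (polh_measure P) (A \<times> UNIV) \<le> emeasure \<gamma> A"
proof -
  show "locally_finite_borel (polh_measure P)"
  proof (cases P)
    case (Polyhom R \<rho>)
    then show ?thesis using haar_measure_onD(1)[OF PolhD(3)] assms by simp
  qed (simp add: locally_finite_borel_def)
  show "emeasure (polh_measure P) (A \<times> UNIV) \<le> emeasure \<gamma> A" if "A \<in> sets borel"
  proof (cases P)
    case (Polyhom R \<rho>)
    then show ?thesis using PolhD(6)[OF _ that] assms by simp
  qed simp
qed

text \<open>The group is recovered from the measure as its support, and a Haar measure is never the
  null measure.\<close>

lemma polh_measure_inj: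
  assumes P: "P \<in> Polh \<gamma> \<gamma>" and Q: "Q \<in> Polh \<gamma> \<gamma>" and eq: "polh_measure P = polh_measure Q"
  shows "P = Q"
proof -
  have nz: "\<rho> \<noteq> null_measure borel" if "Polyhom R \<rho> \<in> Polh \<gamma> \<gamma>" for R \<rho>
    using haar_measure_onD(4)[OF PolhD(3)[OF that]] by auto
  show ?thesis
  proof (cases P)
    case ZeroPolh
    then show ?thesis using nz Q eq by (cases Q) auto
  next
    case P': (Polyhom R \<rho>)
    show ?thesis
    proof (cases Q)
      case ZeroPolh
      then show ?thesis using nz P P' eq by auto
    next
      case Q': (Polyhom S \<sigma>)
      have "\<rho> = \<sigma>" using eq P' Q' by simp
      moreover have "R = S"
        using PolhD(1-3)[OF P[unfolded P']] PolhD(1-3)[OF Q[unfolded Q']] unfolding \<open>\<rho> = \<sigma>\<close>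
        by (rule haar_measure_on_unique_support)
      ultimately show ?thesis by (simp add: P' Q')
    qed
  qed
qed

text \<open>Domination bounds the mass of a piece by the \<gamma>-measure of its projection, so a
  vague limit exists. A zero limit is \<open>ZeroPolh\<close>; a nonzero one is a Haar measure on
  its support, and integrality passes to it for \<alpha> and, after the swap, for \<beta>.\<close>

lemma Polh_Lambda_seq_compact:
  assumes X: "\<And>j::nat. X j \<in> Polh_Lambda \<gamma>"
  obtains P r where "P \<in> Polh_Lambda \<gamma>" "strict_mono (r :: nat \<Rightarrow> nat)" "polh_converges (X \<circ> r) P"
proof -
  obtain Y :: "nat \<Rightarrow> ('a \<times> 'a) set" where "compact_open_partition Y" by (rule KK.partition_exists)
  then interpret Y: compact_open_partition Y .
  define \<mu> where "\<mu> j = polh_measure (X j)" for j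
  have XP: "X j \<in> Polh \<gamma> \<gamma>" for j using X Polh_Lambda_subset by blast
  have lf: "locally_finite_borel (\<mu> j)" for j unfolding \<mu>_def by (rule Polh_measure(1)[OF XP])
  have bd: "emeasure (\<mu> j) (Y n) \<le> ennreal (measure \<gamma> (Domain (Y n)))" for j n
  proof -
    have c: "compact (Domain (Y n))" by (rule compact_Domain[OF Y.compact_X])
    have "emeasure (\<mu> j) (Y n) \<le> emeasure (\<mu> j) (Domain (Y n) \<times> UNIV)"
      using locally_finite_borelD(1)[OF lf] borel_Times[OF borel_compact[OF c] borel_open[OF open_UNIV]]
      by (intro emeasure_mono) auto
    also have "\<dots> \<le> emeasure \<gamma> (Domain (Y n))"
      unfolding \<mu>_def by (rule Polh_measure(2)[OF XP borel_compact[OF c]])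
    finally show ?thesis using \<gamma>_compact[OF c] by (simp add: emeasure_eq_ennreal_measure less_top)
  qed
  obtain r M where r: "strict_mono r" and M: "sets M = sets borel" "\<And>K. compact K \<Longrightarrow> emeasure M K < \<infinity>"
    and conv: "vague_converges (\<mu> \<circ> r) M"
    using Y.vague_seq_compact[of \<mu> "\<lambda>n. measure \<gamma> (Domain (Y n))", OF locally_finite_borelD(1)[OF lf] bd] by blast
  have lfM: "locally_finite_borel M" using M by (simp add: locally_finite_borel_def)
  have polh: "polh_converges (X \<circ> s) P" if "vague_converges (\<mu> \<circ> s) (polh_measure P)" for s P
    using that unfolding polh_converges_def vague_converges_def \<mu>_def by simp
  show thesis
  proof (cases "emeasure M UNIV = 0")
    case True
    have "M = null_measure borel"
    proof (rule measure_eqI)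
      fix A assume "A \<in> sets M"
      have "emeasure M A \<le> emeasure M UNIV" by (intro emeasure_mono) (auto simp: M)
      then show "emeasure M A = emeasure (null_measure borel) A" using True by simp
    qed (simp add: M)
    then have "polh_converges (X \<circ> r) ZeroPolh" using conv by (intro polh) simp
    then show thesis by (intro that[OF _ r]) (simp_all add: Polh_Lambda_def)
  next
    case False
    \<comment> \<open>A piece charged by the limit is eventually charged along the subsequence, so
      these terms are not \<open>ZeroPolh\<close> and have groups \<open>R j\<close>.\<close>
    have "\<exists>n. emeasure M (Y n) \<noteq> 0"
    proof (rule ccontr)
      assume "\<not> ?thesis"
      then show False using Y.emeasure_pieces[OF M(1), of UNIV] False by simp
    qed
    then obtain n where n: "emeasure M (Y n) \<noteq> 0" by blast
    have "\<forall>\<^sub>F j in sequentially. emeasure ((\<mu> \<circ> r) j) (Y n) \<noteq> 0"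
      using Y.vague_open_eventually_pos[OF conv lfM _ Y.open_X n] lf by simp
    then obtain J where J: "\<And>j. j \<ge> J \<Longrightarrow> emeasure (\<mu> (r j)) (Y n) \<noteq> 0"
      unfolding eventually_sequentially by auto
    define s where "s = r \<circ> (\<lambda>j. j + J)"
    have sm: "strict_mono s" unfolding s_def by (intro strict_mono_o r) (simp add: strict_mono_def)
    have conv': "vague_converges (\<mu> \<circ> s) M"
      unfolding s_def o_assoc by (rule vague_converges_subseq[OF conv]) (simp add: strict_mono_def)
    have "\<exists>R \<rho>. X (s j) = Polyhom R \<rho>" for j
      using J[of "j + J"] by (cases "X (s j)") (auto simp: s_def \<mu>_def)
    then obtain R \<rho> where R\<rho>: "\<And>j. X (s j) = Polyhom (R j) (\<rho> j)" by metis
    have \<rho>: "\<mu> \<circ> s = \<rho>" by (rule ext) (simp add: \<mu>_def R\<rho>)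
    note lam = Polh_LambdaD[OF X[of "s _", unfolded R\<rho>]]
    note pol = PolhD[OF lam(1)]
    note conv\<rho> = conv'[unfolded \<rho>]
    obtain S where S: "is_subgroup S" "closed S" "haar_measure_on S M"
      using KK.vague_limit_haar[OF conv\<rho> lfM pol(1-3) False] by blast
    note lf\<rho> = haar_measure_onD(1)[OF pol(3)]
    have pS: "proper_open_rel S"
      by (rule proper_open_rel_if_dominated[OF S vague_limit_dominated[OF conv\<rho> lfM lf\<rho> pol(6)]])
    define \<rho>' where "\<rho>' j = distr (\<rho> j) borel prod.swap" for j
    define M' where "M' = distr M borel prod.swap"
    have conv'': "vague_converges \<rho>' M'"
      unfolding \<rho>'_def M'_def
      by (rule vague_converges_converse[OF conv\<rho> haar_measure_onD(2)[OF pol(3)] M(1)])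
    have h\<rho>': "haar_measure_on ((R j)\<inverse>) (\<rho>' j)" for j unfolding \<rho>'_def by (rule haar_measure_on_converse(1)[OF pol(3)])
    have hM': "haar_measure_on (S\<inverse>) M'" unfolding M'_def by (rule haar_measure_on_converse(1)[OF S(3)])
    have dom': "emeasure (\<rho>' j) (A \<times> UNIV) \<le> emeasure \<gamma> A" if A: "A \<in> sets borel" for j A
    proof -
      have "prod.swap -` (A \<times> UNIV) = (UNIV \<times> A :: ('a \<times> 'a) set)" by auto
      then show ?thesis
        unfolding \<rho>'_def
        using haar_measure_on_converse(2)[OF pol(3) borel_Times[OF A borel_open[OF open_UNIV]]] pol(7)[OF A] by simp
    qed
    have pS': "proper_open_rel (S\<inverse>)"
      by (rule proper_open_rel_if_dominated[OF is_subgroup_relations(3)[OF S(1)] closed_converse[OF S(2)] hM'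
            vague_limit_dominated[OF conv'' haar_measure_onD(1)[OF hM'] haar_measure_onD(1)[OF h\<rho>'] dom']])
    have a: "inverse (polh_alpha \<gamma> S M) \<in> real ` index_semigroup TYPE('a)"
      by (rule vague_limit_alpha[OF conv\<rho> pol(4,5,3) pS pS' S(3) lam(2)])
    have b: "inverse (polh_beta \<gamma> S M) \<in> real ` index_semigroup TYPE('a)"
      unfolding polh_beta_converse[OF S(3)] M'_def[symmetric]
    proof (rule vague_limit_alpha[OF conv'' pol(5) _ h\<rho>' pS' _ hM'])
      show "proper_open_rel (((R j)\<inverse>)\<inverse>)" for j using pol(4) by simp
      show "proper_open_rel ((S\<inverse>)\<inverse>)" using pS by simp
      show "inverse (polh_alpha \<gamma> ((R j)\<inverse>) (\<rho>' j)) \<in> real ` index_semigroup TYPE('a)" for j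
        using lam(3)[of j] unfolding polh_beta_converse[OF pol(3)] \<rho>'_def .
    qed
    have "Polyhom S M \<in> Polh_Lambda \<gamma>" by (rule Polh_LambdaI[OF pS pS' S(3) a b])
    moreover have "polh_converges (X \<circ> s) (Polyhom S M)" using conv' by (intro polh) simp
    ultimately show thesis using that sm by blast
  qed
qed

lemma tendsto_fun_coordinatewise:
  fixes f :: "nat \<Rightarrow> 'i \<Rightarrow> 'c::topological_space"
  assumes "\<And>i. (\<lambda>j. f j i) \<longlonglongrightarrow> l i" shows "f \<longlonglongrightarrow> l"
proof -
  have "limitin (product_topology (\<lambda>i. euclidean) UNIV) f l sequentially"
    unfolding limitin_componentwise using assms by auto
  then show ?thesis by (simp add: euclidean_product_topology)
qed

text \<open>A countable determining family of test functions embeds the space of polyhomomorphisms into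
  the metrizable space of real sequences, where compactness is sequential compactness.\<close>

lemma compactin_Polh_Lambda: "compactin (polh_topology \<gamma> \<gamma>) (Polh_Lambda \<gamma>)"
proof -
  obtain Y :: "nat \<Rightarrow> ('a \<times> 'a) set" where "compact_open_partition Y" by (rule KK.partition_exists)
  then interpret Y: compact_open_partition Y .
  obtain \<theta> :: "nat \<Rightarrow> 'a \<times> 'a \<Rightarrow> real" where \<theta>: "\<And>n. test_function (\<theta> n)"
    "\<And>M N. locally_finite_borel M \<Longrightarrow> locally_finite_borel N \<Longrightarrow>
      (\<And>n. (\<integral>x. \<theta> n x \<partial>M) = (\<integral>x. \<theta> n x \<partial>N)) \<Longrightarrow> M = N"
    using Y.determining_family by metis
  define \<Phi> :: "('a, 'a) polyhom \<Rightarrow> nat \<Rightarrow> real" where "\<Phi> P n = (\<integral>x. \<theta> n x \<partial>polh_measure P)" for P n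
  have inj: "P = Q" if "P \<in> Polh_Lambda \<gamma>" "Q \<in> Polh_Lambda \<gamma>" "\<Phi> P = \<Phi> Q" for P Q
  proof -
    have PQ: "P \<in> Polh \<gamma> \<gamma>" "Q \<in> Polh \<gamma> \<gamma>" using that Polh_Lambda_subset by auto
    have "polh_measure P = polh_measure Q"
      using fun_cong[OF that(3)] by (intro \<theta>(2) Polh_measure(1) PQ) (simp add: \<Phi>_def)
    then show ?thesis by (rule polh_measure_inj[OF PQ])
  qed
  \<comment> \<open>A sequentially open \<open>U\<close> contains no limit of a sequence outside
    \<open>U\<close>, so subsequential limits stay in the difference. The case \<open>U = {}\<close>
    gives the whole set.\<close>
  have cpt: "compact (\<Phi> ` (Polh_Lambda \<gamma> - U))" if U: "polh_open \<gamma> \<gamma> U" for U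
    unfolding seq_compact_eq_compact[symmetric] seq_compact_def
  proof (intro allI impI)
    fix f :: "nat \<Rightarrow> nat \<Rightarrow> real" assume "\<forall>n. f n \<in> \<Phi> ` (Polh_Lambda \<gamma> - U)"
    then have "\<forall>n. \<exists>P. P \<in> Polh_Lambda \<gamma> - U \<and> f n = \<Phi> P" by blast
    then obtain X where X: "\<And>n. X n \<in> Polh_Lambda \<gamma> - U" "\<And>n. f n = \<Phi> (X n)" by metis
    have X': "X j \<in> Polh_Lambda \<gamma>" for j using X(1) by blast
    obtain P r where P: "P \<in> Polh_Lambda \<gamma>" and r: "strict_mono (r :: nat \<Rightarrow> nat)" and conv: "polh_converges (X \<circ> r) P"
      using Polh_Lambda_seq_compact[of X] X' by blast
    have "P \<notin> U"
    proof
      assume "P \<in> U"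
      moreover have "range (X \<circ> r) \<subseteq> Polh \<gamma> \<gamma>" using X' Polh_Lambda_subset by auto
      ultimately have "\<forall>\<^sub>F j in sequentially. (X \<circ> r) j \<in> U" using U conv unfolding polh_open_def by blast
      then obtain j where "(X \<circ> r) j \<in> U" unfolding eventually_sequentially by blast
      then show False using X(1) by simp
    qed
    moreover have "(f \<circ> r) \<longlonglongrightarrow> \<Phi> P"
    proof (rule tendsto_fun_coordinatewise)
      show "(\<lambda>j. (f \<circ> r) j n) \<longlonglongrightarrow> \<Phi> P n" for n
        using conv \<theta>(1)[of n] unfolding polh_converges_def by (simp add: X(2) \<Phi>_def)
    qed
    ultimately show "\<exists>l\<in>\<Phi> ` (Polh_Lambda \<gamma> - U). \<exists>r. strict_mono r \<and> (f \<circ> r) \<longlonglongrightarrow> l" using P r by blast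
  qed
  have "polh_open \<gamma> \<gamma> {}" by (simp add: polh_open_def)
  from cpt[OF this] have cptall: "compact (\<Phi> ` Polh_Lambda \<gamma>)" by simp
  \<comment> \<open>Injectivity of \<open>\<Phi>\<close> lets the complement of a compact image, an
    open set of sequences, stand for \<open>U\<close>; covers move to real sequences and
    back.\<close>
  have in_iff: "\<Phi> P \<in> - \<Phi> ` (Polh_Lambda \<gamma> - U) \<longleftrightarrow> P \<in> U" if "P \<in> Polh_Lambda \<gamma>" for P U
    using inj that by blast
  show ?thesis
    unfolding compactin_def openin_polh_topology topspace_polh_topology
  proof (intro conjI allI impI Polh_Lambda_subset)
    fix \<U> assume \<U>: "Ball \<U> (polh_open \<gamma> \<gamma>) \<and> Polh_Lambda \<gamma> \<subseteq> \<Union>\<U>"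
    have "\<Phi> ` Polh_Lambda \<gamma> \<subseteq> (\<Union>U\<in>\<U>. - \<Phi> ` (Polh_Lambda \<gamma> - U))"
    proof
      fix y assume "y \<in> \<Phi> ` Polh_Lambda \<gamma>"
      then obtain P where P: "P \<in> Polh_Lambda \<gamma>" "y = \<Phi> P" by blast
      then obtain U where "U \<in> \<U>" "P \<in> U" using \<U> by blast
      then show "y \<in> (\<Union>U\<in>\<U>. - \<Phi> ` (Polh_Lambda \<gamma> - U))" using in_iff[OF P(1), of U] P(2) by blast
    qed
    moreover have "open (- \<Phi> ` (Polh_Lambda \<gamma> - U))" if "U \<in> \<U>" for U
      using compact_imp_closed[OF cpt[of U]] \<U> that by auto
    ultimately obtain F where F: "F \<subseteq> \<U>" "finite F" "\<Phi> ` Polh_Lambda \<gamma> \<subseteq> (\<Union>U\<in>F. - \<Phi> ` (Polh_Lambda \<gamma> - U))"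
      using compactE_image[OF cptall, of \<U> "\<lambda>U. - \<Phi> ` (Polh_Lambda \<gamma> - U)"] by metis
    have "Polh_Lambda \<gamma> \<subseteq> \<Union>F"
    proof
      fix P assume P: "P \<in> Polh_Lambda \<gamma>"
      then obtain U where "U \<in> F" "\<Phi> P \<in> - \<Phi> ` (Polh_Lambda \<gamma> - U)" using F(3) by blast
      then show "P \<in> \<Union>F" using in_iff[OF P] by blast
    qed
    then show "\<exists>\<F>. finite \<F> \<and> \<F> \<subseteq> \<U> \<and> Polh_Lambda \<gamma> \<subseteq> \<Union>\<F>" using F(1,2) by blast
  qed
qed

end

theorem theorem1p8:
  fixes \<gamma> :: "'a::{topological_group_add,second_countable_topology,t2_space} measure"
    and K0 :: "'a set"
  assumes "locally_compact_space (euclidean :: 'a topology)"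
    and "is_subgroup K0" and "open K0" and "compact K0"
    and "unimodular_haar \<gamma>"
    and "emeasure \<gamma> K0 = 1"
  shows "Polh_Lambda \<gamma> \<subseteq> Polh \<gamma> \<gamma> \<and>
    (\<forall>T\<in>Polh_Lambda \<gamma>. \<forall>R\<in>Polh_Lambda \<gamma>. polh_mult \<gamma> \<gamma> \<gamma> T R \<in> Polh_Lambda \<gamma>) \<and>
    compactin (polh_topology \<gamma> \<gamma>) (Polh_Lambda \<gamma>)"
proof -
  interpret haar_setting \<gamma> K0
    using assms by unfold_locales (simp_all add: cosub_def)
  show ?thesis
    using Polh_Lambda_subset Polh_Lambda_mult compactin_Polh_Lambda by blast
qed

end
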